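(* Let $m,n\ge1$ be integers, let $q$ be an odd prime, and let $H$ be a finite group. Then, modulo $2$, $$s_{\Gamma_m(q)}^H(1,n)\equiv\begin{cases}N_q(n/m), & \text{if } 2\mid m,\ m\mid n\text{ and } q\nmid m,\\ s_q(n/m), & \text{if } 2\nmid m,\ q\nmid m,\ m\mid n\text{ and }2\nmid|H|,\\ N_q(n/m), & \text{if } 2\nmid m,\ q\nmid m,\ m\mid n\text{ and }2\mid|H|,\\ M_q(n/m), & \text{if } q\mid m,\ m\mid n,\ 2\nmid m\text{ and }2\nmid|H|,\\ 0, & \text{otherwise.}\end{cases}$$
   Context: For an odd prime $q$ and a positive integer $m$, $\Gamma_m(q)=\langle x,y\mid x^{2m}=y^{qm}=1,\ x^2=y^q\rangle$, i.e. the free product of cyclic groups of orders $2m$ and $qm$ amalgamated along their subgroups of order $m$. Put $\zeta:=x^2=y^q$, a central element of order $m$. For a finite group $H$ and $n\ge1$, $$s_{\Gamma_m(q)}^H(1,n)=\sum_{\Delta}|\mathrm{Hom}(\Delta,H)|,$$ the sum being over all subgroups $\Delta\le\Gamma_m(q)$ of index $n$ with $\Delta\cap\langle\zeta\rangle=1$. Let $\mathfrak{H}(q)=\langle x,y\mid x^2=y^q=1\rangle\cong C_2*C_q$. By Kurosh's theorem every finite-index subgroup $\Delta\le\mathfrak{H}(q)$ is of the form $\Delta\cong C_2^{*\lambda(\Delta)}*C_q^{*\mu(\Delta)}*F_{\nu(\Delta)}$ with non-negative integers $\lambda(\Delta),\mu(\Delta),\nu(\Delta)$ ($G^{*r}$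 = free product of $r$ copies of $G$; $F_r$ = free group of rank $r$). For $n\ge1$: $s_q(n)$ is the number of all index $n$ subgroups of $\mathfrak{H}(q)$; $M_q(n)$ is the number of index $n$ subgroups $\Delta$ of $\mathfrak{H}(q)$ with $\mu(\Delta)=0$; $N_q(n)$ is the number of index $n$ subgroups of $\mathfrak{H}(q)$ which are isomorphic to a free product of copies of $C_q$ (i.e. $\lambda(\Delta)=\nu(\Delta)=0$). *)

theory Defs
  imports "HOL-Algebra.Elementary_Groups" "HOL-Number_Theory.Cong"
begin

text \<open>A letter \<open>(a, True)\<close> stands for the generator \<open>a\<close>, and \<open>(a, False)\<close> for its formal inverse.\<close>

type_synonym 'a word = "('a \<times> bool) list"

definition words :: "'a set \<Rightarrow> 'a word set" where
  "words S = lists (S \<times> UNIV)"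

definition gen_pow :: "'a \<Rightarrow> nat \<Rightarrow> 'a word" where
  "gen_pow a k = replicate k (a, True)"

text \<open>The least congruence on the words over \<open>S\<close> that cancels adjacent inverse letters and
  identifies \<open>u\<close> with \<open>v\<close> for each defining relation \<open>u = v\<close>, encoded as \<open>(u, v) \<in> R\<close>;
  \<open>R\<close> is meant to be a subset of \<open>words S \<times> words S\<close>.\<close>

inductive_set pres_rel :: "'a set \<Rightarrow> ('a word \<times> 'a word) set \<Rightarrow> ('a word \<times> 'a word) set"
  for S R where
  refl: "w \<in> words S \<Longrightarrow> (w, w) \<in> pres_rel S R"
| sym: "(v, w) \<in> pres_rel S R \<Longrightarrow> (w, v) \<in> pres_rel S R"
| trans: "(u, v) \<in> pres_rel S R \<Longrightarrow> (v, w) \<in> pres_rel S R \<Longrightarrow> (u, w) \<in> pres_rel S R"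
| cancel: "p \<in> words S \<Longrightarrow> s \<in> words S \<Longrightarrow> a \<in> S
    \<Longrightarrow> (p @ [(a, b), (a, \<not> b)] @ s, p @ s) \<in> pres_rel S R"
| relation: "p \<in> words S \<Longrightarrow> s \<in> words S \<Longrightarrow> (u, v) \<in> R
    \<Longrightarrow> (p @ u @ s, p @ v @ s) \<in> pres_rel S R"

definition word_class :: "'a set \<Rightarrow> ('a word \<times> 'a word) set \<Rightarrow> 'a word \<Rightarrow> 'a word set" where
  "word_class S R w = pres_rel S R `` {w}"

definition presented_group :: "'a set \<Rightarrow> ('a word \<times> 'a word) set \<Rightarrow> 'a word set monoid" where
  "presented_group S R =
    \<lparr>carrier = words S // pres_rel S R,
     monoid.mult = (\<lambda>A B. \<Union>u\<in>A. \<Union>v\<in>B. word_class S R (u @ v)),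
     one = word_class S R []\<rparr>"

definition free_group :: "nat \<Rightarrow> nat word set monoid" where
  "free_group r = presented_group {..<r} {}"

text \<open>Free products are presented by all elements of the factors, subject to the
  multiplication tables of the factors.\<close>

definition free_product :: "('a, 'k) monoid_scheme \<Rightarrow> ('b, 'l) monoid_scheme \<Rightarrow> ('a + 'b) word set monoid"
  where
  "free_product G H = presented_group (carrier G <+> carrier H)
    ({([(Inl g, True), (Inl g', True)], [(Inl (g \<otimes>\<^bsub>G\<^esub> g'), True)]) | g g'.
        g \<in> carrier G \<and> g' \<in> carrier G} \<union>
     {([(Inr h, True), (Inr h', True)], [(Inr (h \<otimes>\<^bsub>H\<^esub> h'), True)]) | h h'.
        h \<in> carrier H \<and> h' \<in> carrier H})"

text \<open>The free product of \<open>r\<close> copies of \<open>G\<close>; the first component of a generator tells the copy.\<close>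

definition free_power :: "('a, 'k) monoid_scheme \<Rightarrow> nat \<Rightarrow> (nat \<times> 'a) word set monoid" where
  "free_power G r = presented_group ({..<r} \<times> carrier G)
    {([((i, g), True), ((i, g'), True)], [((i, g \<otimes>\<^bsub>G\<^esub> g'), True)]) | i g g'.
        i < r \<and> g \<in> carrier G \<and> g' \<in> carrier G}"

abbreviation subgrp :: "('a, 'k) monoid_scheme \<Rightarrow> 'a set \<Rightarrow> ('a, 'k) monoid_scheme" where
  "subgrp G D \<equiv> G\<lparr>carrier := D\<rparr>"

text \<open>Used for \<open>n \<ge> 1\<close> only: an infinite set of cosets has cardinality \<open>0\<close>.\<close>

definition subgroups_of_index :: "('a, 'k) monoid_scheme \<Rightarrow> nat \<Rightarrow> 'a set set" where
  "subgroups_of_index G n = {D. subgroup D G \<and> card (rcosets\<^bsub>G\<^esub> D) = n}"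

text \<open>Elements of \<^const>\<open>hom\<close> are unconstrained outside the carrier; counting the extensional ones
  counts each homomorphism exactly once.\<close>

definition num_homs :: "('a, 'k) monoid_scheme \<Rightarrow> ('b, 'l) monoid_scheme \<Rightarrow> nat" where
  "num_homs G H = card (hom G H \<inter> extensional (carrier G))"

datatype gen = Gen_x | Gen_y

definition Gamma_rels :: "nat \<Rightarrow> nat \<Rightarrow> (gen word \<times> gen word) set" where
  "Gamma_rels m q = {(gen_pow Gen_x (2 * m), []), (gen_pow Gen_y (q * m), []), (gen_pow Gen_x 2, gen_pow Gen_y q)}"

definition Gamma :: "nat \<Rightarrow> nat \<Rightarrow> gen word set monoid" where
  "Gamma m q = presented_group UNIV (Gamma_rels m q)"

definition zeta :: "nat \<Rightarrow> nat \<Rightarrow> gen word set" where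
  "zeta m q = word_class UNIV (Gamma_rels m q) (gen_pow Gen_x 2)"

definition s_Gamma :: "nat \<Rightarrow> nat \<Rightarrow> ('h, 'k) monoid_scheme \<Rightarrow> nat \<Rightarrow> nat" where
  "s_Gamma m q H n =
    (\<Sum>D | D \<in> subgroups_of_index (Gamma m q) n \<and>
            D \<inter> generate (Gamma m q) {zeta m q} = {\<one>\<^bsub>Gamma m q\<^esub>}.
       num_homs (subgrp (Gamma m q) D) H)"

definition Hecke :: "nat \<Rightarrow> gen word set monoid" where
  "Hecke q = presented_group UNIV {(gen_pow Gen_x 2, []), (gen_pow Gen_y q, [])}"

text \<open>\<open>C\<^sub>2\<^sup>*\<^sup>l * C\<^sub>q\<^sup>*\<^sup>u * F\<^sub>v\<close>\<close>

definition kurosh_product where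
  "kurosh_product q l u v =
    free_product
      (free_product (free_power (integer_mod_group 2) l) (free_power (integer_mod_group q) u))
      (free_group v)"

definition s_q :: "nat \<Rightarrow> nat \<Rightarrow> nat" where
  "s_q q n = card (subgroups_of_index (Hecke q) n)"

text \<open>The parameters \<open>\<lambda>(\<Delta>)\<close>, \<open>\<mu>(\<Delta>)\<close>, \<open>\<nu>(\<Delta>)\<close> are the unique \<open>l\<close>, \<open>u\<close>, \<open>v\<close> with
  \<open>\<Delta> \<cong> kurosh_product q l u v\<close>, so \<open>\<mu>(\<Delta>) = 0\<close> says that such an isomorphism exists with \<open>u = 0\<close>.\<close>

definition M_q :: "nat \<Rightarrow> nat \<Rightarrow> nat" where
  "M_q q n = card {D \<in> subgroups_of_index (Hecke q) n.
     \<exists>l v. subgrp (Hecke q) D \<cong> kurosh_product q l 0 v}"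

definition N_q :: "nat \<Rightarrow> nat \<Rightarrow> nat" where
  "N_q q n = card {D \<in> subgroups_of_index (Hecke q) n.
     \<exists>u. subgrp (Hecke q) D \<cong> free_power (integer_mod_group q) u}"

end

theory Submission
  imports Defs
begin

text \<open>Put \<open>G = Gamma m q\<close>, and let \<open>Z\<close> be its central subgroup generated by \<open>zeta\<close>, so that
  \<open>G\<close> is an extension of \<open>Hecke q\<close> by \<open>Z\<close>, with projection \<open>\<pi>\<close>; the order of \<open>Z\<close> is exactly \<open>m\<close>,
  as a homomorphism to a cyclic group of order \<open>2 q m\<close> shows. A subgroup \<open>\<Delta>\<close> of index \<open>n\<close> that meets
  \<open>Z\<close> trivially maps isomorphically onto a subgroup \<open>D = \<pi> ` \<Delta>\<close> with
  \<open>n = m * index of D\<close> (\<open>card_rcosets_complement\<close>). Hence the sum vanishes unless \<open>m\<close> divides \<open>n\<close>, and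
  otherwise it is the sum, over the finitely many subgroups \<open>D\<close> of \<open>Hecke q\<close> of index \<open>n div m\<close>, of the
  number of lifts \<open>\<Delta>\<close> of \<open>D\<close> times the number of homomorphisms from \<open>D\<close> to the finite group
  (\<open>s_Gamma_eq\<close>).

  By Kurosh's theorem, \<open>D\<close> is a free product of cyclic groups: it has a basis of elements \<open>e j\<close> whose
  orders \<open>d j\<close> are \<open>2\<close> (conjugates of \<open>x\<close>), \<open>q\<close> (conjugates of \<open>y\<close>) or infinite, which is encoded as
  \<open>0\<close>. The proof (\<open>stab_basis\<close>) works on the set of cosets of \<open>D\<close>. A spanning tree, whose vertices are
  the orbits of \<open>y\<close> and whose edges are two-element orbits of \<open>x\<close>, gives a transversal; the Schreier
  generators that the tree leaves over generate \<open>D\<close>, and they are free because the coset action lifts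
  to a covering whose fibre is the abstract free product. Some generator is always left over, so \<open>D\<close>
  is not trivial.

  A lift of \<open>D\<close> amounts to a section of \<open>\<pi>\<close> over \<open>D\<close>, and hence to a choice, for each \<open>j\<close>, of a preimage
  \<open>g\<close> of \<open>e j\<close> with \<open>g ^ d j = 1\<close> (\<open>bij_betw_lifts\<close>). There are \<open>m\<close> such preimages if \<open>d j = 0\<close>. If
  \<open>d j\<close> is \<open>2\<close> or \<open>q\<close> there is one or none, according to whether \<open>d j\<close> is prime to \<open>m\<close> or divides \<open>m\<close>
  (\<open>card_root_lifts\<close>). Likewise, a homomorphism from \<open>D\<close> to the finite group \<open>K\<close> amounts to a choice of
  elements \<open>h\<close> of \<open>K\<close> with \<open>h ^ d j = 1\<close>, and pairing elements with their inverses shows that their number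
  is odd if \<open>d j = q\<close> and has the parity of the order of \<open>K\<close> if \<open>d j\<close> is \<open>2\<close> or \<open>0\<close>. So the contribution
  of \<open>D\<close> is odd if and only if
  \<^item> there is no \<open>j\<close> with \<open>d j \<noteq> q\<close>, or both \<open>m\<close> and the order of \<open>K\<close> are odd; and
  \<^item> there is no \<open>j\<close> with \<open>d j = q\<close>, or \<open>q\<close> does not divide \<open>m\<close>.

  In the four cases that arise, this condition always holds, or it says that all \<open>d j\<close> equal \<open>q\<close>, or that
  no \<open>d j\<close> equals \<open>q\<close>, or it never holds, as there is at least one \<open>j\<close>. These conditions on \<open>d\<close> are the
  isomorphism types that \<open>N_q\<close> and \<open>M_q\<close> count (\<open>iso_free_power_iff\<close>, \<open>iso_kurosh_no_q_iff\<close>), because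
  homomorphisms to cyclic groups of prime order determine how often each order occurs.\<close>

section \<open>Groups given by presentations\<close>

lemma words_Nil [simp]: "[] \<in> words S"
  by (simp add: words_def)

lemma words_append [simp]: "u @ v \<in> words S \<longleftrightarrow> u \<in> words S \<and> v \<in> words S"
  by (auto simp: words_def)

lemma words_Cons [simp]: "l # v \<in> words S \<longleftrightarrow> fst l \<in> S \<and> v \<in> words S"
  by (cases l) (auto simp: words_def)

lemma words_gen_pow [simp]: "a \<in> S \<Longrightarrow> gen_pow a k \<in> words S"
  by (induction k) (auto simp: gen_pow_def)

lemma words_UNIV [simp]: "w \<in> words UNIV"
  by (auto simp: words_def)

text \<open>The formal inverse of a word.\<close>

definition inv_word :: "'a word \<Rightarrow> 'a word" where
  "inv_word w = rev (map (\<lambda>(a, b). (a, \<not> b)) w)"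

lemma words_inv_word [simp]: "inv_word w \<in> words S \<longleftrightarrow> w \<in> words S"
  by (auto simp: inv_word_def words_def in_lists_conv_set)

text \<open>A presentation acts on a set \<open>Y\<close> as soon as the letters act by mutually inverse maps that
  satisfy the relations; words then act by composing their letters.\<close>

lemma pres_rel_foldr:
  assumes maps: "\<And>l s. fst l \<in> S \<Longrightarrow> s \<in> Y \<Longrightarrow> F l s \<in> Y"
    and cancel: "\<And>a b s. a \<in> S \<Longrightarrow> s \<in> Y \<Longrightarrow> F (a, b) (F (a, \<not> b) s) = s"
    and rel: "\<And>u v s. (u, v) \<in> R \<Longrightarrow> s \<in> Y \<Longrightarrow> foldr F u s = foldr F v s"
  shows "(u, v) \<in> pres_rel S R \<Longrightarrow> s \<in> Y \<Longrightarrow> foldr F u s = foldr F v s"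
proof -
  have mem: "foldr F w s \<in> Y" if "w \<in> words S" "s \<in> Y" for w s
    using that by (induction w) (auto intro!: maps)
  show "(u, v) \<in> pres_rel S R \<Longrightarrow> s \<in> Y \<Longrightarrow> foldr F u s = foldr F v s"
    by (induction rule: pres_rel.induct) (auto simp: cancel rel mem)
qed

locale presentation =
  fixes S :: "'a set" and R :: "('a word \<times> 'a word) set"
  assumes R_words: "R \<subseteq> words S \<times> words S"
begin

abbreviation "cls \<equiv> word_class S R"

abbreviation "P \<equiv> presented_group S R"

text \<open>The element of the presented group that is represented by the generator \<open>a\<close>.\<close>

definition gen :: "'a \<Rightarrow> 'a word set" where
  "gen a = cls [(a, True)]"

lemma pres_rel_words: "(u, v) \<in> pres_rel S R \<Longrightarrow> u \<in> words S \<and> v \<in> words S"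
  by (induction rule: pres_rel.induct) (use R_words in auto)

lemma equiv_pres_rel: "equiv (words S) (pres_rel S R)"
  by (intro equivI refl_onI symI transI subsetI)
     (use pres_rel_words in \<open>auto intro: pres_rel.intros\<close>)

lemma pres_rel_prepend: "(u, v) \<in> pres_rel S R \<Longrightarrow> p \<in> words S \<Longrightarrow> (p @ u, p @ v) \<in> pres_rel S R"
proof (induction rule: pres_rel.induct)
  case (cancel p' s a b)
  then show ?case using pres_rel.cancel[of "p @ p'" S s a b R] by simp
next
  case (relation p' s u v)
  then show ?case using pres_rel.relation[of "p @ p'" S s u v R] by simp
qed (auto intro: pres_rel.intros)

lemma pres_rel_append: "(u, v) \<in> pres_rel S R \<Longrightarrow> p \<in> words S \<Longrightarrow> (u @ p, v @ p) \<in> pres_rel S R"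
proof (induction rule: pres_rel.induct)
  case (cancel p' s a b)
  then show ?case using pres_rel.cancel[of p' S "s @ p" a b R] by simp
next
  case (relation p' s u v)
  then show ?case using pres_rel.relation[of p' S "s @ p" u v R] by simp
qed (auto intro: pres_rel.intros)

lemma cls_eq_iff: "u \<in> words S \<Longrightarrow> v \<in> words S \<Longrightarrow> cls u = cls v \<longleftrightarrow> (u, v) \<in> pres_rel S R"
  unfolding word_class_def using eq_equiv_class_iff[OF equiv_pres_rel] by blast

lemma mem_cls: "v \<in> cls u \<longleftrightarrow> (u, v) \<in> pres_rel S R"
  by (simp add: word_class_def)

lemma carrier_P: "carrier P = cls ` words S"
  by (auto simp: presented_group_def quotient_def word_class_def)

lemma cls_closed [simp]: "w \<in> words S \<Longrightarrow> cls w \<in> carrier P"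
  by (simp add: carrier_P)

lemma one_P: "\<one>\<^bsub>P\<^esub> = cls []"
  by (simp add: presented_group_def)

lemma mult_cls:
  assumes "u \<in> words S" "v \<in> words S"
  shows "cls u \<otimes>\<^bsub>P\<^esub> cls v = cls (u @ v)"
proof -
  have "cls (u' @ v') = cls (u @ v)" if "u' \<in> cls u" "v' \<in> cls v" for u' v'
  proof -
    have "(u, u') \<in> pres_rel S R" "(v, v') \<in> pres_rel S R"
      using that by (auto simp: mem_cls)
    then have "(u @ v, u' @ v') \<in> pres_rel S R"
      by (meson pres_rel.trans pres_rel_append pres_rel_prepend pres_rel_words)
    then show ?thesis
      using pres_rel_words cls_eq_iff by metis
  qed
  moreover have "u \<in> cls u" "v \<in> cls v"
    using assms by (auto simp: mem_cls pres_rel.refl)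
  ultimately have "(\<Union>u\<in>cls u. \<Union>v\<in>cls v. cls (u @ v)) = cls (u @ v)"
    by blast
  then show ?thesis by (simp add: presented_group_def)
qed

lemma cls_inv_word: "w \<in> words S \<Longrightarrow> cls (inv_word w @ w) = cls []"
proof (induction w)
  case (Cons l w)
  obtain a b where l: "l = (a, b)" by (cases l)
  have "(inv_word w @ [(a, \<not> b), (a, \<not> \<not> b)] @ w, inv_word w @ w) \<in> pres_rel S R"
    using Cons l by (intro pres_rel.cancel) auto
  then show ?case
    using Cons l pres_rel_words[of "inv_word w @ [(a, \<not> b), (a, \<not> \<not> b)] @ w"]
    by (metis (no_types, lifting) append.assoc append_Cons append_Nil case_prod_conv cls_eq_iff inv_word_def list.simps(9) rev.simps(2) words_Cons)
qed (simp add: inv_word_def)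

lemma group_P: "group P"
proof (rule groupI)
  show "\<exists>y\<in>carrier P. y \<otimes>\<^bsub>P\<^esub> x = \<one>\<^bsub>P\<^esub>" if x: "x \<in> carrier P" for x
  proof -
    obtain w where w: "w \<in> words S" "x = cls w" using x unfolding carrier_P by blast
    then have "cls (inv_word w) \<otimes>\<^bsub>P\<^esub> x = \<one>\<^bsub>P\<^esub>"
      by (simp add: mult_cls one_P cls_inv_word)
    then show ?thesis using w by (meson cls_closed words_inv_word)
  qed
qed (auto simp: carrier_P one_P mult_cls)

sublocale P: group P by (rule group_P)

lemma gen_closed [simp]: "a \<in> S \<Longrightarrow> gen a \<in> carrier P"
  by (simp add: gen_def)

lemma cls_gen_pow: "a \<in> S \<Longrightarrow> cls (gen_pow a k) = gen a [^]\<^bsub>P\<^esub> k"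
proof (induction k)
  case (Suc k)
  have "gen_pow a (Suc k) = gen_pow a k @ [(a, True)]"
    by (simp add: gen_pow_def replicate_append_same)
  then show ?case using Suc mult_cls[of "gen_pow a k" "[(a, True)]"] by (simp add: gen_def)
qed (simp add: gen_pow_def one_P)

lemma cls_rel: "(u, v) \<in> R \<Longrightarrow> cls u = cls v"
  using R_words pres_rel.relation[of "[]" S "[]" u v R] cls_eq_iff[of u v] by auto

lemma gen_mult:
  assumes "([(a, True), (b, True)], [(c, True)]) \<in> R" "a \<in> S" "b \<in> S"
  shows "gen a \<otimes>\<^bsub>P\<^esub> gen b = gen c"
  using cls_rel[OF assms(1)] mult_cls[of "[(a, True)]" "[(b, True)]"] assms by (simp add: gen_def)

lemma cls_False: "a \<in> S \<Longrightarrow> cls [(a, False)] = inv\<^bsub>P\<^esub> (gen a)"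
  using cls_inv_word[of "[(a, True)]"] mult_cls[of "[(a, False)]" "[(a, True)]"]
  by (intro P.inv_equality[symmetric]) (auto simp: gen_def one_P inv_word_def)

lemma generate_gen: "generate P (gen ` S) = carrier P"
proof
  show "generate P (gen ` S) \<subseteq> carrier P"
    by (rule P.generate_incl) auto
  have "cls w \<in> generate P (gen ` S)" if "w \<in> words S" for w
    using that
  proof (induction w)
    case Nil
    then show ?case using generate.one[of P] by (simp add: one_P)
  next
    case (Cons l w)
    obtain a b where l: "l = (a, b)" by (cases l)
    have "cls [l] \<in> generate P (gen ` S)"
      using Cons.prems l by (cases b) (auto simp: cls_False gen_def[symmetric] intro: generate.incl generate.inv)
    then have "cls [l] \<otimes>\<^bsub>P\<^esub> cls w \<in> generate P (gen ` S)"
      using Cons by (auto intro: generate.eng)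
    then show ?case using Cons.prems by (simp add: mult_cls)
  qed
  then show "carrier P \<subseteq> generate P (gen ` S)"
    by (auto simp: carrier_P)
qed

end

text \<open>The value of a word in a group under the substitution \<open>f\<close> of the generators.\<close>

definition eval_word :: "('g, 'k) monoid_scheme \<Rightarrow> ('a \<Rightarrow> 'g) \<Rightarrow> 'a word \<Rightarrow> 'g" where
  "eval_word G f w = foldr (\<lambda>(a, b) g. (if b then f a else inv\<^bsub>G\<^esub> f a) \<otimes>\<^bsub>G\<^esub> g) w \<one>\<^bsub>G\<^esub>"

lemma (in group) eval_word_simps:
  "eval_word G f [] = \<one>"
  "f a \<in> carrier G \<Longrightarrow> eval_word G f [(a, True)] = f a"
  "f a \<in> carrier G \<Longrightarrow> f b \<in> carrier G \<Longrightarrow> eval_word G f [(a, True), (b, True)] = f a \<otimes> f b"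
  by (auto simp: eval_word_def)

lemma (in group) eval_word_gen_pow: "f a \<in> carrier G \<Longrightarrow> eval_word G f (gen_pow a k) = f a [^] k"
proof (induction k)
  case (Suc k)
  then have "eval_word G f (gen_pow a (Suc k)) = f a \<otimes> f a [^] k"
    by (simp add: eval_word_def gen_pow_def)
  then show ?case using Suc.prems by (metis nat_pow_Suc2)
qed (simp add: eval_word_def gen_pow_def)

context presentation
begin

text \<open>The universal property of a presented group.\<close>

lemma ex_hom:
  assumes "group G" and f: "\<And>a. a \<in> S \<Longrightarrow> f a \<in> carrier G"
    and rel: "\<And>u v. (u, v) \<in> R \<Longrightarrow> eval_word G f u = eval_word G f v"
  obtains \<phi> where "\<phi> \<in> hom P G" "\<And>a. a \<in> S \<Longrightarrow> \<phi> (gen a) = f a"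
proof -
  interpret G: group G by fact
  define F where "F = (\<lambda>(a, b) g. (if b then f a else inv\<^bsub>G\<^esub> f a) \<otimes>\<^bsub>G\<^esub> g)"
  have F_closed: "F l g \<in> carrier G" if "fst l \<in> S" "g \<in> carrier G" for l g
    using that f by (auto simp: F_def split: prod.split)
  have fold_closed: "foldr F w g \<in> carrier G" if "w \<in> words S" "g \<in> carrier G" for w g
    using that by (induction w) (auto intro!: F_closed)
  have eval_closed: "eval_word G f w \<in> carrier G" if "w \<in> words S" for w
    using fold_closed[OF that] by (simp add: eval_word_def F_def)
  have fold_mult: "foldr F w g = eval_word G f w \<otimes>\<^bsub>G\<^esub> g" if "w \<in> words S" "g \<in> carrier G" for w g
    using that
  proof (induction w)
    case (Cons l w)
    obtain a b where l: "l = (a, b)" by (cases l)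
    have "eval_word G f (l # w) = F l (eval_word G f w)"
      by (simp add: eval_word_def F_def)
    then show ?case
      using Cons l f eval_closed by (auto simp: F_def G.m_assoc)
  qed (simp add: G.eval_word_simps)
  have eq: "eval_word G f u = eval_word G f v" if "(u, v) \<in> pres_rel S R" for u v
  proof -
    have "foldr F u \<one>\<^bsub>G\<^esub> = foldr F v \<one>\<^bsub>G\<^esub>"
    proof (rule pres_rel_foldr[OF _ _ _ that, where Y = "carrier G"])
      show "F (a, b) (F (a, \<not> b) s) = s" if "a \<in> S" "s \<in> carrier G" for a b s
        using that f by (auto simp: F_def G.m_assoc[symmetric])
      show "foldr F u s = foldr F v s" if "(u, v) \<in> R" "s \<in> carrier G" for u v s
        using that R_words by (auto simp: fold_mult rel)
    qed (auto intro: F_closed)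
    then show ?thesis by (simp add: eval_word_def F_def)
  qed
  define \<phi> where "\<phi> = (\<lambda>C. eval_word G f (SOME w. w \<in> C))"
  have \<phi>: "\<phi> (cls w) = eval_word G f w" if "w \<in> words S" for w
  proof -
    have "w \<in> cls w" using that by (simp add: mem_cls pres_rel.refl)
    then have "(SOME w'. w' \<in> cls w) \<in> cls w" by (rule someI)
    then show ?thesis unfolding \<phi>_def mem_cls using eq by metis
  qed
  have app: "eval_word G f (u @ v) = eval_word G f u \<otimes>\<^bsub>G\<^esub> eval_word G f v"
    if "u \<in> words S" "v \<in> words S" for u v
    using fold_mult[OF that(1) eval_closed[OF that(2)]] by (simp add: eval_word_def F_def)
  have "\<phi> \<in> hom P G"
    by (auto simp: hom_def carrier_P \<phi> mult_cls app eval_closed)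
  moreover have "\<phi> (gen a) = f a" if "a \<in> S" for a
    using that f by (simp add: gen_def \<phi> G.eval_word_simps)
  ultimately show ?thesis using that by blast
qed

end

lemma hom_eq_on_generate:
  assumes "group G" "group H" "\<phi> \<in> hom G H" "\<psi> \<in> hom G H" "X \<subseteq> carrier G"
    and "\<And>x. x \<in> X \<Longrightarrow> \<phi> x = \<psi> x" and g: "g \<in> generate G X"
  shows "\<phi> g = \<psi> g"
proof -
  interpret \<phi>: group_hom G H \<phi> using assms by (simp add: group_hom_def group_hom_axioms_def)
  interpret \<psi>: group_hom G H \<psi> using assms by (simp add: group_hom_def group_hom_axioms_def)
  show ?thesis using g
  proof (induction rule: generate.induct)
    case (eng h1 h2)
    then have "h1 \<in> carrier G" "h2 \<in> carrier G"
      using assms \<phi>.G.generate_in_carrier by blast+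
    then show ?case using eng by simp
  next
    case (inv h)
    then show ?case using assms by (metis \<phi>.hom_inv \<psi>.hom_inv subsetD)
  qed (use assms in auto)
qed

lemma (in presentation) hom_eqI:
  assumes "group G" "\<phi> \<in> hom P G" "\<psi> \<in> hom P G" "\<And>a. a \<in> S \<Longrightarrow> \<phi> (gen a) = \<psi> (gen a)"
    and "g \<in> carrier P"
  shows "\<phi> g = \<psi> g"
  by (rule hom_eq_on_generate[OF group_P assms(1-3), of "gen ` S"])
     (use assms in \<open>auto simp: generate_gen\<close>)

section \<open>Free products of cyclic groups\<close>

lemma (in group) pow_mod_exponent:
  assumes "x \<in> carrier G" "x [^] k = \<one>"
  shows "x [^] (n mod k :: nat) = x [^] n"
proof -
  have "x [^] n = x [^] (k * (n div k) + n mod k)" by simp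
  also have "\<dots> = (x [^] k) [^] (n div k) \<otimes> x [^] (n mod k)"
    by (simp only: nat_pow_mult[OF assms(1), symmetric] nat_pow_pow[OF assms(1)])
  finally show ?thesis using assms by simp
qed

text \<open>The free product \<open>cyc J d\<close> of cyclic groups, with one generator of order \<open>d j\<close> for each \<open>j \<in> J\<close>.
  The order \<open>0\<close> stands for an infinite cyclic factor, as its relation \<open>gen_pow j 0 = []\<close> is void.\<close>

definition cyc_rels :: "'j set \<Rightarrow> ('j \<Rightarrow> nat) \<Rightarrow> ('j word \<times> 'j word) set" where
  "cyc_rels J d = (\<lambda>j. (gen_pow j (d j), [])) ` J"

abbreviation cyc :: "'j set \<Rightarrow> ('j \<Rightarrow> nat) \<Rightarrow> 'j word set monoid" where
  "cyc J d \<equiv> presented_group J (cyc_rels J d)"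

lemma mem_cyc_rels: "j \<in> J \<Longrightarrow> (gen_pow j (d j), []) \<in> cyc_rels J d"
  by (simp add: cyc_rels_def)

interpretation cyc: presentation J "cyc_rels J d" for J d
  by unfold_locales (auto simp: cyc_rels_def)

lemma restrict_hom: "group G \<Longrightarrow> \<phi> \<in> hom G H \<Longrightarrow> restrict \<phi> (carrier G) \<in> hom G H"
  by (auto simp: hom_def group.is_monoid monoid.m_closed)

lemma cyc_gen_pow: "j \<in> J \<Longrightarrow> cyc.gen J d j [^]\<^bsub>cyc J d\<^esub> d j = \<one>\<^bsub>cyc J d\<^esub>"
  using cyc.cls_rel[of "gen_pow j (d j)" "[]" J d] cyc.cls_gen_pow[of j J d "d j"]
    cyc.one_P[of J d] by (simp add: mem_cyc_rels)

lemma ex_cyc_hom: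
  assumes "group G" and f: "\<And>j. j \<in> J \<Longrightarrow> f j \<in> carrier G"
    and rel: "\<And>j. j \<in> J \<Longrightarrow> f j [^]\<^bsub>G\<^esub> d j = \<one>\<^bsub>G\<^esub>"
  obtains \<phi> where "\<phi> \<in> hom (cyc J d) G" "\<And>j. j \<in> J \<Longrightarrow> \<phi> (cyc.gen J d j) = f j"
proof -
  interpret G: group G by fact
  have "eval_word G f u = eval_word G f v" if "(u, v) \<in> cyc_rels J d" for u v
    using that f rel by (auto simp: cyc_rels_def G.eval_word_gen_pow G.eval_word_simps)
  then obtain \<phi> where "\<phi> \<in> hom (cyc J d) G" "\<And>j. j \<in> J \<Longrightarrow> \<phi> (cyc.gen J d j) = f j"
    using cyc.ex_hom[where f = f and J = J and d = d, OF \<open>group G\<close> f] by metis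
  then show ?thesis by (rule that)
qed

lemma group_homI: "group G \<Longrightarrow> group H \<Longrightarrow> \<phi> \<in> hom G H \<Longrightarrow> group_hom G H \<phi>"
  by (simp add: group_hom_def group_hom_axioms_def)

text \<open>Homomorphisms on \<open>cyc J d\<close> correspond to families of elements whose orders divide \<open>d\<close>; the sets
  \<open>A j\<close> allow for further constraints on the values at the generators.\<close>

lemma bij_betw_cyc_homs:
  assumes "group G"
    and A: "\<And>j. j \<in> J \<Longrightarrow> A j \<subseteq> {g \<in> carrier G. g [^]\<^bsub>G\<^esub> d j = \<one>\<^bsub>G\<^esub>}"
  shows "bij_betw (\<lambda>\<phi>. restrict (\<lambda>j. \<phi> (cyc.gen J d j)) J)
    {\<phi> \<in> hom (cyc J d) G \<inter> extensional (carrier (cyc J d)). \<forall>j\<in>J. \<phi> (cyc.gen J d j) \<in> A j} (PiE J A)"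
proof -
  let ?C = "cyc J d" and ?g = "cyc.gen J d"
  let ?L = "{\<phi> \<in> hom ?C G \<inter> extensional (carrier ?C). \<forall>j\<in>J. \<phi> (?g j) \<in> A j}"
  let ?r = "\<lambda>\<phi>. restrict (\<lambda>j. \<phi> (?g j)) J"
  show "bij_betw ?r ?L (PiE J A)"
  proof (rule bij_betw_imageI)
    show "inj_on ?r ?L"
    proof (rule inj_onI)
      fix \<phi> \<psi> assume \<phi>: "\<phi> \<in> ?L" and \<psi>: "\<psi> \<in> ?L" and eq: "?r \<phi> = ?r \<psi>"
      have "\<phi> (?g j) = \<psi> (?g j)" if "j \<in> J" for j
        using fun_cong[OF eq, of j] that by simp
      then have "\<phi> x = \<psi> x" if "x \<in> carrier ?C" for x
        using \<phi> \<psi> by (intro cyc.hom_eqI[OF \<open>group G\<close> _ _ _ that, of \<phi> \<psi>]) auto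
      then show "\<phi> = \<psi>" using \<phi> \<psi> by (intro extensionalityI) auto
    qed
    show "?r ` ?L = PiE J A"
    proof
      show "?r ` ?L \<subseteq> PiE J A" by auto
      show "PiE J A \<subseteq> ?r ` ?L"
      proof
        fix f assume f: "f \<in> PiE J A"
        then have "f j \<in> carrier G" "f j [^]\<^bsub>G\<^esub> d j = \<one>\<^bsub>G\<^esub>" if "j \<in> J" for j
          using A that by (auto dest!: PiE_mem)
        then obtain \<phi> where \<phi>: "\<phi> \<in> hom ?C G" "\<And>j. j \<in> J \<Longrightarrow> \<phi> (?g j) = f j"
          using ex_cyc_hom[OF \<open>group G\<close>, of J f d] by blast
        let ?\<phi> = "restrict \<phi> (carrier ?C)"
        have eq: "?\<phi> (?g j) = f j" if "j \<in> J" for j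
          using \<phi>(2)[OF that] that by simp
        have "f = ?r ?\<phi>"
          using f eq by (intro extensionalityI[of _ J]) (simp_all add: PiE_def del: restrict_apply, simp add: restrict_def)
        have "f j \<in> A j" if "j \<in> J" for j using f that by (rule PiE_mem)
        then have "?\<phi> \<in> ?L"
          using eq restrict_hom[OF cyc.group_P \<phi>(1)] by (simp del: restrict_apply)
        with \<open>f = ?r ?\<phi>\<close> show "f \<in> ?r ` ?L" by (rule image_eqI)
      qed
    qed
  qed
qed

lemma card_cyc_homs:
  assumes "group G" "finite J"
    and A: "\<And>j. j \<in> J \<Longrightarrow> A j \<subseteq> {g \<in> carrier G. g [^]\<^bsub>G\<^esub> d j = \<one>\<^bsub>G\<^esub>}"
  shows "card {\<phi> \<in> hom (cyc J d) G \<inter> extensional (carrier (cyc J d)). \<forall>j\<in>J. \<phi> (cyc.gen J d j) \<in> A j}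
    = (\<Prod>j\<in>J. card (A j))"
  using bij_betw_same_card[OF bij_betw_cyc_homs[of G J A d, OF assms(1) A]] card_PiE[OF \<open>finite J\<close>, of A]
  by simp

corollary num_homs_cyc:
  assumes "group G" "finite J"
  shows "num_homs (cyc J d) G = (\<Prod>j\<in>J. card {g \<in> carrier G. g [^]\<^bsub>G\<^esub> d j = \<one>\<^bsub>G\<^esub>})"
proof -
  have "\<phi> (cyc.gen J d j) \<in> carrier G \<and> \<phi> (cyc.gen J d j) [^]\<^bsub>G\<^esub> d j = \<one>\<^bsub>G\<^esub>"
    if "\<phi> \<in> hom (cyc J d) G" "j \<in> J" for \<phi> j
  proof -
    interpret group_hom "cyc J d" G \<phi> using assms that by (intro group_homI) auto
    show ?thesis using that cyc_gen_pow[of j J d] by (simp flip: hom_nat_pow)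
  qed
  then have "{\<phi> \<in> hom (cyc J d) G \<inter> extensional (carrier (cyc J d)). \<forall>j\<in>J. \<phi> (cyc.gen J d j)
      \<in> {g \<in> carrier G. g [^]\<^bsub>G\<^esub> d j = \<one>\<^bsub>G\<^esub>}} = hom (cyc J d) G \<inter> extensional (carrier (cyc J d))"
    by blast
  then show ?thesis
    unfolding num_homs_def using card_cyc_homs[OF assms, of "\<lambda>j. {g \<in> carrier G. g [^]\<^bsub>G\<^esub> d j = \<one>\<^bsub>G\<^esub>}" d]
    by simp
qed

lemma num_homs_iso:
  assumes "group G" "G \<cong> G'"
  shows "num_homs G H = num_homs G' H"
proof -
  obtain i where i: "i \<in> iso G G'" using assms by (auto simp: is_iso_def)
  then have hi: "i \<in> hom G G'" and bi: "bij_betw i (carrier G) (carrier G')" by (auto simp: iso_def)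
  define k where "k = inv_into (carrier G) i"
  have hk: "k \<in> hom G' G" using group.iso_set_sym[OF assms(1) i] by (auto simp: iso_def k_def)
  have ki: "k (i x) = x" if "x \<in> carrier G" for x
    using bi that by (simp add: k_def bij_betw_def)
  have ik: "i (k x) = x" if "x \<in> carrier G'" for x
    using bi that by (simp add: k_def bij_betw_inv_into_right)
  have ic: "i x \<in> carrier G'" if "x \<in> carrier G" for x using hi that by (auto simp: hom_def)
  have kc: "k x \<in> carrier G" if "x \<in> carrier G'" for x using hk that by (auto simp: hom_def)
  have 1: "restrict (\<phi> \<circ> i) (carrier G) \<in> hom G H" if "\<phi> \<in> hom G' H" for \<phi>
    by (rule restrict_hom[OF assms(1) hom_compose[OF hi that]])
  have 2: "restrict (\<phi> \<circ> k) (carrier G') \<in> hom G' H" if "\<phi> \<in> hom G H" for \<phi>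
  proof -
    have "\<phi> \<circ> k \<in> hom G' H" by (rule hom_compose[OF hk that])
    moreover have "x \<otimes>\<^bsub>G'\<^esub> y \<in> carrier G'" if "x \<in> carrier G'" "y \<in> carrier G'" for x y
    proof -
      have "x \<otimes>\<^bsub>G'\<^esub> y = i (k x \<otimes>\<^bsub>G\<^esub> k y)"
        using that by (simp add: hom_mult[OF hi] kc ik)
      then show ?thesis
        using that ic kc assms(1) by (simp add: group.is_monoid monoid.m_closed)
    qed
    ultimately show ?thesis by (auto simp: hom_def Pi_iff)
  qed
  have "bij_betw (\<lambda>\<phi>. restrict (\<phi> \<circ> i) (carrier G))
      (hom G' H \<inter> extensional (carrier G')) (hom G H \<inter> extensional (carrier G))"
  proof (rule bij_betwI[where g = "\<lambda>\<phi>. restrict (\<phi> \<circ> k) (carrier G')"])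
    show "restrict (restrict (\<phi> \<circ> i) (carrier G) \<circ> k) (carrier G') = \<phi>"
      if "\<phi> \<in> hom G' H \<inter> extensional (carrier G')" for \<phi>
      using that by (intro extensionalityI[of _ "carrier G'"]) (auto simp: ik kc)
    show "restrict (restrict (\<phi> \<circ> k) (carrier G') \<circ> i) (carrier G) = \<phi>"
      if "\<phi> \<in> hom G H \<inter> extensional (carrier G)" for \<phi>
      using that by (intro extensionalityI[of _ "carrier G"]) (auto simp: ki ic)
  qed (use 1 2 in auto)
  then show ?thesis unfolding num_homs_def by (metis bij_betw_same_card)
qed

lemma card_roots_integer_mod_group:
  assumes "prime p"
  shows "card {g \<in> carrier (integer_mod_group p).
      g [^]\<^bsub>integer_mod_group p\<^esub> k = \<one>\<^bsub>integer_mod_group p\<^esub>} = (if p dvd k then p else 1)"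
proof (cases "p dvd k")
  case True
  then have "{g \<in> carrier (integer_mod_group p).
      g [^]\<^bsub>integer_mod_group p\<^esub> k = \<one>\<^bsub>integer_mod_group p\<^esub>} = {0..<int p}"
    using prime_gt_0_nat[OF assms] by (auto simp: carrier_integer_mod_group)
  then have "card {g \<in> carrier (integer_mod_group p).
      g [^]\<^bsub>integer_mod_group p\<^esub> k = \<one>\<^bsub>integer_mod_group p\<^esub>} = card {0..<int p}"
    by (rule arg_cong)
  then show ?thesis using True by simp
next
  case False
  have "g = 0" if "0 \<le> g" "g < int p" "int p dvd int k * g" for g
  proof -
    have "int p dvd g"
      using that False assms prime_dvd_mult_iff[of "int p" "int k" g] by simp
    then show ?thesis using that zdvd_imp_le[of "int p" g] by linarith
  qed
  moreover have "p \<noteq> 0" using assms by auto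
  ultimately have "{g \<in> carrier (integer_mod_group p).
      g [^]\<^bsub>integer_mod_group p\<^esub> k = \<one>\<^bsub>integer_mod_group p\<^esub>} = {0}"
    by (simp add: carrier_integer_mod_group set_eq_iff) (metis dvd_eq_mod_eq_0 mult_zero_right mod_0 order_refl of_nat_0_less_iff gr0I)
  then show ?thesis using False by simp
qed

text \<open>The number of generators whose order is divisible by a given prime (the free generators,
  of order \<open>0\<close>, included) is an isomorphism invariant: it is read off from the number of
  homomorphisms to the cyclic group of that prime order.\<close>

lemma cyc_iso_invariant:
  assumes "finite J" "finite J'" and iso: "cyc J d \<cong> cyc J' d'" and "prime p"
  shows "card {j \<in> J. p dvd d j} = card {j \<in> J'. p dvd d' j}"
proof -
  let ?Z = "integer_mod_group p"
  have *: "num_homs (cyc I f) ?Z = p ^ card {j \<in> I. p dvd f j}" if "finite I"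
    for I :: "'i set" and f
    using that assms(4) by (simp add: num_homs_cyc card_roots_integer_mod_group[OF assms(4), simplified]
        prod.If_cases Int_def)
  have "p ^ card {j \<in> J. p dvd d j} = p ^ card {j \<in> J'. p dvd d' j}"
    using num_homs_iso[OF cyc.group_P iso, of ?Z] *[OF assms(1)] *[OF assms(2)] by simp
  then show ?thesis using prime_gt_1_nat[OF \<open>prime p\<close>] by (simp add: power_inject_exp)
qed

text \<open>Recognition of a free product of cyclic groups: generators \<open>e j\<close> of the prescribed orders
  form a free basis once some homomorphism maps them to the standard generators.\<close>

lemma cyc_isoI:
  assumes "group G" and e: "\<And>j. j \<in> J \<Longrightarrow> e j \<in> carrier G" "\<And>j. j \<in> J \<Longrightarrow> e j [^]\<^bsub>G\<^esub> d j = \<one>\<^bsub>G\<^esub>"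
    and gen: "carrier G \<subseteq> generate G (e ` J)"
    and \<psi>: "\<psi> \<in> hom G (cyc J d)" "\<And>j. j \<in> J \<Longrightarrow> \<psi> (e j) = cyc.gen J d j"
  obtains \<phi> where "\<phi> \<in> iso (cyc J d) G" "\<And>j. j \<in> J \<Longrightarrow> \<phi> (cyc.gen J d j) = e j"
proof -
  let ?C = "cyc J d" and ?g = "cyc.gen J d"
  obtain \<phi> where \<phi>: "\<phi> \<in> hom ?C G" "\<And>j. j \<in> J \<Longrightarrow> \<phi> (?g j) = e j"
    using ex_cyc_hom[OF \<open>group G\<close>, of J e d] e by blast
  interpret \<phi>: group_hom ?C G \<phi> using \<open>group G\<close> \<phi> by (intro group_homI) auto
  have "(\<psi> \<circ> \<phi>) x = id x" if "x \<in> carrier ?C" for x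
    by (rule cyc.hom_eqI[OF cyc.group_P hom_compose[OF \<phi>(1) \<psi>(1)] _ _ that])
       (auto simp: \<phi> \<psi> hom_def)
  then have "inj_on \<phi> (carrier ?C)" by (intro inj_on_inverseI[of _ \<psi>]) simp
  moreover have "\<phi> ` carrier ?C = carrier G"
  proof
    have "e ` J = \<phi> ` (?g ` J)" using \<phi>(2) by (force simp: image_image)
    then have "generate G (e ` J) = \<phi> ` generate ?C (?g ` J)"
      using \<phi>.generate_img[of "?g ` J"] by (simp add: image_subset_iff)
    then show "carrier G \<subseteq> \<phi> ` carrier ?C"
      using gen by (simp add: cyc.generate_gen)
  qed auto
  ultimately have "\<phi> \<in> iso ?C G" using \<phi>(1) by (simp add: iso_def bij_betw_def)
  then show ?thesis using \<phi>(2) that by blast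
qed

lemma cyc_reindex:
  assumes \<beta>: "bij_betw \<beta> J J'" and d: "\<And>j. j \<in> J \<Longrightarrow> d' (\<beta> j) = d j"
  shows "cyc J d \<cong> cyc J' d'"
proof -
  let ?e = "\<lambda>j. cyc.gen J' d' (\<beta> j)" and ?f = "\<lambda>j. cyc.gen J d (inv_into J \<beta> j)"
  have mem: "\<beta> j \<in> J'" if "j \<in> J" for j using that \<beta> by (auto simp: bij_betw_def)
  have mem': "inv_into J \<beta> j \<in> J" "\<beta> (inv_into J \<beta> j) = j" if "j \<in> J'" for j
    using that \<beta> bij_betw_inv_into_right[OF \<beta>] by (auto simp: bij_betw_def inv_into_into)
  have "?f j [^]\<^bsub>cyc J d\<^esub> d' j = \<one>\<^bsub>cyc J d\<^esub>" if "j \<in> J'" for j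
    using cyc_gen_pow[OF mem'(1)[OF that], of d] d[OF mem'(1)[OF that]] mem'(2)[OF that] by simp
  then obtain \<psi> where \<psi>: "\<psi> \<in> hom (cyc J' d') (cyc J d)" "\<And>j. j \<in> J' \<Longrightarrow> \<psi> (cyc.gen J' d' j) = ?f j"
    using ex_cyc_hom[OF cyc.group_P, of J' ?f J d d'] mem' by auto
  have "carrier (cyc J' d') \<subseteq> generate (cyc J' d') (?e ` J)"
    using \<beta> by (simp add: cyc.generate_gen[symmetric] bij_betw_def image_image[symmetric])
  moreover have "\<psi> (?e j) = cyc.gen J d j" if "j \<in> J" for j
    using that \<beta> mem by (simp add: \<psi> bij_betw_def)
  moreover have "?e j [^]\<^bsub>cyc J' d'\<^esub> d j = \<one>\<^bsub>cyc J' d'\<^esub>" if "j \<in> J" for j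
    using cyc_gen_pow[OF mem[OF that], of d'] d[OF that] by simp
  moreover have "?e j \<in> carrier (cyc J' d')" if "j \<in> J" for j
    using mem[OF that] by simp
  ultimately obtain \<phi> where "\<phi> \<in> iso (cyc J d) (cyc J' d')"
    using cyc_isoI[OF cyc.group_P, of J ?e J' d' d \<psi>] \<psi>(1) by metis
  then show ?thesis by (auto simp: is_iso_def)
qed

lemma free_group_iso_cyc: "cyc {..<r} (\<lambda>_. 0) \<cong> free_group r"
proof -
  interpret F: presentation "{..<r}" "{}" by unfold_locales auto
  obtain \<psi> where \<psi>: "\<psi> \<in> hom F.P (cyc {..<r} (\<lambda>_. 0))" "\<And>j. j < r \<Longrightarrow> \<psi> (F.gen j) = cyc.gen {..<r} (\<lambda>_. 0) j"
    by (rule F.ex_hom[OF cyc.group_P[of "{..<r}" "\<lambda>_. 0"], where f = "cyc.gen {..<r} (\<lambda>_. 0)"]) auto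
  obtain \<phi> where "\<phi> \<in> iso (cyc {..<r} (\<lambda>_. 0)) F.P"
    by (rule cyc_isoI[OF F.group_P, of "{..<r}" F.gen "\<lambda>_. 0" \<psi>]) (auto simp: \<psi> F.generate_gen)
  then show ?thesis by (auto simp: is_iso_def free_group_def)
qed

lemma free_power_iso_cyc:
  assumes "k \<ge> 2"
  shows "cyc {..<r} (\<lambda>_. k) \<cong> free_power (integer_mod_group k) r"
proof -
  let ?Z = "integer_mod_group k"
  define R where "R = {([((i, g), True), ((i, g'), True)], [((i, g \<otimes>\<^bsub>?Z\<^esub> g'), True)]) | i g g'.
        i < r \<and> g \<in> carrier ?Z \<and> g' \<in> carrier ?Z}"
  let ?C = "cyc {..<r} (\<lambda>_. k)" and ?g = "cyc.gen {..<r} (\<lambda>_. k)"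
  interpret Z: group ?Z by simp
  interpret F: presentation "{..<r} \<times> carrier ?Z" R
    by unfold_locales (use Z.m_closed in \<open>auto simp: R_def\<close>)
  have mult: "F.gen (i, g) \<otimes>\<^bsub>F.P\<^esub> F.gen (i, g') = F.gen (i, g \<otimes>\<^bsub>?Z\<^esub> g')"
    if "i < r" "g \<in> carrier ?Z" "g' \<in> carrier ?Z" for i g g'
    by (rule F.gen_mult) (use that in \<open>auto simp: R_def\<close>)
  have hom: "(\<lambda>g. F.gen (i, g)) \<in> hom ?Z F.P" if "i < r" for i
    using that mult[OF that] by (simp add: hom_def)
  have one: "1 \<in> carrier ?Z" using assms by simp
  have pow: "F.gen (i, 1) [^]\<^bsub>F.P\<^esub> l = F.gen (i, int l mod int k)" if "i < r" for i l
    using group_hom.hom_nat_pow[OF group_homI[OF group_integer_mod_group F.group_P hom[OF that]] one, of l]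
    by simp
  let ?f = "\<lambda>(i, g). ?g i [^]\<^bsub>?C\<^esub> nat g"
  have pow_mod: "?g i [^]\<^bsub>?C\<^esub> nat ((g + g') mod int k) = ?g i [^]\<^bsub>?C\<^esub> nat g \<otimes>\<^bsub>?C\<^esub> ?g i [^]\<^bsub>?C\<^esub> nat g'"
    if "i < r" "g \<in> carrier ?Z" "g' \<in> carrier ?Z" for i g g'
  proof -
    have nonneg: "0 \<le> g" "0 \<le> g'" using that assms by (auto simp: carrier_integer_mod_group)
    let ?n = "nat g + nat g'"
    have "?g i [^]\<^bsub>?C\<^esub> ?n = ?g i [^]\<^bsub>?C\<^esub> (?n mod k)"
      using that(1) cyc_gen_pow[of i "{..<r}" "\<lambda>_. k"]
      by (intro cyc.P.pow_mod_exponent[symmetric]) auto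
    also have "?n mod k = nat ((g + g') mod int k)"
      using nonneg by (simp add: nat_mod_distrib nat_add_distrib)
    finally show ?thesis using that(1) by (simp add: cyc.P.nat_pow_mult)
  qed
  obtain \<psi> where \<psi>: "\<psi> \<in> hom F.P ?C" "\<And>j. j \<in> {..<r} \<times> carrier ?Z \<Longrightarrow> \<psi> (F.gen j) = ?f j"
  proof (rule F.ex_hom[OF cyc.group_P[of "{..<r}" "\<lambda>_. k"], where f = ?f])
    fix u v assume "(u, v) \<in> R"
    then show "eval_word ?C ?f u = eval_word ?C ?f v"
      using pow_mod Z.m_closed by (auto simp: R_def cyc.P.eval_word_simps)
  qed auto
  obtain \<phi> where "\<phi> \<in> iso ?C F.P"
  proof (rule cyc_isoI[OF F.group_P, of "{..<r}" "\<lambda>i. F.gen (i, 1)" "\<lambda>_. k" \<psi>])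
    show "F.gen (i, 1) [^]\<^bsub>F.P\<^esub> k = \<one>\<^bsub>F.P\<^esub>" if "i \<in> {..<r}" for i
      using that pow[of i k] pow[of i 0] by simp
    let ?Q = "generate F.P ((\<lambda>i. F.gen (i, 1)) ` {..<r})"
    have "F.gen (i, g) \<in> ?Q" if "i < r" "g \<in> carrier ?Z" for i g
    proof -
      have "F.gen (i, g) = F.gen (i, 1) [^]\<^bsub>F.P\<^esub> nat g"
        using that pow[of i "nat g"] assms by (simp add: carrier_integer_mod_group)
      moreover have "F.gen (i, 1) \<in> ?Q" using that by (auto intro: generate.incl)
      moreover have "subgroup ?Q F.P" using one by (intro F.P.generate_is_subgroup) auto
      ultimately show ?thesis
        by (metis F.P.subgroup_int_pow_closed int_pow_int)
    qed
    then have "F.gen ` ({..<r} \<times> carrier ?Z) \<subseteq> ?Q" by auto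
    then show "carrier F.P \<subseteq> ?Q"
      using F.P.generate_subgroup_incl[OF _ F.P.generate_is_subgroup] one
      by (metis (no_types, lifting) F.gen_closed F.generate_gen SigmaI image_subset_iff)
    show "\<psi> (F.gen (i, 1)) = ?g i" if "i \<in> {..<r}" for i
      using that one \<psi>(2)[of "(i, 1)"] by simp
  qed (use one \<psi>(1) in auto)
  then show ?thesis by (auto simp: is_iso_def free_power_def R_def)
qed

lemma free_product_iso_cyc:
  assumes "group G" "group H" and isos: "cyc J d \<cong> G" "cyc J' d' \<cong> H"
  shows "group (free_product G H) \<and> cyc (J <+> J') (case_sum d d') \<cong> free_product G H"
proof -
  interpret G: group G by fact
  interpret H: group H by fact
  let ?S = "carrier G <+> carrier H"
  define R where "R = {([(Inl g, True), (Inl g', True)], [(Inl (g \<otimes>\<^bsub>G\<^esub> g'), True)]) | g g'.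
        g \<in> carrier G \<and> g' \<in> carrier G} \<union>
     {([(Inr h, True), (Inr h', True)], [(Inr (h \<otimes>\<^bsub>H\<^esub> h'), True)]) | h h'.
        h \<in> carrier H \<and> h' \<in> carrier H}"
  let ?K = "J <+> J'" and ?d = "case_sum d d'"
  interpret F: presentation ?S R by unfold_locales (auto simp: R_def)
  have FP: "F.P = free_product G H" by (simp add: free_product_def R_def)
  have "F.gen (Inl g) \<otimes>\<^bsub>F.P\<^esub> F.gen (Inl g') = F.gen (Inl (g \<otimes>\<^bsub>G\<^esub> g'))"
    if "g \<in> carrier G" "g' \<in> carrier G" for g g'
    by (rule F.gen_mult) (use that in \<open>auto simp: R_def\<close>)
  then have homL: "(\<lambda>g. F.gen (Inl g)) \<in> hom G F.P" by (simp add: hom_def InlI)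
  have "F.gen (Inr g) \<otimes>\<^bsub>F.P\<^esub> F.gen (Inr g') = F.gen (Inr (g \<otimes>\<^bsub>H\<^esub> g'))"
    if "g \<in> carrier H" "g' \<in> carrier H" for g g'
    by (rule F.gen_mult) (use that in \<open>auto simp: R_def\<close>)
  then have homR: "(\<lambda>g. F.gen (Inr g)) \<in> hom H F.P" by (simp add: hom_def InrI)
  obtain \<phi> \<phi>' where \<phi>: "\<phi> \<in> iso (cyc J d) G" and \<phi>': "\<phi>' \<in> iso (cyc J' d') H"
    using isos by (auto simp: is_iso_def)
  define \<theta> \<theta>' where "\<theta> = inv_into (carrier (cyc J d)) \<phi>" "\<theta>' = inv_into (carrier (cyc J' d')) \<phi>'"
  have \<theta>: "\<theta> \<in> hom G (cyc J d)" "\<And>x. x \<in> carrier (cyc J d) \<Longrightarrow> \<theta> (\<phi> x) = x"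
    and \<theta>': "\<theta>' \<in> hom H (cyc J' d')" "\<And>x. x \<in> carrier (cyc J' d') \<Longrightarrow> \<theta>' (\<phi>' x) = x"
    using cyc.P.iso_set_sym[OF \<phi>] cyc.P.iso_set_sym[OF \<phi>'] \<phi> \<phi>'
    by (auto simp: iso_def bij_betw_def \<theta>_\<theta>'_def)
  have "cyc.gen ?K ?d (Inl j) [^]\<^bsub>cyc ?K ?d\<^esub> d j = \<one>\<^bsub>cyc ?K ?d\<^esub>" if "j \<in> J" for j
    using cyc_gen_pow[of "Inl j" ?K ?d] that by auto
  then obtain \<kappa> where \<kappa>: "\<kappa> \<in> hom (cyc J d) (cyc ?K ?d)"
    "\<And>j. j \<in> J \<Longrightarrow> \<kappa> (cyc.gen J d j) = cyc.gen ?K ?d (Inl j)"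
    using ex_cyc_hom[OF cyc.group_P[of ?K ?d], of J "\<lambda>j. cyc.gen ?K ?d (Inl j)" d]
    by (metis InlI cyc.gen_closed)
  have "cyc.gen ?K ?d (Inr j) [^]\<^bsub>cyc ?K ?d\<^esub> d' j = \<one>\<^bsub>cyc ?K ?d\<^esub>" if "j \<in> J'" for j
    using cyc_gen_pow[of "Inr j" ?K ?d] that by auto
  then obtain \<kappa>' where \<kappa>': "\<kappa>' \<in> hom (cyc J' d') (cyc ?K ?d)"
    "\<And>j. j \<in> J' \<Longrightarrow> \<kappa>' (cyc.gen J' d' j) = cyc.gen ?K ?d (Inr j)"
    using ex_cyc_hom[OF cyc.group_P[of ?K ?d], of J' "\<lambda>j. cyc.gen ?K ?d (Inr j)" d']
    by (metis InrI cyc.gen_closed)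
  let ?f = "case_sum (\<kappa> \<circ> \<theta>) (\<kappa>' \<circ> \<theta>')"
  have fL: "\<kappa> \<circ> \<theta> \<in> hom G (cyc ?K ?d)" and fR: "\<kappa>' \<circ> \<theta>' \<in> hom H (cyc ?K ?d)"
    using \<theta>(1) \<theta>'(1) \<kappa>(1) \<kappa>'(1) by (auto intro: Group.hom_compose)
  obtain \<psi> where \<psi>: "\<psi> \<in> hom F.P (cyc ?K ?d)" "\<And>s. s \<in> ?S \<Longrightarrow> \<psi> (F.gen s) = ?f s"
  proof (rule F.ex_hom[OF cyc.group_P[of ?K ?d], where f = ?f])
    fix u v assume "(u, v) \<in> R"
    then show "eval_word (cyc ?K ?d) ?f u = eval_word (cyc ?K ?d) ?f v"
      using hom_in_carrier[OF fL] hom_in_carrier[OF fR] hom_mult[OF fL] hom_mult[OF fR]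
      by (auto simp: R_def cyc.P.eval_word_simps simp del: o_apply)
  qed (use hom_in_carrier[OF fL] hom_in_carrier[OF fR] in auto)
  have \<phi>_closed: "\<phi> x \<in> carrier G" if "x \<in> carrier (cyc J d)" for x
    using \<phi> that by (auto simp: iso_def intro: hom_in_carrier)
  have \<phi>'_closed: "\<phi>' x \<in> carrier H" if "x \<in> carrier (cyc J' d')" for x
    using \<phi>' that by (auto simp: iso_def intro: hom_in_carrier)
  let ?e = "case_sum (\<lambda>j. F.gen (Inl (\<phi> (cyc.gen J d j)))) (\<lambda>j. F.gen (Inr (\<phi>' (cyc.gen J' d' j))))"
  have hL: "(\<lambda>g. F.gen (Inl g)) \<circ> \<phi> \<in> hom (cyc J d) F.P"
    and hR: "(\<lambda>g. F.gen (Inr g)) \<circ> \<phi>' \<in> hom (cyc J' d') F.P"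
    using \<phi> \<phi>' homL homR by (auto simp: iso_def intro: Group.hom_compose)
  interpret L: group_hom "cyc J d" F.P "(\<lambda>g. F.gen (Inl g)) \<circ> \<phi>"
    using hL by (intro group_homI) auto
  interpret R: group_hom "cyc J' d'" F.P "(\<lambda>g. F.gen (Inr g)) \<circ> \<phi>'"
    using hR by (intro group_homI) auto
  have e_closed: "?e j \<in> carrier F.P" if "j \<in> ?K" for j
    using that L.hom_closed R.hom_closed by auto
  obtain \<chi> where "\<chi> \<in> iso (cyc ?K ?d) F.P"
  proof (rule cyc_isoI[OF F.group_P, of ?K ?e ?d \<psi>])
    show "?e j [^]\<^bsub>F.P\<^esub> ?d j = \<one>\<^bsub>F.P\<^esub>" if "j \<in> ?K" for j
      using that
    proof (cases j)
      case (Inl i)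
      then show ?thesis
        using that L.hom_nat_pow[of "cyc.gen J d i" "d i"] L.hom_one cyc_gen_pow[of i J d] by auto
    next
      case (Inr i)
      then show ?thesis
        using that R.hom_nat_pow[of "cyc.gen J' d' i" "d' i"] R.hom_one cyc_gen_pow[of i J' d'] by auto
    qed
    let ?Q = "generate F.P (?e ` ?K)"
    have Q: "subgroup ?Q F.P" using e_closed by (intro F.P.generate_is_subgroup) blast
    have "F.gen (Inl g) \<in> ?Q" if "g \<in> carrier G" for g
    proof -
      have "F.gen (Inl g) \<in> ((\<lambda>g. F.gen (Inl g)) \<circ> \<phi>) ` generate (cyc J d) (cyc.gen J d ` J)"
        using that \<phi> unfolding cyc.generate_gen iso_def bij_betw_def image_comp[symmetric] by blast
      also have "\<dots> = generate F.P (((\<lambda>g. F.gen (Inl g)) \<circ> \<phi>) ` cyc.gen J d ` J)"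
        using L.generate_img[of "cyc.gen J d ` J"] by (simp add: image_subset_iff)
      also have "\<dots> \<subseteq> ?Q" by (rule F.P.mono_generate) (auto simp: Plus_def image_Un image_image)
      finally show ?thesis .
    qed
    moreover have "F.gen (Inr g) \<in> ?Q" if "g \<in> carrier H" for g
    proof -
      have "F.gen (Inr g) \<in> ((\<lambda>g. F.gen (Inr g)) \<circ> \<phi>') ` generate (cyc J' d') (cyc.gen J' d' ` J')"
        using that \<phi>' unfolding cyc.generate_gen iso_def bij_betw_def image_comp[symmetric] by blast
      also have "\<dots> = generate F.P (((\<lambda>g. F.gen (Inr g)) \<circ> \<phi>') ` cyc.gen J' d' ` J')"
        using R.generate_img[of "cyc.gen J' d' ` J'"] by (simp add: image_subset_iff)
      also have "\<dots> \<subseteq> ?Q" by (rule F.P.mono_generate) (auto simp: Plus_def image_Un image_image)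
      finally show ?thesis .
    qed
    ultimately have "F.gen ` ?S \<subseteq> ?Q" by auto
    then show "carrier F.P \<subseteq> ?Q"
      using F.P.generate_subgroup_incl[OF _ Q] by (metis F.generate_gen)
    show "\<psi> (?e j) = cyc.gen ?K ?d j" if "j \<in> ?K" for j
      using that \<theta>(2) \<theta>'(2) \<kappa>(2) \<kappa>'(2) \<psi>(2) \<phi>_closed \<phi>'_closed by (elim PlusE) (simp_all add: InlI InrI)
  qed (use e_closed \<psi>(1) in auto)
  then show ?thesis using F.group_P by (auto simp: is_iso_def FP)
qed

lemma kurosh_product_iso_cyc:
  assumes "q \<ge> 2"
  shows "cyc (({..<l} <+> {..<u}) <+> {..<v}) (case_sum (case_sum (\<lambda>_. 2) (\<lambda>_. q)) (\<lambda>_. 0))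
    \<cong> kurosh_product q l u v"
proof -
  have grp: "group (free_power (integer_mod_group k) r)" for k r
  proof -
    interpret Z: group "integer_mod_group k" by simp
    interpret F: presentation "{..<r} \<times> carrier (integer_mod_group k)"
      "{([((i, g), True), ((i, g'), True)], [((i, g \<otimes>\<^bsub>integer_mod_group k\<^esub> g'), True)]) | i g g'.
        i < r \<and> g \<in> carrier (integer_mod_group k) \<and> g' \<in> carrier (integer_mod_group k)}"
      by unfold_locales (use Z.m_closed in auto)
    show ?thesis using F.group_P by (simp add: free_power_def)
  qed
  interpret F: presentation "{..<v}" "{}" by unfold_locales auto
  have grpF: "group (free_group v)" using F.group_P by (simp add: free_group_def)
  have "group (free_product (free_power (integer_mod_group 2) l) (free_power (integer_mod_group q) u)) \<and>
    cyc ({..<l} <+> {..<u}) (case_sum (\<lambda>_. 2) (\<lambda>_. q))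
      \<cong> free_product (free_power (integer_mod_group 2) l) (free_power (integer_mod_group q) u)"
    by (intro free_product_iso_cyc grp free_power_iso_cyc assms) simp_all
  then show ?thesis
    unfolding kurosh_product_def using free_product_iso_cyc[OF _ grpF _ free_group_iso_cyc] by blast
qed

text \<open>The two isomorphism types that matter for a free product of cyclic groups of orders \<open>2\<close>, \<open>q\<close>
  and \<open>\<infinity>\<close>: no factor of order \<open>q\<close>, and no other factor.\<close>

lemma iso_kurosh_no_q_iff:
  assumes J: "finite J" "\<And>j. j \<in> J \<Longrightarrow> d j \<in> {0, 2, q}" and q: "prime q" "odd q" and "cyc J d \<cong> G"
  shows "(\<exists>l v. G \<cong> kurosh_product q l 0 v) \<longleftrightarrow> (\<forall>j\<in>J. d j \<noteq> q)"
proof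
  assume "\<exists>l v. G \<cong> kurosh_product q l 0 v"
  then obtain l v where "G \<cong> kurosh_product q l 0 v" by blast
  define K where "K = ({..<l} <+> {..<0::nat}) <+> {..<v}"
  define e where "e = case_sum (case_sum (\<lambda>_::nat. 2::nat) (\<lambda>_::nat. q)) (\<lambda>_::nat. 0)"
  have q2: "q \<ge> 2" "q \<noteq> 2" using q prime_ge_2_nat by auto
  have fK: "finite K" by (simp add: K_def)
  have "kurosh_product q l 0 v \<cong> cyc K e"
    using cyc.P.iso_sym[OF kurosh_product_iso_cyc[OF q2(1), of l 0 v]] by (simp add: K_def e_def)
  then have iso: "cyc J d \<cong> cyc K e"
    by (rule iso_trans[OF iso_trans[OF \<open>cyc J d \<cong> G\<close> \<open>G \<cong> _\<close>]])
  have e: "e j \<in> {0, 2}" if "j \<in> K" for j using that by (auto simp: K_def e_def)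
  have "\<not> q dvd 2" using q2 by (auto dest!: dvd_imp_le)
  obtain p where p: "prime p" "p > q" using bigger_prime by blast
  have p': "\<not> p dvd 2" "\<not> p dvd q"
    using p q2 by (auto dest!: dvd_imp_le)
  \<comment> \<open>The primes \<open>q\<close> and \<open>p\<close> count the generators of order \<open>q\<close> or \<open>\<infinity>\<close>, and those of order \<open>\<infinity>\<close>.\<close>
  have "card {j \<in> J. q dvd d j} = card {j \<in> K. q dvd e j}"
    by (rule cyc_iso_invariant[OF J(1) fK iso q(1)])
  also have "{j \<in> K. q dvd e j} = {j \<in> K. p dvd e j}"
    using e \<open>\<not> q dvd 2\<close> p' by force
  also have "card \<dots> = card {j \<in> J. p dvd d j}"
    by (rule cyc_iso_invariant[OF J(1) fK iso p(1), symmetric])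
  also have "{j \<in> J. p dvd d j} = {j \<in> J. d j = 0}"
    using J(2) p' by force
  finally have "card {j \<in> J. d j = 0} = card {j \<in> J. q dvd d j}" ..
  then have "{j \<in> J. d j = 0} = {j \<in> J. q dvd d j}"
    using J(1) by (intro card_subset_eq) auto
  then show "\<forall>j\<in>J. d j \<noteq> q" using q2 by force
next
  assume no_q: "\<forall>j\<in>J. d j \<noteq> q"
  let ?l = "card {j \<in> J. d j = 2}" and ?v = "card {j \<in> J. d j = 0}"
  let ?K = "({..<?l} <+> {..<0::nat}) <+> {..<?v}"
  let ?e = "case_sum (case_sum (\<lambda>_::nat. 2::nat) (\<lambda>_::nat. q)) (\<lambda>_::nat. 0)"
  obtain f where f: "bij_betw f {j \<in> J. d j = 2} {..<?l}"
    using J(1) ex_bij_betw_finite_nat[of "{j \<in> J. d j = 2}"] by (auto simp: atLeast0LessThan)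
  obtain g where g: "bij_betw g {j \<in> J. d j = 0} {..<?v}"
    using J(1) ex_bij_betw_finite_nat[of "{j \<in> J. d j = 0}"] by (auto simp: atLeast0LessThan)
  let ?\<beta> = "\<lambda>j. if d j = 2 then Inl (Inl (f j)) else Inr (g j)"
  have d0: "d j = 0" if "j \<in> J" "d j \<noteq> 2" for j using J(2)[OF that(1)] that no_q by auto
  have "bij_betw ?\<beta> J ?K"
  proof (rule bij_betw_imageI)
    show "inj_on ?\<beta> J"
      using f g d0 by (auto simp: inj_on_def bij_betw_def)
    have "?\<beta> ` J = Inl ` Inl ` f ` {j \<in> J. d j = 2} \<union> Inr ` g ` {j \<in> J. d j = 0}"
    proof (intro equalityI subsetI)
      fix z assume "z \<in> ?\<beta> ` J"
      then obtain j where j: "j \<in> J" "z = ?\<beta> j" by blast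
      show "z \<in> Inl ` Inl ` f ` {j \<in> J. d j = 2} \<union> Inr ` g ` {j \<in> J. d j = 0}"
        using j d0[OF j(1)] by (cases "d j = 2") auto
    next
      fix z assume "z \<in> Inl ` Inl ` f ` {j \<in> J. d j = 2} \<union> Inr ` g ` {j \<in> J. d j = 0}"
      then show "z \<in> ?\<beta> ` J" by (auto intro!: image_eqI[of z ?\<beta>])
    qed
    then show "?\<beta> ` J = ?K" using f g by (auto simp: bij_betw_def)
  qed
  moreover have "?e (?\<beta> j) = d j" if "j \<in> J" for j
    using that J(2) no_q by auto
  ultimately have "cyc J d \<cong> cyc ?K ?e" by (rule cyc_reindex)
  moreover have "q \<ge> 2" using q(1) by (rule prime_ge_2_nat)
  ultimately have "cyc J d \<cong> kurosh_product q ?l 0 ?v"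
    using iso_trans[OF _ kurosh_product_iso_cyc[of q ?l 0 ?v]] by blast
  then show "\<exists>l v. G \<cong> kurosh_product q l 0 v"
    using iso_trans[OF cyc.P.iso_sym[OF \<open>cyc J d \<cong> G\<close>]] by blast
qed

lemma iso_free_power_iff:
  assumes J: "finite J" "\<And>j. j \<in> J \<Longrightarrow> d j \<in> {0, 2, q}" and q: "prime q" "odd q" and "cyc J d \<cong> G"
  shows "(\<exists>u. G \<cong> free_power (integer_mod_group q) u) \<longleftrightarrow> (\<forall>j\<in>J. d j = q)"
proof
  assume "\<exists>u. G \<cong> free_power (integer_mod_group q) u"
  then obtain u where u: "G \<cong> free_power (integer_mod_group q) u" by blast
  have "q \<ge> 2" using q(1) by (rule prime_ge_2_nat)
  have "free_power (integer_mod_group q) u \<cong> cyc {..<u} (\<lambda>_. q)"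
    by (rule cyc.P.iso_sym[OF free_power_iso_cyc[OF \<open>q \<ge> 2\<close>]])
  then have iso: "cyc J d \<cong> cyc {..<u} (\<lambda>_. q)"
    by (rule iso_trans[OF iso_trans[OF \<open>cyc J d \<cong> G\<close> u]])
  have "card {j \<in> J. even (d j)} = card {j \<in> {..<u}. even q}"
    by (rule cyc_iso_invariant[OF J(1) _ iso two_is_prime_nat]) simp
  then have "{j \<in> J. even (d j)} = {}" using J(1) q(2) by simp
  then show "\<forall>j\<in>J. d j = q" using J(2) by fastforce
next
  assume all_q: "\<forall>j\<in>J. d j = q"
  obtain f where "bij_betw f J {..<card J}"
    using J(1) ex_bij_betw_finite_nat[of J] by (auto simp: atLeast0LessThan)
  then have "cyc J d \<cong> cyc {..<card J} (\<lambda>_. q)" by (rule cyc_reindex) (use all_q in auto)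
  moreover have "cyc {..<card J} (\<lambda>_. q) \<cong> free_power (integer_mod_group q) (card J)"
    by (rule free_power_iso_cyc[OF prime_ge_2_nat[OF q(1)]])
  ultimately have "cyc J d \<cong> free_power (integer_mod_group q) (card J)"
    by (rule iso_trans)
  then show "\<exists>u. G \<cong> free_power (integer_mod_group q) u"
    using iso_trans[OF cyc.P.iso_sym[OF \<open>cyc J d \<cong> G\<close>]] by blast
qed

section \<open>The free product of two cyclic groups of orders two and \<open>q\<close>\<close>

definition hecke_rels :: "nat \<Rightarrow> (gen word \<times> gen word) set" where
  "hecke_rels q = {(gen_pow Gen_x 2, []), (gen_pow Gen_y q, [])}"

lemma Hecke_eq: "presented_group UNIV (hecke_rels q) = Hecke q"
  by (simp add: Hecke_def hecke_rels_def)

interpretation hecke: presentation UNIV "hecke_rels q"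
  rewrites "presented_group UNIV (hecke_rels q) = Hecke q"
  for q
proof -
  show "presentation UNIV (hecke_rels q)" by unfold_locales (auto simp: hecke_rels_def)
qed (rule Hecke_eq)

abbreviation hx :: "nat \<Rightarrow> gen word set" where "hx q \<equiv> hecke.gen q Gen_x"

abbreviation hy :: "nat \<Rightarrow> gen word set" where "hy q \<equiv> hecke.gen q Gen_y"

lemma hx_pow: "hx q [^]\<^bsub>Hecke q\<^esub> (2::nat) = \<one>\<^bsub>Hecke q\<^esub>"
  using hecke.cls_rel[of "gen_pow Gen_x 2" "[]" q] hecke.cls_gen_pow[of Gen_x q 2] hecke.one_P[of q]
  by (simp add: hecke_rels_def)

lemma hy_pow: "hy q [^]\<^bsub>Hecke q\<^esub> q = \<one>\<^bsub>Hecke q\<^esub>"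
  using hecke.cls_rel[of "gen_pow Gen_y q" "[]" q] hecke.cls_gen_pow[of Gen_y q q] hecke.one_P[of q]
  by (simp add: hecke_rels_def)

lemma hx_hx: "hx q \<otimes>\<^bsub>Hecke q\<^esub> hx q = \<one>\<^bsub>Hecke q\<^esub>"
  using hx_pow[of q] hecke.P.nat_pow_Suc2[of "hx q" q 1] hecke.P.nat_pow_0[of q "hx q"]
  by (simp add: numeral_2_eq_2)

lemma inv_hx: "inv\<^bsub>Hecke q\<^esub> (hx q) = hx q"
  by (rule hecke.P.inv_equality) (auto simp: hx_hx)

lemma ex_hecke_hom:
  assumes "group G" "a \<in> carrier G" "b \<in> carrier G"
    and "a [^]\<^bsub>G\<^esub> (2::nat) = \<one>\<^bsub>G\<^esub>" "b [^]\<^bsub>G\<^esub> q = \<one>\<^bsub>G\<^esub>"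
  obtains \<phi> where "\<phi> \<in> hom (Hecke q) G" "\<phi> (hx q) = a" "\<phi> (hy q) = b"
proof -
  interpret G: group G by fact
  let ?f = "case_gen a b"
  have f: "?f c \<in> carrier G" for c using assms by (cases c) auto
  have "eval_word G ?f u = eval_word G ?f v" if "(u, v) \<in> hecke_rels q" for u v
    using that assms f by (auto simp: hecke_rels_def G.eval_word_gen_pow G.eval_word_simps)
  then obtain \<phi> where "\<phi> \<in> hom (Hecke q) G" "\<And>c. \<phi> (hecke.gen q c) = ?f c"
    using hecke.ex_hom[where f = ?f and q = q, OF \<open>group G\<close> f] by (metis UNIV_I)
  then show ?thesis using that[of \<phi>] by simp
qed

text \<open>Since the generators have finite order, every element is a product of generators, without
  inverses.\<close>

lemma hecke_induct [consumes 2, case_names one x y]: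
  assumes "q > 0" "w \<in> carrier (Hecke q)"
    and one: "Q \<one>\<^bsub>Hecke q\<^esub>"
    and x: "\<And>w. w \<in> carrier (Hecke q) \<Longrightarrow> Q w \<Longrightarrow> Q (hx q \<otimes>\<^bsub>Hecke q\<^esub> w)"
    and y: "\<And>w. w \<in> carrier (Hecke q) \<Longrightarrow> Q w \<Longrightarrow> Q (hy q \<otimes>\<^bsub>Hecke q\<^esub> w)"
  shows "Q w"
proof -
  have ypow: "Q (hy q [^]\<^bsub>Hecke q\<^esub> k \<otimes>\<^bsub>Hecke q\<^esub> w)" if "w \<in> carrier (Hecke q)" "Q w" for w and k :: nat
  proof (induction k)
    case (Suc k)
    have "hy q [^]\<^bsub>Hecke q\<^esub> Suc k \<otimes>\<^bsub>Hecke q\<^esub> w = hy q \<otimes>\<^bsub>Hecke q\<^esub> (hy q [^]\<^bsub>Hecke q\<^esub> k \<otimes>\<^bsub>Hecke q\<^esub> w)"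
      using that hecke.P.nat_pow_Suc2[of "hy q" q k] by (simp add: hecke.P.m_assoc del: hecke.P.nat_pow_Suc)
    then show ?case using y[of "hy q [^]\<^bsub>Hecke q\<^esub> k \<otimes>\<^bsub>Hecke q\<^esub> w"] Suc that by simp
  qed (use that in simp)
  have inv_y: "inv\<^bsub>Hecke q\<^esub> (hy q) = hy q [^]\<^bsub>Hecke q\<^esub> (q - 1)"
    using hy_pow[of q] \<open>q > 0\<close> hecke.P.nat_pow_Suc[of q "hy q" "q - 1"]
    by (intro hecke.P.inv_equality) auto
  have "Q (hecke.cls q u)" for u
  proof (induction u)
    case Nil
    then show ?case using one by (simp add: hecke.one_P)
  next
    case (Cons l u)
    obtain c b where l: "l = (c, b)" by (cases l)
    have "hecke.cls q (l # u) = hecke.cls q [l] \<otimes>\<^bsub>Hecke q\<^esub> hecke.cls q u"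
      by (simp add: hecke.mult_cls)
    moreover have "hecke.cls q [l] = (if b then hecke.gen q c else inv\<^bsub>Hecke q\<^esub> (hecke.gen q c))"
      by (simp add: l hecke.cls_False hecke.gen_def[symmetric])
    ultimately show ?case
      using x[of "hecke.cls q u"] y[of "hecke.cls q u"] ypow[of "hecke.cls q u" "q - 1"] Cons
      by (cases c) (auto simp: inv_hx inv_y)
  qed
  then show ?thesis using assms(2) by (auto simp: hecke.carrier_P)
qed

lemma foldr_gen_pow: "foldr F (gen_pow a k) s = (F (a, True) ^^ k) s"
  by (induction k) (auto simp: gen_pow_def)

text \<open>An action of \<open>Hecke q\<close> on a set is given by two maps \<open>fx\<close>, \<open>fy\<close> with \<open>fx\<^sup>2\<close> and \<open>fy\<close> to the
  power \<open>q\<close> equal to the identity.\<close>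

lemma ex_hecke_action:
  assumes "q > 0"
    and fx: "\<And>s. s \<in> Y \<Longrightarrow> fx s \<in> Y" "\<And>s. s \<in> Y \<Longrightarrow> fx (fx s) = s"
    and fy: "\<And>s. s \<in> Y \<Longrightarrow> fy s \<in> Y" "\<And>s. s \<in> Y \<Longrightarrow> (fy ^^ q) s = s"
  obtains A where "\<And>s. s \<in> Y \<Longrightarrow> A \<one>\<^bsub>Hecke q\<^esub> s = s"
    "\<And>w s. w \<in> carrier (Hecke q) \<Longrightarrow> s \<in> Y \<Longrightarrow> A w s \<in> Y"
    "\<And>w s. w \<in> carrier (Hecke q) \<Longrightarrow> s \<in> Y \<Longrightarrow> A (hx q \<otimes>\<^bsub>Hecke q\<^esub> w) s = fx (A w s)"
    "\<And>w s. w \<in> carrier (Hecke q) \<Longrightarrow> s \<in> Y \<Longrightarrow> A (hy q \<otimes>\<^bsub>Hecke q\<^esub> w) s = fy (A w s)"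
proof -
  define F where "F = (\<lambda>(c, b). case c of Gen_x \<Rightarrow> fx | Gen_y \<Rightarrow> if b then fy else fy ^^ (q - 1))"
  have fy_pow: "(fy ^^ k) s \<in> Y" if "s \<in> Y" for k s
    using that by (induction k) (auto intro: fy)
  have F_closed: "F l s \<in> Y" if "s \<in> Y" for l s
    using that fx fy fy_pow by (auto simp: F_def split: prod.split gen.split)
  have "(fy ^^ (q - 1)) (fy s) = s" "fy ((fy ^^ (q - 1)) s) = s" if "s \<in> Y" for s
    using fy(2)[OF that] \<open>q > 0\<close> by (cases q; simp add: funpow_swap1)+
  then have F_cancel: "F (c, b) (F (c, \<not> b) s) = s" if "s \<in> Y" for c b s
    using that fx by (auto simp: F_def split: gen.split)
  have F_rel: "foldr F u s = foldr F v s" if "(u, v) \<in> hecke_rels q" "s \<in> Y" for u v s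
    using that fx fy by (auto simp: hecke_rels_def foldr_gen_pow F_def numeral_2_eq_2)
  have eq: "foldr F u s = foldr F v s" if "(u, v) \<in> pres_rel UNIV (hecke_rels q)" "s \<in> Y" for u v s
    by (rule pres_rel_foldr[OF F_closed F_cancel F_rel that])
  define A where "A = (\<lambda>w s. foldr F (SOME u. u \<in> w) s)"
  have A: "A (hecke.cls q u) s = foldr F u s" if "s \<in> Y" for u s
  proof -
    have "u \<in> hecke.cls q u" by (simp add: hecke.mem_cls pres_rel.refl)
    then have "(SOME u'. u' \<in> hecke.cls q u) \<in> hecke.cls q u" by (rule someI)
    then show ?thesis unfolding A_def hecke.mem_cls using eq that by metis
  qed
  have fold_closed: "foldr F u s \<in> Y" if "s \<in> Y" for u s
    using that by (induction u) (auto intro: F_closed)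
  show ?thesis
  proof (rule that[of A])
    show "A \<one>\<^bsub>Hecke q\<^esub> s = s" if "s \<in> Y" for s using that by (simp add: hecke.one_P A)
    fix w s assume "w \<in> carrier (Hecke q)" and s: "s \<in> Y"
    then obtain u where u: "w = hecke.cls q u" by (auto simp: hecke.carrier_P)
    show "A w s \<in> Y" using s by (simp add: u A fold_closed)
    show "A (hx q \<otimes>\<^bsub>Hecke q\<^esub> w) s = fx (A w s)" "A (hy q \<otimes>\<^bsub>Hecke q\<^esub> w) s = fy (A w s)"
      using s by (simp_all add: u hecke.gen_def hecke.mult_cls A F_def)
  qed
qed

section \<open>Subgroups of finite index\<close>

lemma (in group) mult_inv_cancel: "g \<in> carrier G \<Longrightarrow> h \<in> carrier G \<Longrightarrow> g \<otimes> (inv g \<otimes> h) = h"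
  by (simp add: m_assoc[symmetric])

lemma (in group) conj_pow:
  assumes "a \<in> carrier G" "g \<in> carrier G"
  shows "(inv g \<otimes> (a \<otimes> g)) [^] (k::nat) = inv g \<otimes> (a [^] k \<otimes> g)"
  using assms by (induction k) (simp_all add: m_assoc mult_inv_cancel)

text \<open>A finite transitive action of \<open>Hecke q\<close> from the left. The points play the role of the cosets of
  the subgroup under study, which is the stabilizer of the base point.\<close>

locale transitive_action =
  fixes q :: nat and X :: "'p set" and act :: "gen word set \<Rightarrow> 'p \<Rightarrow> 'p" and p0 :: 'p
  assumes q: "prime q"
    and finite_X: "finite X" and p0: "p0 \<in> X"
    and act_one: "p \<in> X \<Longrightarrow> act \<one>\<^bsub>Hecke q\<^esub> p = p"
    and act_mult: "v \<in> carrier (Hecke q) \<Longrightarrow> w \<in> carrier (Hecke q) \<Longrightarrow> p \<in> X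
      \<Longrightarrow> act (v \<otimes>\<^bsub>Hecke q\<^esub> w) p = act v (act w p)"
    and act_closed: "w \<in> carrier (Hecke q) \<Longrightarrow> p \<in> X \<Longrightarrow> act w p \<in> X"
    and transitive: "p \<in> X \<Longrightarrow> \<exists>w\<in>carrier (Hecke q). act w p0 = p"
begin

abbreviation H where "H \<equiv> Hecke q"
abbreviation x where "x \<equiv> hx q"
abbreviation y where "y \<equiv> hy q"

text \<open>The stabilizer of the base point.\<close>

definition stab :: "gen word set set" where
  "stab = {w \<in> carrier H. act w p0 = p0}"

lemma q_pos: "q > 0" using q by (rule prime_gt_0_nat)

lemma x_closed [simp]: "x \<in> carrier H" and y_closed [simp]: "y \<in> carrier H"
  by auto

lemma act_inv: "w \<in> carrier H \<Longrightarrow> p \<in> X \<Longrightarrow> act (inv\<^bsub>H\<^esub> w) (act w p) = p"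
  "w \<in> carrier H \<Longrightarrow> p \<in> X \<Longrightarrow> act w (act (inv\<^bsub>H\<^esub> w) p) = p"
  by (simp_all add: act_mult[symmetric] act_one)

lemma act_x_x: "p \<in> X \<Longrightarrow> act x (act x p) = p"
  by (simp add: act_mult[symmetric] hx_hx act_one)

lemma act_pow: "act w p = p \<Longrightarrow> w \<in> carrier H \<Longrightarrow> p \<in> X \<Longrightarrow> act (w [^]\<^bsub>H\<^esub> (k::nat)) p = p"
  by (induction k) (simp_all add: act_mult act_one)

lemma subgroup_stab: "subgroup stab H"
proof (rule hecke.P.subgroupI)
  show "stab \<noteq> {}" using act_one[OF p0] by (auto simp: stab_def)
  show "inv\<^bsub>H\<^esub> a \<in> stab" if "a \<in> stab" for a
    using that act_inv(1)[of a p0] p0 by (auto simp: stab_def)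
qed (auto simp: stab_def act_mult p0)

text \<open>\<open>reach E p t\<close>: the element \<open>t\<close> is read along a path from the base point to \<open>p\<close> that moves
  by \<open>y\<close>, or by \<open>x\<close> from points of \<open>E\<close>.\<close>

inductive reach :: "'p set \<Rightarrow> 'p \<Rightarrow> gen word set \<Rightarrow> bool" for E where
  reach_base: "reach E p0 \<one>\<^bsub>H\<^esub>"
| reach_y: "reach E p t \<Longrightarrow> act y p \<noteq> p \<Longrightarrow> reach E (act y p) (y \<otimes>\<^bsub>H\<^esub> t)"
| reach_x: "reach E p t \<Longrightarrow> p \<in> E \<Longrightarrow> reach E (act x p) (x \<otimes>\<^bsub>H\<^esub> t)"

lemma reach_closed: "reach E p t \<Longrightarrow> t \<in> carrier H \<and> p \<in> X \<and> act t p0 = p"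
  by (induction rule: reach.induct) (auto simp: act_one p0 act_mult act_closed)

lemma reach_mono: "reach E p t \<Longrightarrow> E \<subseteq> E' \<Longrightarrow> reach E' p t"
  by (induction rule: reach.induct) (auto intro: reach.intros)

text \<open>The orbit of a point under \<open>y\<close>; as \<open>y\<close> has finite order, its non-negative powers suffice.\<close>

definition y_orbit :: "'p \<Rightarrow> 'p set" where
  "y_orbit p = range (\<lambda>i. act (y [^]\<^bsub>H\<^esub> (i::nat)) p)"

lemma act_y_pow_Suc: "p \<in> X \<Longrightarrow> act (y [^]\<^bsub>H\<^esub> Suc i) p = act y (act (y [^]\<^bsub>H\<^esub> i) p)"
  using hecke.P.nat_pow_Suc2[of y q i] act_mult[of y "y [^]\<^bsub>H\<^esub> i" p] by (metis hecke.P.nat_pow_closed y_closed)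

lemma y_orbit_closed: "p \<in> X \<Longrightarrow> r \<in> y_orbit p \<Longrightarrow> act y r \<in> y_orbit p"
  unfolding y_orbit_def by (auto simp only: act_y_pow_Suc[symmetric] intro: rangeI)

lemma y_orbit_self: "p \<in> X \<Longrightarrow> p \<in> y_orbit p"
  unfolding y_orbit_def by (rule range_eqI[of _ _ 0]) (simp add: act_one)

text \<open>As \<open>q\<close> is prime, \<open>y\<close> permutes each orbit freely or fixes it pointwise.\<close>

lemma y_pow_eq:
  assumes "p \<in> X" "act y p \<noteq> p" "act (y [^]\<^bsub>H\<^esub> i) p = act (y [^]\<^bsub>H\<^esub> j) p"
  shows "y [^]\<^bsub>H\<^esub> (i::nat) = y [^]\<^bsub>H\<^esub> (j::nat)"
proof -
  have *: "y [^]\<^bsub>H\<^esub> i = y [^]\<^bsub>H\<^esub> j"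
    if "i \<le> j" "act (y [^]\<^bsub>H\<^esub> i) p = act (y [^]\<^bsub>H\<^esub> j) p" for i j :: nat
  proof -
    define k where "k = j - i"
    have j: "y [^]\<^bsub>H\<^esub> j = y [^]\<^bsub>H\<^esub> i \<otimes>\<^bsub>H\<^esub> y [^]\<^bsub>H\<^esub> k"
      using that(1) by (simp add: hecke.P.nat_pow_mult k_def)
    have "act (inv\<^bsub>H\<^esub> (y [^]\<^bsub>H\<^esub> i)) (act (y [^]\<^bsub>H\<^esub> i) (act (y [^]\<^bsub>H\<^esub> k) p)) = p"
      using act_mult[of "y [^]\<^bsub>H\<^esub> i" "y [^]\<^bsub>H\<^esub> k" p] that(2) assms(1)
        act_inv(1)[of "y [^]\<^bsub>H\<^esub> i" p] by (simp add: j)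
    then have fixed: "act (y [^]\<^bsub>H\<^esub> k) p = p"
      using assms(1) by (simp add: act_inv act_closed)
    have "q dvd k"
    proof (rule ccontr)
      assume "\<not> q dvd k"
      then have "coprime k q"
        using q prime_imp_coprime coprime_commute by blast
      then obtain e where "[k * e = 1] (mod q)"
        using cong_solve_coprime_nat by (metis One_nat_def)
      then have "(k * e) mod q = 1"
        using prime_gt_1_nat[OF q] by (simp add: cong_def)
      then have "y = y [^]\<^bsub>H\<^esub> (k * e)"
        using hecke.P.pow_mod_exponent[of y q q "k * e"] by (simp add: hy_pow)
      also have "\<dots> = (y [^]\<^bsub>H\<^esub> k) [^]\<^bsub>H\<^esub> e" by (simp add: hecke.P.nat_pow_pow)
      finally show False using act_pow[OF fixed, of e] assms by simp
    qed
    then have "y [^]\<^bsub>H\<^esub> k = \<one>\<^bsub>H\<^esub>"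
      by (metis UNIV_I dvdE hecke.P.nat_pow_one hecke.P.nat_pow_pow hecke.gen_closed hy_pow)
    then show ?thesis by (simp add: j)
  qed
  show ?thesis using *[of i j] *[of j i] assms(3) by (metis linear)
qed

text \<open>A transversal along one orbit of \<open>y\<close>, which prolongs the value \<open>t\<close> at the point \<open>p\<close>.\<close>

lemma ex_orbit_section:
  assumes p: "p \<in> X" and t: "t \<in> carrier H"
  obtains \<tau> where "\<tau> p = t"
    "\<And>r. r \<in> y_orbit p \<Longrightarrow> act y r \<noteq> r \<Longrightarrow> \<tau> (act y r) = y \<otimes>\<^bsub>H\<^esub> \<tau> r"
    "\<And>r E. r \<in> y_orbit p \<Longrightarrow> reach E p t \<Longrightarrow> reach E r (\<tau> r)"
proof (cases "act y p = p")
  case True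
  then have "y_orbit p = {p}" using p act_pow by (auto simp: y_orbit_def)
  then show ?thesis using True that[of "\<lambda>_. t"] by simp
next
  case False
  define \<tau> where "\<tau> = (\<lambda>r. y [^]\<^bsub>H\<^esub> (SOME i::nat. act (y [^]\<^bsub>H\<^esub> i) p = r) \<otimes>\<^bsub>H\<^esub> t)"
  have \<tau>: "\<tau> (act (y [^]\<^bsub>H\<^esub> i) p) = y [^]\<^bsub>H\<^esub> i \<otimes>\<^bsub>H\<^esub> t" for i :: nat
  proof -
    let ?j = "SOME j::nat. act (y [^]\<^bsub>H\<^esub> j) p = act (y [^]\<^bsub>H\<^esub> i) p"
    have "\<exists>j::nat. act (y [^]\<^bsub>H\<^esub> j) p = act (y [^]\<^bsub>H\<^esub> i) p" by blast
    then have "act (y [^]\<^bsub>H\<^esub> ?j) p = act (y [^]\<^bsub>H\<^esub> i) p" by (rule someI_ex)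
    then have "y [^]\<^bsub>H\<^esub> ?j = y [^]\<^bsub>H\<^esub> i" by (rule y_pow_eq[OF p False])
    then show ?thesis by (simp add: \<tau>_def)
  qed
  have y_Suc: "y [^]\<^bsub>H\<^esub> Suc i \<otimes>\<^bsub>H\<^esub> t = y \<otimes>\<^bsub>H\<^esub> (y [^]\<^bsub>H\<^esub> i \<otimes>\<^bsub>H\<^esub> t)" for i :: nat
    using t hecke.P.nat_pow_Suc2[of y q i] by (metis hecke.P.m_assoc hecke.P.nat_pow_closed y_closed)
  show ?thesis
  proof (rule that[of \<tau>])
    show "\<tau> p = t" using \<tau>[of 0] p t by (simp add: act_one)
    show "\<tau> (act y r) = y \<otimes>\<^bsub>H\<^esub> \<tau> r" if r: "r \<in> y_orbit p" for r
    proof -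
      obtain i :: nat where r: "r = act (y [^]\<^bsub>H\<^esub> i) p" using r by (auto simp: y_orbit_def)
      show ?thesis using \<tau>[of "Suc i"] unfolding y_Suc act_y_pow_Suc[OF p] by (simp add: r \<tau>)
    qed
    have "reach E (act (y [^]\<^bsub>H\<^esub> i) p) (y [^]\<^bsub>H\<^esub> i \<otimes>\<^bsub>H\<^esub> t)" if "reach E p t" for E and i :: nat
    proof (induction i)
      case 0
      then show ?case using that p t by (simp add: act_one)
    next
      case (Suc i)
      have "act y (act (y [^]\<^bsub>H\<^esub> i) p) \<noteq> act (y [^]\<^bsub>H\<^esub> i) p"
      proof
        assume "act y (act (y [^]\<^bsub>H\<^esub> i) p) = act (y [^]\<^bsub>H\<^esub> i) p"
        then have "y [^]\<^bsub>H\<^esub> Suc i = y [^]\<^bsub>H\<^esub> i"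
          using y_pow_eq[OF p False, of "Suc i" i] act_y_pow_Suc[OF p, of i] by simp
        then have "y = \<one>\<^bsub>H\<^esub>" by simp
        then show False using False act_one[OF p] by simp
      qed
      then show ?case
        unfolding y_Suc act_y_pow_Suc[OF p] using Suc by (intro reach_y)
    qed
    then show "reach E r (\<tau> r)" if "r \<in> y_orbit p" "reach E p t" for r E
      using that by (auto simp: y_orbit_def \<tau>)
  qed
qed

text \<open>A partial spanning tree: \<open>S\<close> is a union of orbits of \<open>y\<close>, connected by the edges
  \<open>{p, act x p}\<close> with \<open>p \<in> E\<close>, and \<open>t p\<close> is the group element that leads from the base point to
  \<open>p\<close> inside the tree. When an orbit of \<open>y\<close> without fixed points is added, only one of its points is
  put into \<open>E\<close>, and so another one remains outside \<open>E\<close>: this is the last clause.\<close>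

definition tree :: "'p set \<Rightarrow> 'p set \<Rightarrow> ('p \<Rightarrow> gen word set) \<Rightarrow> bool" where
  "tree S E t \<longleftrightarrow> p0 \<in> S \<and> S \<subseteq> X \<and> (\<forall>p\<in>S. act y p \<in> S) \<and> E \<subseteq> S \<and>
    (\<forall>p\<in>E. act x p \<in> E \<and> act x p \<noteq> p) \<and> t p0 = \<one>\<^bsub>H\<^esub> \<and> (\<forall>p\<in>S. reach E p (t p)) \<and>
    (\<forall>p\<in>S. act y p \<noteq> p \<longrightarrow> t (act y p) = y \<otimes>\<^bsub>H\<^esub> t p) \<and>
    (\<forall>p\<in>E. t (act x p) = x \<otimes>\<^bsub>H\<^esub> t p) \<and>
    ((\<forall>p\<in>S. act y p \<noteq> p) \<longrightarrow> (\<exists>p\<in>S. p \<notin> E))"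

lemma y_orbit_subset: "p \<in> X \<Longrightarrow> y_orbit p \<subseteq> X"
  by (auto simp: y_orbit_def act_closed)

lemma ex_tree_base: "\<exists>E S t. tree S E t"
proof -
  obtain \<tau> where \<tau>: "\<tau> p0 = \<one>\<^bsub>H\<^esub>"
    "\<And>r. r \<in> y_orbit p0 \<Longrightarrow> act y r \<noteq> r \<Longrightarrow> \<tau> (act y r) = y \<otimes>\<^bsub>H\<^esub> \<tau> r"
    "\<And>r E. r \<in> y_orbit p0 \<Longrightarrow> reach E p0 \<one>\<^bsub>H\<^esub> \<Longrightarrow> reach E r (\<tau> r)"
    using ex_orbit_section[OF p0 hecke.P.one_closed] by blast
  have "tree (y_orbit p0) {} \<tau>"
    unfolding tree_def using \<tau> y_orbit_self[OF p0] y_orbit_subset[OF p0] y_orbit_closed[OF p0] reach_base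
    by auto
  then show ?thesis by blast
qed

lemma ex_tree_step:
  assumes tree: "tree S E t" and "S \<noteq> X"
  obtains S' E' t' where "tree S' E' t'" "S \<subset> S'"
proof -
  have S: "S \<subseteq> X" "p0 \<in> S" "E \<subseteq> S" "\<And>p. p \<in> S \<Longrightarrow> act y p \<in> S"
    and E: "\<And>p. p \<in> E \<Longrightarrow> act x p \<in> E \<and> act x p \<noteq> p"
    using tree by (auto simp: tree_def)
  \<comment> \<open>By transitivity, \<open>S\<close> is not closed under both generators.\<close>
  have "\<exists>p\<in>S. act x p \<notin> S"
  proof (rule ccontr)
    assume closed: "\<not> ?thesis"
    have "act w p0 \<in> S" if "w \<in> carrier H" for w
      using q_pos that by (induction rule: hecke_induct)
        (use S closed p0 in \<open>auto simp: act_one act_mult\<close>)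
    then show False using transitive S \<open>S \<noteq> X\<close> by blast
  qed
  then obtain p where p: "p \<in> S" "act x p \<notin> S" by blast
  define r where "r = act x p"
  have pX: "p \<in> X" and rX: "r \<in> X" using p S by (auto simp: r_def act_closed)
  have xr: "act x r = p" using pX by (simp add: r_def act_x_x)
  have disj: "S \<inter> y_orbit r = {}"
  proof (rule ccontr)
    assume "\<not> ?thesis"
    then obtain i :: nat where i: "act (y [^]\<^bsub>H\<^esub> i) r \<in> S" by (auto simp: y_orbit_def)
    have *: "act (y [^]\<^bsub>H\<^esub> k) s \<in> S" if "s \<in> S" for s and k :: nat
    proof (induction k)
      case (Suc k)
      then show ?case using that S act_y_pow_Suc[of s k] by (simp only: subsetD)
    qed (use that S in \<open>auto simp: act_one\<close>)
    have "act (y [^]\<^bsub>H\<^esub> (q * i - i)) (act (y [^]\<^bsub>H\<^esub> i) r) = act ((y [^]\<^bsub>H\<^esub> q) [^]\<^bsub>H\<^esub> i) r"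
      using rX q_pos by (simp add: act_mult[symmetric] hecke.P.nat_pow_mult hecke.P.nat_pow_pow)
    then have "act (y [^]\<^bsub>H\<^esub> (q * i - i)) (act (y [^]\<^bsub>H\<^esub> i) r) = r"
      using rX by (simp add: hy_pow act_one)
    then show False using *[OF i, of "q * i - i"] p by (simp add: r_def)
  qed
  have reach_p: "reach E p (t p)" using tree p by (auto simp: tree_def)
  define E' where "E' = E \<union> {p, r}"
  have "reach E' r (x \<otimes>\<^bsub>H\<^esub> t p)"
    unfolding r_def by (rule reach_x[OF reach_mono[OF reach_p]]) (auto simp: E'_def)
  moreover obtain \<tau> where \<tau>: "\<tau> r = x \<otimes>\<^bsub>H\<^esub> t p"
    "\<And>s. s \<in> y_orbit r \<Longrightarrow> act y s \<noteq> s \<Longrightarrow> \<tau> (act y s) = y \<otimes>\<^bsub>H\<^esub> \<tau> s"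
    "\<And>s E. s \<in> y_orbit r \<Longrightarrow> reach E r (x \<otimes>\<^bsub>H\<^esub> t p) \<Longrightarrow> reach E s (\<tau> s)"
    using ex_orbit_section[OF rX, of "x \<otimes>\<^bsub>H\<^esub> t p"] reach_closed[OF reach_p] by auto
  ultimately have reach_O: "reach E' s (\<tau> s)" if "s \<in> y_orbit r" for s using that by blast
  define S' where "S' = S \<union> y_orbit r"
  define t' where "t' = (\<lambda>s. if s \<in> S then t s else \<tau> s)"
  have r_S: "r \<in> S'" "r \<notin> S" using p y_orbit_self[OF rX] by (auto simp: S'_def r_def)
  have t'_O: "t' s = \<tau> s" if "s \<in> y_orbit r" for s using that disj by (auto simp: t'_def)
  have pE: "p \<notin> E" using E S p by blast
  have xx_tp: "x \<otimes>\<^bsub>H\<^esub> (x \<otimes>\<^bsub>H\<^esub> t p) = t p"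
    using reach_closed[OF reach_p] by (simp add: hecke.P.m_assoc[symmetric] hx_hx)
  have "tree S' E' t'"
    unfolding tree_def
  proof (intro conjI ballI impI)
    show "act x s \<in> E'" "act x s \<noteq> s" if "s \<in> E'" for s
      using that E xr p r_S by (auto simp: E'_def r_def)
    show "reach E' s (t' s)" if "s \<in> S'" for s
    proof (cases "s \<in> S")
      case True
      then have "reach E s (t s)" using tree by (auto simp: tree_def)
      then have "reach E' s (t s)" by (rule reach_mono) (auto simp: E'_def)
      then show ?thesis using True by (simp add: t'_def)
    next
      case False
      then show ?thesis using that reach_O t'_O by (auto simp: S'_def)
    qed
    show "t' (act y s) = y \<otimes>\<^bsub>H\<^esub> t' s" if "s \<in> S'" "act y s \<noteq> s" for s
    proof (cases "s \<in> S")
      case True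
      then show ?thesis using tree that S by (auto simp: t'_def tree_def)
    next
      case False
      then have "s \<in> y_orbit r" using that by (auto simp: S'_def)
      then show ?thesis using that \<tau>(2) t'_O y_orbit_closed[OF rX] by simp
    qed
    show "t' (act x s) = x \<otimes>\<^bsub>H\<^esub> t' s" if s: "s \<in> E'" for s
    proof -
      consider "s \<in> E" | "s = p" | "s = r" using s by (auto simp: E'_def)
      then show ?thesis
      proof cases
        case 1
        then have "act x s \<in> S" "s \<in> S" using E S by auto
        then show ?thesis using tree 1 by (auto simp: t'_def tree_def)
      next
        case 2
        then show ?thesis using \<tau>(1) p r_S by (simp add: t'_def flip: r_def)
      next
        case 3
        then show ?thesis using \<tau>(1) p r_S xr xx_tp by (simp add: t'_def)
      qed
    qed
    show "\<exists>s\<in>S'. s \<notin> E'" if "\<forall>s\<in>S'. act y s \<noteq> s"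
    proof (rule bexI[of _ "act y r"])
      \<comment> \<open>The point \<open>r\<close> of the new orbit is in \<open>E'\<close>, and \<open>act y r\<close> is not.\<close>
      show "act y r \<in> S'" using y_orbit_closed[OF rX y_orbit_self[OF rX]] by (simp add: S'_def)
      have "act y r \<notin> S" using disj y_orbit_closed[OF rX y_orbit_self[OF rX]] by blast
      then show "act y r \<notin> E'" using that r_S S p by (auto simp: E'_def)
    qed
    show "t' p0 = \<one>\<^bsub>H\<^esub>" using tree S by (simp add: t'_def tree_def)
  qed (use S p y_orbit_subset[OF rX] y_orbit_closed[OF rX] r_S in \<open>auto simp: S'_def E'_def\<close>)
  moreover have "S \<subset> S'" using r_S by (auto simp: S'_def)
  ultimately show ?thesis using that by blast
qed

lemma ex_spanning_tree: "\<exists>E t. tree X E t"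
proof -
  have "\<exists>E t. tree X E t" if "tree S E t" for S E t
    using that
  proof (induction "card (X - S)" arbitrary: S E t rule: less_induct)
    case less
    show ?case
    proof (cases "S = X")
      case False
      then obtain S' E' t' where 1: "tree S' E' t'" "S \<subset> S'"
        using ex_tree_step[OF less.prems] by blast
      then have "X - S' \<subset> X - S" by (auto simp: tree_def)
      then have "card (X - S') < card (X - S)" using finite_X by (intro psubset_card_mono) auto
      then show ?thesis using less.hyps 1 by blast
    qed (use less in blast)
  qed
  then show ?thesis using ex_tree_base by blast
qed


text \<open>The stabilizer is a free product of cyclic groups. Relative to a spanning tree, its free basis
  consists of the Schreier generators that belong to the fixed points of \<open>y\<close> (order \<open>q\<close>), to the
  fixed points of \<open>x\<close> (order \<open>2\<close>), and to the remaining edges \<open>{p, act x p}\<close>, with one of the two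
  orientations chosen (infinite order). Freeness is shown by exhibiting the coordinate homomorphism
  \<open>\<psi>\<close> to the abstract free product \<open>C\<close>: the action on \<open>X\<close> is lifted to the covering \<open>C \<times> X\<close>.\<close>

lemma stab_basis:
  assumes "q \<noteq> 2"
  obtains J :: "('p + 'p) set" and d e \<phi>
  where "finite J" "J \<noteq> {}"
    "\<And>j. j \<in> J \<Longrightarrow> d j \<in> {0, 2, q}"
    "\<And>j. j \<in> J \<Longrightarrow> e j \<in> stab"
    "\<And>j. j \<in> J \<Longrightarrow> d j = 2 \<Longrightarrow> \<exists>g\<in>carrier H. e j = inv\<^bsub>H\<^esub> g \<otimes>\<^bsub>H\<^esub> (x \<otimes>\<^bsub>H\<^esub> g)"
    "\<And>j. j \<in> J \<Longrightarrow> d j = q \<Longrightarrow> \<exists>g\<in>carrier H. e j = inv\<^bsub>H\<^esub> g \<otimes>\<^bsub>H\<^esub> (y \<otimes>\<^bsub>H\<^esub> g)"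
    "\<phi> \<in> iso (cyc J d) (subgrp H stab)"
    "\<And>j. j \<in> J \<Longrightarrow> \<phi> (cyc.gen J d j) = e j"
proof -
  obtain E t where tree: "tree X E t" using ex_spanning_tree by blast
  have E: "p \<in> X" "act x p \<in> E" "act x p \<noteq> p" "t (act x p) = x \<otimes>\<^bsub>H\<^esub> t p" if "p \<in> E" for p
    using tree that by (auto simp: tree_def)
  have reach: "reach E p (t p)" if "p \<in> X" for p using tree that by (auto simp: tree_def)
  have t: "t p \<in> carrier H" "act (t p) p0 = p" if "p \<in> X" for p
    using reach_closed[OF reach[OF that]] by auto
  have t0: "t p0 = \<one>\<^bsub>H\<^esub>" using tree by (simp add: tree_def)
  have t_y: "t (act y p) = y \<otimes>\<^bsub>H\<^esub> t p" if "p \<in> X" "act y p \<noteq> p" for p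
    using tree that by (auto simp: tree_def)
  have x_X: "act x p \<in> X" and y_X: "act y p \<in> X" if "p \<in> X" for p using that by (auto intro: act_closed)
  note simps = x_X y_X t act_x_x

  define Iq where "Iq = {p \<in> X. act y p = p}"
  define I2 where "I2 = {p \<in> X. act x p = p}"
  define edge where "edge = (\<lambda>p. {p, act x p})"
  \<comment> \<open>\<open>R\<close> contains exactly one end of each edge outside the tree. The choice depends only on the
    unordered pair \<open>edge p\<close>.\<close>
  define R where "R = {p \<in> X - E. act x p \<noteq> p \<and> p = (SOME r. r \<in> edge p)}"
  define J where "J = Inl ` Iq \<union> Inr ` (I2 \<union> R)"
  define d where "d = case_sum (\<lambda>_::'p. q) (\<lambda>p. if act x p = p then 2 else 0)"
  define s where "s = (\<lambda>p. inv\<^bsub>H\<^esub> (t (act x p)) \<otimes>\<^bsub>H\<^esub> (x \<otimes>\<^bsub>H\<^esub> t p))"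
  define r where "r = (\<lambda>p. inv\<^bsub>H\<^esub> (t (act y p)) \<otimes>\<^bsub>H\<^esub> (y \<otimes>\<^bsub>H\<^esub> t p))"
  define e where "e = case_sum r s"

  have R_iff: "act x p \<in> R \<longleftrightarrow> p \<notin> R" if "p \<in> X" "p \<notin> E" "act x p \<noteq> p" for p
  proof -
    have xE: "act x p \<notin> E" using E(2)[of "act x p"] that by (auto simp: act_x_x)
    have "edge (act x p) = edge p" using that by (auto simp: edge_def act_x_x)
    then have "act x p \<in> R \<longleftrightarrow> act x p = (SOME r. r \<in> edge p)"
      using that xE by (simp add: R_def simps)
    moreover have "p \<in> R \<longleftrightarrow> p = (SOME r. r \<in> edge p)"
      using that by (simp add: R_def)
    moreover have "(SOME r. r \<in> edge p) \<in> edge p"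
      by (rule someI[of _ p]) (simp add: edge_def)
    ultimately show ?thesis using that(3) by (auto simp: edge_def)
  qed
  have I2_R: "I2 \<subseteq> X" "R \<subseteq> X" "Iq \<subseteq> X" "I2 \<inter> R = {}" "R \<inter> E = {}" "I2 \<inter> E = {}"
    using E(3) by (auto simp: I2_def R_def Iq_def)

  have J_elim: "Q j" if "j \<in> J" "\<And>p. p \<in> Iq \<Longrightarrow> Q (Inl p)" "\<And>p. p \<in> I2 \<union> R \<Longrightarrow> Q (Inr p)" for Q j
    using that by (auto simp: J_def)
  have s_closed: "s p \<in> carrier H" and r_closed: "r p \<in> carrier H" if "p \<in> X" for p
    using that by (auto simp: s_def r_def simps)
  have act_inv_t: "act (inv\<^bsub>H\<^esub> (t p)) p = p0" if "p \<in> X" for p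
    using act_inv(1)[OF t(1)[OF that] p0] t(2)[OF that] by simp
  have "s p \<in> stab" "r p \<in> stab" if "p \<in> X" for p
    using that by (simp_all add: stab_def s_closed r_closed)
      (simp_all add: s_def r_def act_mult simps p0 act_inv_t)
  then have e_stab: "e j \<in> stab" if "j \<in> J" for j
    using that I2_R by (auto simp: J_def e_def)
  have s_I2: "s p = inv\<^bsub>H\<^esub> (t p) \<otimes>\<^bsub>H\<^esub> (x \<otimes>\<^bsub>H\<^esub> t p)" if "p \<in> I2" for p
    using that by (simp add: s_def I2_def)
  have r_Iq: "r p = inv\<^bsub>H\<^esub> (t p) \<otimes>\<^bsub>H\<^esub> (y \<otimes>\<^bsub>H\<^esub> t p)" if "p \<in> Iq" for p
    using that by (simp add: r_def Iq_def)
  have e_pow: "e j [^]\<^bsub>H\<^esub> d j = \<one>\<^bsub>H\<^esub>" if "j \<in> J" for j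
    using that
  proof (rule J_elim)
    fix p assume "p \<in> Iq"
    then show "e (Inl p) [^]\<^bsub>H\<^esub> d (Inl p) = \<one>\<^bsub>H\<^esub>"
      using I2_R by (auto simp: e_def d_def r_Iq hecke.P.conj_pow t hy_pow)
  next
    fix p assume p: "p \<in> I2 \<union> R"
    then show "e (Inr p) [^]\<^bsub>H\<^esub> d (Inr p) = \<one>\<^bsub>H\<^esub>"
    proof (cases "p \<in> I2")
      case True
      then show ?thesis
        using I2_R by (auto simp: e_def d_def s_I2 hecke.P.conj_pow t hx_pow)
    next
      case False
      then show ?thesis using p by (auto simp: e_def d_def I2_def R_def)
    qed
  qed

  \<comment> \<open>The telescoping argument of Schreier.\<close>
  let ?Q = "generate H (e ` J)"
  have s_Q: "s p \<in> ?Q" if p: "p \<in> X" for p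
  proof -
    have gen_Q: "s p \<in> ?Q" if "p \<in> I2 \<union> R" for p
      using that by (intro generate.incl image_eqI[of _ _ "Inr p"]) (auto simp: e_def J_def)
    consider "p \<in> I2 \<union> R" | "p \<in> E" | "p \<notin> E" "p \<notin> I2" "p \<notin> R" by blast
    then show ?thesis
    proof cases
      case 2
      then have "s p = \<one>\<^bsub>H\<^esub>" using p by (simp add: s_def E t)
      then show ?thesis using generate.one by metis
    next
      case 3
      then have xR: "act x p \<in> R" using R_iff[of p] p by (auto simp: I2_def)
      have "inv\<^bsub>H\<^esub> (s (act x p)) = s p"
        using p by (simp add: s_def simps hecke.P.inv_mult_group hecke.P.m_assoc inv_hx)
      moreover have "inv\<^bsub>H\<^esub> (s (act x p)) \<in> ?Q"
        using xR by (intro generate.inv image_eqI[of _ _ "Inr (act x p)"]) (auto simp: e_def J_def)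
      ultimately show ?thesis by simp
    qed (use gen_Q in blast)
  qed
  have r_Q: "r p \<in> ?Q" if p: "p \<in> X" for p
  proof (cases "p \<in> Iq")
    case True
    then show ?thesis by (intro generate.incl image_eqI[of _ _ "Inl p"]) (auto simp: e_def J_def)
  next
    case False
    then have "r p = \<one>\<^bsub>H\<^esub>" using p by (simp add: r_def t_y t Iq_def)
    then show ?thesis using generate.one by metis
  qed
  have Schreier: "inv\<^bsub>H\<^esub> (t (act w p)) \<otimes>\<^bsub>H\<^esub> (w \<otimes>\<^bsub>H\<^esub> t p) \<in> ?Q" if "w \<in> carrier H" "p \<in> X" for w p
    using q_pos that(1)
  proof (induction rule: hecke_induct)
    case one
    then show ?case using that(2) generate.one[of H] by (simp add: act_one t)
  next
    case (x w)
    let ?p = "act w p"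
    have X: "?p \<in> X" using x that by (simp add: act_closed)
    have "inv\<^bsub>H\<^esub> (t (act (hx q \<otimes>\<^bsub>H\<^esub> w) p)) \<otimes>\<^bsub>H\<^esub> (hx q \<otimes>\<^bsub>H\<^esub> w \<otimes>\<^bsub>H\<^esub> t p)
        = s ?p \<otimes>\<^bsub>H\<^esub> (inv\<^bsub>H\<^esub> (t ?p) \<otimes>\<^bsub>H\<^esub> (w \<otimes>\<^bsub>H\<^esub> t p))"
      using x X that(2) by (simp add: s_def act_mult hecke.P.m_assoc simps hecke.P.mult_inv_cancel)
    then show ?case using generate.eng[OF s_Q[OF X] x(2)] by simp
  next
    case (y w)
    let ?p = "act w p"
    have X: "?p \<in> X" using y that by (simp add: act_closed)
    have "inv\<^bsub>H\<^esub> (t (act (hy q \<otimes>\<^bsub>H\<^esub> w) p)) \<otimes>\<^bsub>H\<^esub> (hy q \<otimes>\<^bsub>H\<^esub> w \<otimes>\<^bsub>H\<^esub> t p)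
        = r ?p \<otimes>\<^bsub>H\<^esub> (inv\<^bsub>H\<^esub> (t ?p) \<otimes>\<^bsub>H\<^esub> (w \<otimes>\<^bsub>H\<^esub> t p))"
      using y X that(2) by (simp add: r_def act_mult hecke.P.m_assoc simps hecke.P.mult_inv_cancel)
    then show ?case using generate.eng[OF r_Q[OF X] y(2)] by simp
  qed
  have stab_Q: "stab \<subseteq> ?Q"
  proof
    fix w assume "w \<in> stab"
    then show "w \<in> ?Q" using Schreier[of w p0] p0 by (simp add: stab_def t0)
  qed

  \<comment> \<open>The covering of the action with fibre \<open>C\<close>; it is trivial along the tree.\<close>
  let ?C = "cyc J d"
  define gl gr where "gl = (\<lambda>p. cyc.gen J d (Inl p))" and "gr = (\<lambda>p. cyc.gen J d (Inr p))"
  have gl: "gl p \<in> carrier ?C" "gl p [^]\<^bsub>?C\<^esub> q = \<one>\<^bsub>?C\<^esub>" if "p \<in> Iq" for p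
    using that cyc_gen_pow[of "Inl p" J d] by (auto simp: gl_def J_def d_def)
  have gr: "gr p \<in> carrier ?C" if "p \<in> I2 \<union> R" for p
    using that by (auto simp: gr_def J_def)
  have gr2: "gr p \<otimes>\<^bsub>?C\<^esub> gr p = \<one>\<^bsub>?C\<^esub>" if "p \<in> I2" for p
  proof -
    have "gr p [^]\<^bsub>?C\<^esub> (2::nat) = \<one>\<^bsub>?C\<^esub>"
      using that cyc_gen_pow[of "Inr p" J d] by (auto simp: gr_def J_def d_def I2_def)
    then show ?thesis using gr that by (simp add: numeral_2_eq_2)
  qed
  define a where "a = (\<lambda>p. if p \<in> I2 \<union> R then gr p else if act x p \<in> R then inv\<^bsub>?C\<^esub> (gr (act x p)) else \<one>\<^bsub>?C\<^esub>)"
  define b where "b = (\<lambda>p. if p \<in> Iq then gl p else \<one>\<^bsub>?C\<^esub>)"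
  have a_closed: "a p \<in> carrier ?C" and b_closed: "b p \<in> carrier ?C" for p
    using gr gl by (auto simp: a_def b_def)
  have a_E: "a p = \<one>\<^bsub>?C\<^esub>" if "p \<in> E" for p
  proof -
    have "p \<notin> I2 \<union> R" "act x p \<notin> R" using I2_R that E(2) by blast+
    then show ?thesis by (simp add: a_def)
  qed
  have a_a: "a (act x p) \<otimes>\<^bsub>?C\<^esub> a p = \<one>\<^bsub>?C\<^esub>" if p: "p \<in> X" for p
  proof (cases "act x p = p")
    case True
    then have "p \<in> I2" using p by (simp add: I2_def)
    then show ?thesis using True gr2 by (simp add: a_def)
  next
    case False
    then have nI2: "p \<notin> I2" "act x p \<notin> I2" using p by (auto simp: I2_def act_x_x)
    show ?thesis
    proof (cases "p \<in> E")
      case True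
      then show ?thesis using a_E E(2) by simp
    next
      case notE: False
      then show ?thesis
        using nI2 R_iff[OF p notE False] p gr by (auto simp: a_def act_x_x)
    qed
  qed
  define Y where "Y = carrier ?C \<times> X"
  define fx where "fx = (\<lambda>(g, p). (a p \<otimes>\<^bsub>?C\<^esub> g, act x p))"
  define fy where "fy = (\<lambda>(g, p). (b p \<otimes>\<^bsub>?C\<^esub> g, act y p))"
  have fx_Y: "fx z \<in> Y" "fx (fx z) = z" if "z \<in> Y" for z
    using that a_a by (auto simp: fx_def Y_def a_closed simps cyc.P.m_assoc[symmetric])
  have fy_Y: "fy z \<in> Y" if "z \<in> Y" for z
    using that by (auto simp: fy_def Y_def b_closed simps)
  have fy_pow: "(fy ^^ k) (g, p) = (if p \<in> Iq then gl p [^]\<^bsub>?C\<^esub> k \<otimes>\<^bsub>?C\<^esub> g else g, act (y [^]\<^bsub>H\<^esub> k) p)"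
    if gp: "g \<in> carrier ?C" "p \<in> X" for k g p
  proof (induction k)
    case 0
    then show ?case using gp by (auto simp: act_one gl)
  next
    case (Suc k)
    let ?p = "act (y [^]\<^bsub>H\<^esub> k) p"
    have "?p \<in> Iq \<longleftrightarrow> p \<in> Iq"
    proof
      assume "?p \<in> Iq"
      then have "act (y [^]\<^bsub>H\<^esub> Suc k) p = ?p" using act_y_pow_Suc[OF gp(2), of k] by (simp add: Iq_def)
      moreover have "act (y [^]\<^bsub>H\<^esub> Suc k) p = act (y [^]\<^bsub>H\<^esub> k) (act y p)"
        using gp(2) by (simp add: act_mult)
      ultimately have "act y p = p"
        using act_inv(1)[of "y [^]\<^bsub>H\<^esub> k"] gp(2) y_X by (metis hecke.P.nat_pow_closed y_closed)
      then show "p \<in> Iq" using gp by (simp add: Iq_def)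
    next
      assume "p \<in> Iq"
      then have "?p = p" using act_pow gp by (auto simp: Iq_def)
      then show "?p \<in> Iq" using \<open>p \<in> Iq\<close> by simp
    qed
    moreover have "?p = p" if "p \<in> Iq" using that act_pow gp by (auto simp: Iq_def)
    moreover have "gl p \<otimes>\<^bsub>?C\<^esub> (gl p [^]\<^bsub>?C\<^esub> k \<otimes>\<^bsub>?C\<^esub> g) = gl p [^]\<^bsub>?C\<^esub> Suc k \<otimes>\<^bsub>?C\<^esub> g" if "p \<in> Iq"
      using cyc.P.nat_pow_Suc2[OF gl(1)[OF that], of k] gl(1)[OF that] gp(1)
      by (metis cyc.P.m_assoc cyc.P.nat_pow_closed)
    ultimately show ?case
      using Suc gp act_y_pow_Suc[OF gp(2), of k] by (auto simp: fy_def b_def)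
  qed
  have fy_q: "(fy ^^ q) z = z" if "z \<in> Y" for z
    using that fy_pow gl(2) by (auto simp: Y_def hy_pow act_one)
  obtain A where A_one: "\<And>z. z \<in> Y \<Longrightarrow> A \<one>\<^bsub>H\<^esub> z = z"
    and A_closed: "\<And>w z. w \<in> carrier H \<Longrightarrow> z \<in> Y \<Longrightarrow> A w z \<in> Y"
    and A_x: "\<And>w z. w \<in> carrier H \<Longrightarrow> z \<in> Y \<Longrightarrow> A (x \<otimes>\<^bsub>H\<^esub> w) z = fx (A w z)"
    and A_y: "\<And>w z. w \<in> carrier H \<Longrightarrow> z \<in> Y \<Longrightarrow> A (y \<otimes>\<^bsub>H\<^esub> w) z = fy (A w z)"
    using ex_hecke_action[OF q_pos fx_Y fy_Y fy_q] by blast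
  have A_mult: "A (v \<otimes>\<^bsub>H\<^esub> w) z = A v (A w z)" if "v \<in> carrier H" "w \<in> carrier H" "z \<in> Y" for v w z
    using q_pos that(1)
    by (induction rule: hecke_induct) (use that in \<open>simp_all add: A_one A_closed A_x A_y hecke.P.m_assoc\<close>)
  define c where "c = (\<lambda>w p. fst (A w (\<one>\<^bsub>?C\<^esub>, p)))"
  have c_eq: "c w p = fst (A w (\<one>\<^bsub>?C\<^esub>, p))" for w p by (simp add: c_def)
  have base: "(g, p) \<in> Y \<longleftrightarrow> g \<in> carrier ?C \<and> p \<in> X" for g p by (simp add: Y_def)
  have c_closed: "c w p \<in> carrier ?C" if "w \<in> carrier H" "p \<in> X" for w p
    using A_closed[OF that(1), of "(\<one>\<^bsub>?C\<^esub>, p)"] that by (auto simp: c_def Y_def)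
  have A_c_all: "\<forall>g\<in>carrier ?C. A w (g, p) = (c w p \<otimes>\<^bsub>?C\<^esub> g, act w p)"
    if "w \<in> carrier H" "p \<in> X" for w p
    using q_pos that(1)
  proof (induction rule: hecke_induct)
    case one
    then show ?case using that by (simp add: A_one base c_def act_one)
  next
    case (x w)
    then have "A w (\<one>\<^bsub>?C\<^esub>, p) = (c w p, act w p)"
      using c_closed[OF x(1) that(2)] by simp
    then have "c (hx q \<otimes>\<^bsub>H\<^esub> w) p = a (act w p) \<otimes>\<^bsub>?C\<^esub> c w p"
      using x(1) that(2) by (simp add: c_eq[of "hx q \<otimes>\<^bsub>H\<^esub> w"] A_x base fx_def)
    then show ?case
      using x that(2) c_closed[OF x(1) that(2)]
      by (simp add: A_x base fx_def act_mult a_closed cyc.P.m_assoc)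
  next
    case (y w)
    then have "A w (\<one>\<^bsub>?C\<^esub>, p) = (c w p, act w p)"
      using c_closed[OF y(1) that(2)] by simp
    then have "c (hy q \<otimes>\<^bsub>H\<^esub> w) p = b (act w p) \<otimes>\<^bsub>?C\<^esub> c w p"
      using y(1) that(2) by (simp add: c_eq[of "hy q \<otimes>\<^bsub>H\<^esub> w"] A_y base fy_def)
    then show ?case
      using y that(2) c_closed[OF y(1) that(2)]
      by (simp add: A_y base fy_def act_mult b_closed cyc.P.m_assoc)
  qed
  then have A_c: "A w (g, p) = (c w p \<otimes>\<^bsub>?C\<^esub> g, act w p)"
    if "w \<in> carrier H" "g \<in> carrier ?C" "p \<in> X" for w g p
    using that by blast
  have "A u (\<one>\<^bsub>?C\<^esub>, p0) = (\<one>\<^bsub>?C\<^esub>, p)" if "reach E p u" for p u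
    using that
  proof (induction rule: reach.induct)
    case reach_base
    then show ?case by (simp add: A_one base p0)
  next
    case (reach_y p u)
    then have "p \<notin> Iq" "u \<in> carrier H" using reach_closed by (auto simp: Iq_def)
    then show ?case using reach_y by (simp add: A_y base p0 fy_def b_def)
  next
    case (reach_x p u)
    then have "u \<in> carrier H" using reach_closed by auto
    then show ?case using reach_x by (simp add: A_x base p0 fx_def a_E)
  qed
  then have A_t: "A (t p) (g, p0) = (g, p)" if "p \<in> X" "g \<in> carrier ?C" for p g
    using A_c[OF t(1)[OF that(1)] that(2) p0] reach[OF that(1)] that t(2)[OF that(1)]
    by (simp add: c_def)
  have A_inv_t: "A (inv\<^bsub>H\<^esub> (t p)) (g, p) = (g, p0)" if "p \<in> X" "g \<in> carrier ?C" for p g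
    using A_mult[of "inv\<^bsub>H\<^esub> (t p)" "t p" "(g, p0)"] that t[OF that(1)]
    by (simp add: A_t base p0 A_one)
  define \<psi> where "\<psi> = (\<lambda>w. c w p0)"
  have "\<psi> \<in> hom (subgrp H stab) ?C"
  proof (rule homI)
    fix v w assume "v \<in> carrier (subgrp H stab)" "w \<in> carrier (subgrp H stab)"
    then have vw: "v \<in> carrier H" "w \<in> carrier H" "act v p0 = p0" "act w p0 = p0"
      by (simp_all add: stab_def)
    have "A (v \<otimes>\<^bsub>H\<^esub> w) (\<one>\<^bsub>?C\<^esub>, p0) = A v (A w (\<one>\<^bsub>?C\<^esub>, p0))"
      using vw by (simp add: A_mult base p0)
    also have "\<dots> = (c v p0 \<otimes>\<^bsub>?C\<^esub> c w p0, p0)"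
      using vw by (simp add: A_c p0 c_closed)
    finally show "\<psi> (v \<otimes>\<^bsub>subgrp H stab\<^esub> w) = \<psi> v \<otimes>\<^bsub>?C\<^esub> \<psi> w"
      by (simp add: \<psi>_def c_eq[of "v \<otimes>\<^bsub>H\<^esub> w"])
  qed (auto simp: \<psi>_def stab_def c_closed p0)
  moreover have "\<psi> (e j) = cyc.gen J d j" if "j \<in> J" for j
    using that
  proof (rule J_elim)
    fix p assume p: "p \<in> Iq"
    then have pX: "p \<in> X" using I2_R by blast
    have "A (e (Inl p)) (\<one>\<^bsub>?C\<^esub>, p0) = A (inv\<^bsub>H\<^esub> (t p)) (A (y \<otimes>\<^bsub>H\<^esub> t p) (\<one>\<^bsub>?C\<^esub>, p0))"
      using p pX by (simp add: e_def r_Iq A_mult t base p0)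
    also have "A (y \<otimes>\<^bsub>H\<^esub> t p) (\<one>\<^bsub>?C\<^esub>, p0) = (gl p, p)"
      using p pX gl by (simp add: A_y t base p0 A_t fy_def b_def) (simp add: Iq_def)
    finally show "\<psi> (e (Inl p)) = cyc.gen J d (Inl p)"
      using pX gl[OF p] by (simp add: A_inv_t \<psi>_def c_def gl_def)
  next
    fix p assume p: "p \<in> I2 \<union> R"
    then have pX: "p \<in> X" using I2_R by blast
    have "A (e (Inr p)) (\<one>\<^bsub>?C\<^esub>, p0) = A (inv\<^bsub>H\<^esub> (t (act x p))) (A (x \<otimes>\<^bsub>H\<^esub> t p) (\<one>\<^bsub>?C\<^esub>, p0))"
      using pX by (simp add: e_def s_def A_mult simps base p0)
    also have "A (x \<otimes>\<^bsub>H\<^esub> t p) (\<one>\<^bsub>?C\<^esub>, p0) = (gr p, act x p)"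
      using p pX gr by (simp add: A_x t base p0 A_t fx_def a_def)
    finally show "\<psi> (e (Inr p)) = cyc.gen J d (Inr p)"
      using pX gr[OF p] by (simp add: A_inv_t \<psi>_def c_def gr_def x_X)
  qed
  moreover have "group (subgrp H stab)"
    by (rule subgroup.subgroup_is_group[OF subgroup_stab hecke.group_P])
  moreover have "e j [^]\<^bsub>subgrp H stab\<^esub> d j = \<one>\<^bsub>subgrp H stab\<^esub>" if "j \<in> J" for j
    using e_pow[OF that] by (simp flip: hecke.P.nat_pow_consistent)
  moreover have "carrier (subgrp H stab) \<subseteq> generate (subgrp H stab) (e ` J)"
    using stab_Q hecke.P.generate_consistent[OF _ subgroup_stab, of "e ` J"] e_stab by auto
  moreover have "e j \<in> carrier (subgrp H stab)" if "j \<in> J" for j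
    using e_stab[OF that] by simp
  ultimately obtain \<phi> where \<phi>: "\<phi> \<in> iso ?C (subgrp H stab)" "\<And>j. j \<in> J \<Longrightarrow> \<phi> (cyc.gen J d j) = e j"
    using cyc_isoI[of "subgrp H stab" J e d \<psi>] by metis

  have "J \<noteq> {}"
  proof (cases "\<exists>p\<in>X. act y p = p")
    case True
    then show ?thesis by (auto simp: J_def Iq_def)
  next
    case False
    then obtain p where p: "p \<in> X" "p \<notin> E" using tree by (auto simp: tree_def)
    have "p \<in> I2 \<or> p \<in> R \<or> act x p \<in> R" using R_iff[OF p] p by (auto simp: I2_def)
    then show ?thesis by (auto simp: J_def)
  qed
  moreover have "finite J"
    using finite_X I2_R by (auto simp: J_def intro: finite_subset)
  moreover have "d j \<in> {0, 2, q}" for j by (simp add: d_def split: sum.split)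
  moreover have "\<exists>g\<in>carrier H. e j = inv\<^bsub>H\<^esub> g \<otimes>\<^bsub>H\<^esub> (x \<otimes>\<^bsub>H\<^esub> g)" if j: "j \<in> J" "d j = 2" for j
  proof -
    obtain p where p: "j = Inr p" "p \<in> I2"
      using j \<open>q \<noteq> 2\<close> I2_R by (cases j) (auto simp: J_def d_def I2_def split: if_splits)
    then have "p \<in> X" using I2_R by blast
    then show ?thesis using p t by (auto simp: e_def s_I2)
  qed
  moreover have "\<exists>g\<in>carrier H. e j = inv\<^bsub>H\<^esub> g \<otimes>\<^bsub>H\<^esub> (y \<otimes>\<^bsub>H\<^esub> g)" if j: "j \<in> J" "d j = q" for j
  proof -
    obtain p where p: "j = Inl p" "p \<in> Iq"
      using j \<open>q \<noteq> 2\<close> q_pos by (cases j) (auto simp: J_def d_def split: if_splits)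
    then have "p \<in> X" using I2_R by blast
    then show ?thesis using p t by (auto simp: e_def r_Iq)
  qed
  ultimately show ?thesis using that[of J d e \<phi>] \<phi> e_stab by blast
qed

end

text \<open>The right cosets carry the left action of \<open>w\<close> by right multiplication with the inverse of \<open>w\<close>.\<close>

lemma coset_action:
  assumes "prime q" "D \<in> subgroups_of_index (Hecke q) k" "k \<ge> 1"
  shows "transitive_action q (rcosets\<^bsub>Hecke q\<^esub> D) (\<lambda>w p. p #>\<^bsub>Hecke q\<^esub> inv\<^bsub>Hecke q\<^esub> w) D"
    and "transitive_action.stab q (\<lambda>w p. p #>\<^bsub>Hecke q\<^esub> inv\<^bsub>Hecke q\<^esub> w) D = D"
proof -
  let ?H = "Hecke q"
  have D: "subgroup D ?H" and card: "card (rcosets\<^bsub>?H\<^esub> D) = k"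
    using assms(2) by (auto simp: subgroups_of_index_def)
  have sub: "p \<subseteq> carrier ?H" if "p \<in> rcosets\<^bsub>?H\<^esub> D" for p
    using that D hecke.P.rcosets_part_G by blast
  have coset: "\<exists>a\<in>carrier ?H. p = D #>\<^bsub>?H\<^esub> a" if "p \<in> rcosets\<^bsub>?H\<^esub> D" for p
    using that by (auto simp: RCOSETS_def)
  have D_sub: "D \<subseteq> carrier ?H" using D by (rule subgroup.subset)
  have coset_mem: "D #>\<^bsub>?H\<^esub> a \<in> rcosets\<^bsub>?H\<^esub> D" if "a \<in> carrier ?H" for a
    using that D_sub hecke.P.rcosetsI by blast
  show action: "transitive_action q (rcosets\<^bsub>?H\<^esub> D) (\<lambda>w p. p #>\<^bsub>?H\<^esub> inv\<^bsub>?H\<^esub> w) D"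
  proof
    show "finite (rcosets\<^bsub>?H\<^esub> D)" using card \<open>k \<ge> 1\<close> by (metis card.infinite not_one_le_zero)
    show "D \<in> rcosets\<^bsub>?H\<^esub> D" using D by (rule subgroup.subgroup_in_rcosets) (rule hecke.group_P)
    fix p assume p: "p \<in> rcosets\<^bsub>?H\<^esub> D"
    show "p #>\<^bsub>?H\<^esub> inv\<^bsub>?H\<^esub> \<one>\<^bsub>?H\<^esub> = p" using sub[OF p] by (simp add: hecke.P.coset_mult_one)
    obtain a where a: "a \<in> carrier ?H" "p = D #>\<^bsub>?H\<^esub> a" using coset[OF p] by blast
    show "\<exists>w\<in>carrier ?H. D #>\<^bsub>?H\<^esub> inv\<^bsub>?H\<^esub> w = p"
      using a by (intro bexI[of _ "inv\<^bsub>?H\<^esub> a"]) auto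
    fix w assume w: "w \<in> carrier ?H"
    show "p #>\<^bsub>?H\<^esub> inv\<^bsub>?H\<^esub> w \<in> rcosets\<^bsub>?H\<^esub> D"
      using a w D_sub by (simp add: hecke.P.coset_mult_assoc coset_mem)
    fix v assume v: "v \<in> carrier ?H"
    show "p #>\<^bsub>?H\<^esub> inv\<^bsub>?H\<^esub> (v \<otimes>\<^bsub>?H\<^esub> w) = p #>\<^bsub>?H\<^esub> inv\<^bsub>?H\<^esub> w #>\<^bsub>?H\<^esub> inv\<^bsub>?H\<^esub> v"
      using sub[OF p] v w by (simp add: hecke.P.coset_mult_assoc hecke.P.inv_mult_group)
  qed (rule assms)
  interpret transitive_action q "rcosets\<^bsub>?H\<^esub> D" "\<lambda>w p. p #>\<^bsub>?H\<^esub> inv\<^bsub>?H\<^esub> w" D by (rule action)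
  have "D #>\<^bsub>?H\<^esub> inv\<^bsub>?H\<^esub> w = D \<longleftrightarrow> w \<in> D" if "w \<in> carrier ?H" for w
    using that hecke.P.coset_join1[OF _ _ D, of "inv\<^bsub>?H\<^esub> w"] hecke.P.coset_join2[OF _ D, of "inv\<^bsub>?H\<^esub> w"]
      subgroup.m_inv_closed[OF D] D_sub by (metis hecke.P.inv_closed hecke.P.inv_inv)
  then show "stab = D" using D_sub by (auto simp: stab_def)
qed

text \<open>A subgroup of index \<open>k\<close> is determined by the action of the two generators on its cosets, when these
  are numbered in any way, and by the number of the trivial coset.\<close>

lemma finite_subgroups_of_index:
  assumes "prime q" "k \<ge> 1"
  shows "finite (subgroups_of_index (Hecke q) k)"
proof -
  let ?H = "Hecke q"
  have "q > 0" using assms(1) by (rule prime_gt_0_nat)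
  define act where "act = (\<lambda>w p. p #>\<^bsub>?H\<^esub> inv\<^bsub>?H\<^esub> w)"
  define code where "code = (\<lambda>D (f, g, i0). \<exists>\<beta>. bij_betw \<beta> (rcosets\<^bsub>?H\<^esub> D) {..<k} \<and> \<beta> D = i0 \<and>
    (\<forall>p\<in>rcosets\<^bsub>?H\<^esub> D. f (\<beta> p) = \<beta> (act (hx q) p) \<and> g (\<beta> p) = \<beta> (act (hy q) p)))"
  let ?T = "({..<k} \<rightarrow>\<^sub>E {..<k}) \<times> ({..<k} \<rightarrow>\<^sub>E {..<k}) \<times> {..<k}"
  have ex: "\<exists>c\<in>?T. code D c" if D: "D \<in> subgroups_of_index ?H k" for D
  proof -
    interpret transitive_action q "rcosets\<^bsub>?H\<^esub> D" act D
      unfolding act_def by (rule coset_action(1)[OF assms(1) D assms(2)])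
    obtain \<beta> where \<beta>: "bij_betw \<beta> (rcosets\<^bsub>?H\<^esub> D) {..<k}"
      using ex_bij_betw_finite_nat[OF finite_X] D by (auto simp: subgroups_of_index_def atLeast0LessThan)
    define \<gamma> where "\<gamma> = inv_into (rcosets\<^bsub>?H\<^esub> D) \<beta>"
    have \<gamma>: "\<gamma> i \<in> rcosets\<^bsub>?H\<^esub> D" if "i < k" for i
      using \<beta> that by (auto simp: \<gamma>_def bij_betw_def intro: inv_into_into)
    have \<gamma>\<beta>: "\<gamma> (\<beta> p) = p" if "p \<in> rcosets\<^bsub>?H\<^esub> D" for p
      using \<beta> that by (simp add: \<gamma>_def bij_betw_def)
    have \<beta>_less: "\<beta> p < k" if "p \<in> rcosets\<^bsub>?H\<^esub> D" for p
      using \<beta> that by (auto simp: bij_betw_def)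
    let ?f = "\<lambda>w. \<lambda>i\<in>{..<k}. \<beta> (act w (\<gamma> i))"
    have "code D (?f (hx q), ?f (hy q), \<beta> D)"
      using \<beta> by (auto simp: code_def \<gamma>\<beta> \<beta>_less intro!: exI[of _ \<beta>])
    moreover have "(?f (hx q), ?f (hy q), \<beta> D) \<in> ?T"
      using \<gamma> \<beta>_less act_closed p0 by auto
    ultimately show ?thesis by blast
  qed
  have unique: "D \<subseteq> D'"
    if D: "D \<in> subgroups_of_index ?H k" "D' \<in> subgroups_of_index ?H k" and c: "code D c" "code D' c" for D D' c
  proof -
    interpret D: transitive_action q "rcosets\<^bsub>?H\<^esub> D" act D
      unfolding act_def by (rule coset_action(1)[OF assms(1) D(1) assms(2)])
    interpret D': transitive_action q "rcosets\<^bsub>?H\<^esub> D'" act D'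
      unfolding act_def by (rule coset_action(1)[OF assms(1) D(2) assms(2)])
    have stab: "D.stab = D" "D'.stab = D'"
      unfolding act_def using coset_action(2)[OF assms(1) D(1) assms(2)] coset_action(2)[OF assms(1) D(2) assms(2)]
      by auto
    obtain f g i0 where "c = (f, g, i0)" by (cases c)
    then obtain \<beta> \<beta>' where \<beta>: "bij_betw \<beta> (rcosets\<^bsub>?H\<^esub> D) {..<k}" "\<beta> D = i0"
        "\<And>p. p \<in> rcosets\<^bsub>?H\<^esub> D \<Longrightarrow> f (\<beta> p) = \<beta> (act (hx q) p) \<and> g (\<beta> p) = \<beta> (act (hy q) p)"
      and \<beta>': "bij_betw \<beta>' (rcosets\<^bsub>?H\<^esub> D') {..<k}" "\<beta>' D' = i0"
        "\<And>p. p \<in> rcosets\<^bsub>?H\<^esub> D' \<Longrightarrow> f (\<beta>' p) = \<beta>' (act (hx q) p) \<and> g (\<beta>' p) = \<beta>' (act (hy q) p)"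
      using c by (auto simp: code_def)
    have *: "\<beta> (act w D) = \<beta>' (act w D')" if "w \<in> carrier ?H" for w
      using \<open>q > 0\<close> that
    proof (induction rule: hecke_induct)
      case one
      then show ?case using \<beta>(2) \<beta>'(2) D.p0 D'.p0 by (simp add: D.act_one D'.act_one)
    next
      case (x w)
      then show ?case
        using \<beta>(3)[OF D.act_closed[OF x(1) D.p0]] \<beta>'(3)[OF D'.act_closed[OF x(1) D'.p0]]
        by (simp add: D.act_mult D'.act_mult D.p0 D'.p0)
    next
      case (y w)
      then show ?case
        using \<beta>(3)[OF D.act_closed[OF y(1) D.p0]] \<beta>'(3)[OF D'.act_closed[OF y(1) D'.p0]]
        by (simp add: D.act_mult D'.act_mult D.p0 D'.p0)
    qed
    show "D \<subseteq> D'"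
    proof
      fix w assume "w \<in> D"
      then have w: "w \<in> carrier ?H" "act w D = D" using stab(1) by (auto simp: D.stab_def)
      then have "\<beta>' (act w D') = \<beta>' D'" using *[OF w(1)] \<beta>(2) \<beta>'(2) by simp
      then have "act w D' = D'"
        using \<beta>'(1) D'.act_closed[OF w(1) D'.p0] D'.p0 by (auto simp: bij_betw_def inj_on_def)
      then show "w \<in> D'" using w(1) stab(2) by (auto simp: D'.stab_def)
    qed
  qed
  define sel where "sel = (\<lambda>D. SOME c. c \<in> ?T \<and> code D c)"
  have sel: "sel D \<in> ?T \<and> code D (sel D)" if "D \<in> subgroups_of_index ?H k" for D
    unfolding sel_def by (rule someI_ex) (use ex[OF that] in blast)
  have "inj_on sel (subgroups_of_index ?H k)"
  proof (rule inj_onI)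
    fix D D' assume D: "D \<in> subgroups_of_index ?H k" "D' \<in> subgroups_of_index ?H k" "sel D = sel D'"
    have "code D (sel D)" "code D' (sel D)"
      using conjunct2[OF sel[OF D(1)]] conjunct2[OF sel[OF D(2)]] unfolding D(3) by simp_all
    then show "D = D'" using unique[OF D(1,2)] unique[OF D(2,1)] by blast
  qed
  moreover have "finite (sel ` subgroups_of_index ?H k)"
  proof (rule finite_subset)
    show "sel ` subgroups_of_index ?H k \<subseteq> ?T"
      by (rule image_subsetI) (rule conjunct1[OF sel])
    show "finite ?T" by (intro finite_cartesian_product finite_PiE) auto
  qed
  ultimately show ?thesis by (rule finite_imageD[rotated])
qed

section \<open>The central extension\<close>

interpretation gamma: presentation UNIV "Gamma_rels m q"
  rewrites "presented_group UNIV (Gamma_rels m q) = Gamma m q"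
  for m q
proof -
  show "presentation UNIV (Gamma_rels m q)" by unfold_locales (auto simp: Gamma_rels_def)
qed (simp add: Gamma_def)

text \<open>The group \<open>Gamma m q\<close>, with generators \<open>X\<close>, \<open>Y\<close> and central element \<open>z = X\<^sup>2\<close>.\<close>

locale central_extension =
  fixes m q :: nat
  assumes m: "m \<ge> 1" and q: "prime q" "odd q"
begin

abbreviation G where "G \<equiv> Gamma m q"
abbreviation H where "H \<equiv> Hecke q"
abbreviation X where "X \<equiv> gamma.gen m q Gen_x"
abbreviation Y where "Y \<equiv> gamma.gen m q Gen_y"
abbreviation z where "z \<equiv> zeta m q"

lemma X_pow: "X [^]\<^bsub>G\<^esub> (2::nat) = z"
  using gamma.cls_gen_pow[of Gen_x m q 2] by (simp add: zeta_def)

lemma Y_pow: "Y [^]\<^bsub>G\<^esub> q = z"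
  using gamma.cls_gen_pow[of Gen_y m q q] gamma.cls_rel[of "gen_pow Gen_x 2" "gen_pow Gen_y q" m q]
  by (simp add: zeta_def Gamma_rels_def)

lemma z_closed [simp]: "z \<in> carrier G"
  by (simp add: zeta_def)

lemma z_pow: "z [^]\<^bsub>G\<^esub> m = \<one>\<^bsub>G\<^esub>"
proof -
  have "X [^]\<^bsub>G\<^esub> (2 * m) = \<one>\<^bsub>G\<^esub>"
    using gamma.cls_gen_pow[of Gen_x m q "2 * m"] gamma.cls_rel[of "gen_pow Gen_x (2 * m)" "[]" m q]
    by (simp add: Gamma_rels_def gamma.one_P)
  then show ?thesis by (simp add: X_pow[symmetric] gamma.P.nat_pow_pow)
qed

lemma ex_gamma_hom:
  assumes "group K" "a \<in> carrier K" "b \<in> carrier K"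
    and "a [^]\<^bsub>K\<^esub> (2 * m) = \<one>\<^bsub>K\<^esub>" "b [^]\<^bsub>K\<^esub> (q * m) = \<one>\<^bsub>K\<^esub>" "a [^]\<^bsub>K\<^esub> (2::nat) = b [^]\<^bsub>K\<^esub> q"
  obtains \<phi> where "\<phi> \<in> hom G K" "\<phi> X = a" "\<phi> Y = b"
proof -
  interpret K: group K by fact
  let ?f = "case_gen a b"
  have f: "?f c \<in> carrier K" for c using assms by (cases c) auto
  have "eval_word K ?f u = eval_word K ?f v" if "(u, v) \<in> Gamma_rels m q" for u v
    using that assms f by (auto simp: Gamma_rels_def K.eval_word_gen_pow K.eval_word_simps)
  then obtain \<phi> where "\<phi> \<in> hom G K" "\<And>c. \<phi> (gamma.gen m q c) = ?f c"
    using gamma.ex_hom[where f = ?f and m = m and q = q, OF \<open>group K\<close> f] by (metis UNIV_I)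
  then show ?thesis using that[of \<phi>] by simp
qed

text \<open>The order of \<open>z\<close> is detected in the cyclic group of order \<open>2 q m\<close>, with \<open>X\<close>, \<open>Y\<close> sent to
  \<open>q\<close>, \<open>2\<close>.\<close>

lemma z_pow_eq_one_iff: "z [^]\<^bsub>G\<^esub> (i::nat) = \<one>\<^bsub>G\<^esub> \<longleftrightarrow> m dvd i"
proof
  assume i: "z [^]\<^bsub>G\<^esub> i = \<one>\<^bsub>G\<^esub>"
  define N where "N = 2 * q * m"
  let ?Z = "integer_mod_group N"
  have q2: "q \<ge> 2" using q(1) by (rule prime_ge_2_nat)
  have "2 * q * 1 \<le> N" unfolding N_def using m by (intro mult_le_mono2) simp
  then have N: "N > q" "N > 2" using q2 by auto
  have mults: "int (2 * m) * int q = int N" "int (q * m) * 2 = int N" by (simp_all add: N_def)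
  obtain \<phi> where \<phi>: "\<phi> \<in> hom G ?Z" "\<phi> X = int q" "\<phi> Y = 2"
  proof (rule ex_gamma_hom[of ?Z "int q" 2])
    show "int q [^]\<^bsub>?Z\<^esub> (2 * m) = \<one>\<^bsub>?Z\<^esub>" "2 [^]\<^bsub>?Z\<^esub> (q * m) = \<one>\<^bsub>?Z\<^esub>"
      unfolding pow_integer_mod_group mults by simp_all
  qed (use N in \<open>auto simp: carrier_integer_mod_group mult_ac\<close>)
  interpret group_hom G ?Z \<phi> using \<phi>(1) by (intro group_homI) auto
  have "\<phi> (z [^]\<^bsub>G\<^esub> i) = (int i * (2 * int q)) mod int N"
    using \<phi>(2) by (simp add: hom_nat_pow X_pow[symmetric] mod_mult_right_eq)
  then have "int N dvd int i * (2 * int q)" using i by (simp add: dvd_eq_mod_eq_0)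
  then have "int (m * (2 * q)) dvd int (i * (2 * q))" by (simp add: N_def mult_ac)
  then have "m * (2 * q) dvd i * (2 * q)" by (simp only: int_dvd_int_iff)
  then show "m dvd i" using q2 by simp
next
  assume "m dvd i"
  then show "z [^]\<^bsub>G\<^esub> i = \<one>\<^bsub>G\<^esub>"
    using z_pow by (metis dvdE gamma.P.nat_pow_one gamma.P.nat_pow_pow z_closed)
qed

lemma z_pow_inj:
  assumes "z [^]\<^bsub>G\<^esub> i = z [^]\<^bsub>G\<^esub> j" "i < m" "j < m"
  shows "i = (j::nat)"
proof -
  have *: "i = j" if "z [^]\<^bsub>G\<^esub> i = z [^]\<^bsub>G\<^esub> j" "i \<le> j" "j < m" for i j :: nat
  proof -
    have "z [^]\<^bsub>G\<^esub> i \<otimes>\<^bsub>G\<^esub> z [^]\<^bsub>G\<^esub> (j - i) = z [^]\<^bsub>G\<^esub> i"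
      using that gamma.P.nat_pow_mult[of z m q i "j - i"] by simp
    then have "m dvd j - i" by (simp add: z_pow_eq_one_iff[symmetric])
    then show ?thesis using that by (auto dest: dvd_imp_le)
  qed
  show ?thesis using *[of i j] *[of j i] assms by (metis linear)
qed

lemma z_central:
  assumes "g \<in> carrier G"
  shows "z \<otimes>\<^bsub>G\<^esub> g = g \<otimes>\<^bsub>G\<^esub> z"
proof -
  let ?C = "{g \<in> carrier G. z \<otimes>\<^bsub>G\<^esub> g = g \<otimes>\<^bsub>G\<^esub> z}"
  have "subgroup ?C G"
  proof (rule gamma.P.subgroupI)
    show "inv\<^bsub>G\<^esub> g \<in> ?C" if "g \<in> ?C" for g
    proof -
      have g: "g \<in> carrier G" "z \<otimes>\<^bsub>G\<^esub> g = g \<otimes>\<^bsub>G\<^esub> z" using that by auto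
      have "z \<otimes>\<^bsub>G\<^esub> inv\<^bsub>G\<^esub> g = inv\<^bsub>G\<^esub> g \<otimes>\<^bsub>G\<^esub> (g \<otimes>\<^bsub>G\<^esub> z) \<otimes>\<^bsub>G\<^esub> inv\<^bsub>G\<^esub> g"
        using g(1) by (simp add: gamma.P.m_assoc[symmetric])
      also have "\<dots> = inv\<^bsub>G\<^esub> g \<otimes>\<^bsub>G\<^esub> z"
        using g(1) by (simp add: g(2)[symmetric] gamma.P.m_assoc)
      finally show ?thesis using g(1) by simp
    qed
    show "a \<otimes>\<^bsub>G\<^esub> b \<in> ?C" if "a \<in> ?C" "b \<in> ?C" for a b
    proof -
      have ab: "a \<in> carrier G" "b \<in> carrier G" "z \<otimes>\<^bsub>G\<^esub> a = a \<otimes>\<^bsub>G\<^esub> z" "z \<otimes>\<^bsub>G\<^esub> b = b \<otimes>\<^bsub>G\<^esub> z"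
        using that by auto
      then have "z \<otimes>\<^bsub>G\<^esub> (a \<otimes>\<^bsub>G\<^esub> b) = a \<otimes>\<^bsub>G\<^esub> (z \<otimes>\<^bsub>G\<^esub> b)"
        by (metis gamma.P.m_assoc z_closed)
      then show ?thesis using ab by (simp add: gamma.P.m_assoc)
    qed
    show "?C \<noteq> {}" using gamma.P.one_closed by fastforce
  qed auto
  moreover have "gamma.gen m q c \<in> ?C" for c
  proof (cases c)
    case Gen_x
    then show ?thesis
      using gamma.P.nat_pow_Suc2[of X m q 2] gamma.P.nat_pow_Suc[of m q X 2] by (simp add: X_pow)
  next
    case Gen_y
    then show ?thesis
      using gamma.P.nat_pow_Suc2[of Y m q q] gamma.P.nat_pow_Suc[of m q Y q] by (simp add: Y_pow)
  qed
  ultimately have "generate G (gamma.gen m q ` UNIV) \<subseteq> ?C"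
    by (intro gamma.P.generate_subgroup_incl) auto
  then show ?thesis using assms by (auto simp: gamma.generate_gen)
qed

lemma z_pow_central:
  "g \<in> carrier G \<Longrightarrow> z [^]\<^bsub>G\<^esub> (i::nat) \<otimes>\<^bsub>G\<^esub> g = g \<otimes>\<^bsub>G\<^esub> z [^]\<^bsub>G\<^esub> i"
  using gamma.P.nat_pow_mult
proof (induction i)
  case (Suc i)
  then show ?case by (simp add: gamma.P.m_assoc z_central) (simp add: gamma.P.m_assoc[symmetric])
qed simp

text \<open>The central subgroup generated by \<open>z\<close>; as \<open>z\<close> has finite order, no inverses are needed.\<close>

definition Z :: "gen word set set" where
  "Z = range (\<lambda>i::nat. z [^]\<^bsub>G\<^esub> i)"

lemma subgroup_Z: "subgroup Z G"
proof (rule gamma.P.subgroupI)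
  show "inv\<^bsub>G\<^esub> a \<in> Z" if "a \<in> Z" for a
  proof -
    obtain i :: nat where i: "a = z [^]\<^bsub>G\<^esub> i" using \<open>a \<in> Z\<close> by (auto simp: Z_def)
    have "z [^]\<^bsub>G\<^esub> (m * i - i) \<otimes>\<^bsub>G\<^esub> a = z [^]\<^bsub>G\<^esub> (m * i)"
      using m by (simp add: i gamma.P.nat_pow_mult)
    also have "\<dots> = \<one>\<^bsub>G\<^esub>" by (simp add: z_pow_eq_one_iff)
    finally have "inv\<^bsub>G\<^esub> a = z [^]\<^bsub>G\<^esub> (m * i - i)"
      by (intro gamma.P.inv_equality) (simp_all add: i)
    then show ?thesis by (simp add: Z_def)
  qed
qed (auto simp: Z_def gamma.P.nat_pow_mult)

lemma generate_z: "generate G {z} = Z"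
proof
  have "z \<in> Z" unfolding Z_def by (rule range_eqI[of _ _ 1]) simp
  then show "generate G {z} \<subseteq> Z"
    using gamma.P.generate_subgroup_incl[OF _ subgroup_Z] by simp
  have "z [^]\<^bsub>G\<^esub> (i::nat) \<in> generate G {z}" for i
    by (induction i) (auto intro: generate.intros)
  then show "Z \<subseteq> generate G {z}" by (auto simp: Z_def)
qed

lemma Z_eq: "Z = (\<lambda>i. z [^]\<^bsub>G\<^esub> i) ` {..<m}"
proof -
  have "z [^]\<^bsub>G\<^esub> i \<in> (\<lambda>i. z [^]\<^bsub>G\<^esub> i) ` {..<m}" for i :: nat
    using gamma.P.pow_mod_exponent[OF z_closed z_pow, of i] m by (intro image_eqI[of _ _ "i mod m"]) auto
  then show ?thesis by (auto simp: Z_def)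
qed

text \<open>The projection onto \<open>Hecke q\<close>, with kernel \<open>Z\<close>.\<close>

definition \<pi> :: "gen word set \<Rightarrow> gen word set" where
  "\<pi> = (SOME \<phi>. \<phi> \<in> hom G H \<and> \<phi> X = hx q \<and> \<phi> Y = hy q)"

lemma \<pi>: "\<pi> \<in> hom G H" "\<pi> X = hx q" "\<pi> Y = hy q"
proof -
  have "hx q [^]\<^bsub>H\<^esub> (2 * m) = \<one>\<^bsub>H\<^esub>" "hy q [^]\<^bsub>H\<^esub> (q * m) = \<one>\<^bsub>H\<^esub>"
    using hx_pow[of q] hy_pow[of q] by (simp_all flip: hecke.P.nat_pow_pow)
  then have "\<exists>\<phi>. \<phi> \<in> hom G H \<and> \<phi> X = hx q \<and> \<phi> Y = hy q"
    using ex_gamma_hom[of H "hx q" "hy q"] hecke.group_P[of q] hx_pow[of q] hy_pow[of q] hecke.gen_closed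
    by (metis UNIV_I)
  then have "\<pi> \<in> hom G H \<and> \<pi> X = hx q \<and> \<pi> Y = hy q" unfolding \<pi>_def by (rule someI_ex)
  then show "\<pi> \<in> hom G H" "\<pi> X = hx q" "\<pi> Y = hy q" by auto
qed

sublocale \<pi>: group_hom G H \<pi>
  by (intro group_homI \<pi> gamma.group_P hecke.group_P)

lemma \<pi>_z: "\<pi> (z [^]\<^bsub>G\<^esub> (i::nat)) = \<one>\<^bsub>H\<^esub>"
  by (simp add: \<pi>.hom_nat_pow X_pow[symmetric] \<pi> hx_pow)

lemma \<pi>_surj: "\<pi> ` carrier G = carrier H"
proof
  have "q > 0" using q(1) by (rule prime_gt_0_nat)
  have "w \<in> \<pi> ` carrier G" if "w \<in> carrier H" for w
    using \<open>q > 0\<close> that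
  proof (induction rule: hecke_induct)
    case one
    then show ?case by (intro image_eqI[of _ _ "\<one>\<^bsub>G\<^esub>"]) auto
  next
    case (x w)
    then obtain g where "g \<in> carrier G" "w = \<pi> g" by blast
    then show ?case by (intro image_eqI[of _ _ "X \<otimes>\<^bsub>G\<^esub> g"]) (auto simp: \<pi>)
  next
    case (y w)
    then obtain g where "g \<in> carrier G" "w = \<pi> g" by blast
    then show ?case by (intro image_eqI[of _ _ "Y \<otimes>\<^bsub>G\<^esub> g"]) (auto simp: \<pi>)
  qed
  then show "carrier H \<subseteq> \<pi> ` carrier G" by blast
qed auto

text \<open>The quotient by \<open>Z\<close> satisfies the relations of \<open>Hecke q\<close>; hence the kernel is no larger.\<close>

lemma kernel_\<pi>:
  assumes g: "g \<in> carrier G" "\<pi> g = \<one>\<^bsub>H\<^esub>"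
  shows "g \<in> Z"
proof -
  have "Z \<lhd> G"
    unfolding gamma.P.normal_inv_iff
  proof (intro conjI ballI subgroup_Z)
    fix a h assume a: "a \<in> carrier G" "h \<in> Z"
    then obtain i :: nat where "h = z [^]\<^bsub>G\<^esub> i" by (auto simp: Z_def)
    then have "a \<otimes>\<^bsub>G\<^esub> h \<otimes>\<^bsub>G\<^esub> inv\<^bsub>G\<^esub> a = h"
      using a(1) z_pow_central[OF a(1), of i] by (simp add: gamma.P.m_assoc flip: z_pow_central)
    then show "a \<otimes>\<^bsub>G\<^esub> h \<otimes>\<^bsub>G\<^esub> inv\<^bsub>G\<^esub> a \<in> Z" using a by simp
  qed
  then interpret Z: normal Z G .
  let ?Q = "G Mod Z"
  have grp: "group ?Q" by (rule Z.factorgroup_is_group)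
  have can: "(#>\<^bsub>G\<^esub>) Z \<in> hom G ?Q" by (rule Z.r_coset_hom_Mod)
  interpret can: group_hom G ?Q "(#>\<^bsub>G\<^esub>) Z" by (intro group_homI gamma.group_P grp can)
  have one: "\<one>\<^bsub>?Q\<^esub> = Z" by (simp add: FactGroup_def)
  have "z \<in> Z" unfolding Z_def by (rule range_eqI[of _ _ 1]) simp
  then have zz: "Z #>\<^bsub>G\<^esub> z = \<one>\<^bsub>?Q\<^esub>" using gamma.P.coset_join2[OF z_closed subgroup_Z] one by simp
  obtain \<rho> where \<rho>: "\<rho> \<in> hom H ?Q" "\<rho> (hx q) = Z #>\<^bsub>G\<^esub> X" "\<rho> (hy q) = Z #>\<^bsub>G\<^esub> Y"
  proof (rule ex_hecke_hom[OF grp, of "Z #>\<^bsub>G\<^esub> X" "Z #>\<^bsub>G\<^esub> Y" q])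
    show "(Z #>\<^bsub>G\<^esub> X) [^]\<^bsub>?Q\<^esub> (2::nat) = \<one>\<^bsub>?Q\<^esub>"
      using can.hom_nat_pow[of X 2] zz by (simp add: X_pow)
    show "(Z #>\<^bsub>G\<^esub> Y) [^]\<^bsub>?Q\<^esub> q = \<one>\<^bsub>?Q\<^esub>"
      using can.hom_nat_pow[of Y q] zz by (simp add: Y_pow)
  qed (use can.hom_closed in auto)
  have "(\<rho> \<circ> \<pi>) g = Z #>\<^bsub>G\<^esub> g"
  proof (rule gamma.hom_eqI[OF grp _ can _ g(1)])
    show "\<rho> \<circ> \<pi> \<in> hom G ?Q" by (rule Group.hom_compose[OF \<pi>(1) \<rho>(1)])
    show "(\<rho> \<circ> \<pi>) (gamma.gen m q c) = Z #>\<^bsub>G\<^esub> gamma.gen m q c" for c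
      by (cases c) (simp_all add: \<pi> \<rho>)
  qed
  moreover have "\<rho> \<one>\<^bsub>H\<^esub> = \<one>\<^bsub>?Q\<^esub>" by (rule Group.hom_one[OF \<rho>(1) hecke.group_P grp])
  ultimately have "Z #>\<^bsub>G\<^esub> g = Z" using g(2) one by simp
  then show ?thesis using gamma.P.coset_join1[OF _ g(1) subgroup_Z] by simp
qed

lemma \<pi>_eq_iff:
  assumes "g \<in> carrier G" "h \<in> carrier G"
  shows "\<pi> g = \<pi> h \<longleftrightarrow> (\<exists>i<m. g = z [^]\<^bsub>G\<^esub> i \<otimes>\<^bsub>G\<^esub> h)"
proof
  assume "\<pi> g = \<pi> h"
  then have "\<pi> (g \<otimes>\<^bsub>G\<^esub> inv\<^bsub>G\<^esub> h) = \<one>\<^bsub>H\<^esub>" using assms by simp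
  then obtain i where i: "i < m" "g \<otimes>\<^bsub>G\<^esub> inv\<^bsub>G\<^esub> h = z [^]\<^bsub>G\<^esub> i"
    using kernel_\<pi>[of "g \<otimes>\<^bsub>G\<^esub> inv\<^bsub>G\<^esub> h"] assms by (auto simp: Z_eq)
  have "z [^]\<^bsub>G\<^esub> i \<otimes>\<^bsub>G\<^esub> h = g" using assms by (simp add: i(2)[symmetric] gamma.P.m_assoc)
  then show "\<exists>i<m. g = z [^]\<^bsub>G\<^esub> i \<otimes>\<^bsub>G\<^esub> h" using i(1) by auto
qed (use assms in \<open>auto simp: \<pi>_z\<close>)

end

section \<open>Complements of the central subgroup\<close>

context central_extension
begin

lemma \<pi>_inj_on:
  assumes \<Delta>: "subgroup \<Delta> G" "\<Delta> \<inter> Z = {\<one>\<^bsub>G\<^esub>}"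
  shows "inj_on \<pi> \<Delta>"
proof (rule inj_onI)
  fix a b assume ab: "a \<in> \<Delta>" "b \<in> \<Delta>" "\<pi> a = \<pi> b"
  have c: "a \<in> carrier G" "b \<in> carrier G" using ab subgroup.subset[OF \<Delta>(1)] by auto
  have "a \<otimes>\<^bsub>G\<^esub> inv\<^bsub>G\<^esub> b \<in> \<Delta>"
    using ab \<Delta>(1) by (simp add: subgroup.m_closed subgroup.m_inv_closed)
  moreover have "a \<otimes>\<^bsub>G\<^esub> inv\<^bsub>G\<^esub> b \<in> Z" using c ab by (intro kernel_\<pi>) auto
  ultimately have "a \<otimes>\<^bsub>G\<^esub> inv\<^bsub>G\<^esub> b = \<one>\<^bsub>G\<^esub>" using \<Delta>(2) by blast
  then show "a = b" using c by (metis gamma.P.inv_equality gamma.P.inv_inv gamma.P.inv_closed)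
qed

text \<open>The cosets of a complement are parametrized by a power of \<open>z\<close> and a coset of the image; \<open>\<sigma>\<close>
  chooses representatives for the latter.\<close>

lemma card_rcosets_complement:
  assumes \<Delta>: "subgroup \<Delta> G" "\<Delta> \<inter> Z = {\<one>\<^bsub>G\<^esub>}"
  shows "card (rcosets\<^bsub>G\<^esub> \<Delta>) = m * card (rcosets\<^bsub>H\<^esub> (\<pi> ` \<Delta>))"
proof -
  let ?D = "\<pi> ` \<Delta>"
  have D: "subgroup ?D H" by (rule \<pi>.subgroup_img_is_subgroup[OF \<Delta>(1)])
  have \<Delta>_sub: "\<Delta> \<subseteq> carrier G" by (rule subgroup.subset[OF \<Delta>(1)])
  have image: "\<pi> ` (\<Delta> #>\<^bsub>G\<^esub> g) = ?D #>\<^bsub>H\<^esub> \<pi> g" if "g \<in> carrier G" for g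
    using that \<Delta>_sub by (auto simp: r_coset_def image_iff subset_iff)
  define \<sigma> where "\<sigma> = (\<lambda>C. SOME g. g \<in> carrier G \<and> ?D #>\<^bsub>H\<^esub> \<pi> g = C)"
  have \<sigma>: "\<sigma> C \<in> carrier G \<and> ?D #>\<^bsub>H\<^esub> \<pi> (\<sigma> C) = C" if C: "C \<in> rcosets\<^bsub>H\<^esub> ?D" for C
  proof -
    obtain w where w: "w \<in> carrier H" "C = ?D #>\<^bsub>H\<^esub> w" using C by (auto simp: RCOSETS_def)
    obtain g where "g \<in> carrier G" "w = \<pi> g" using w(1) unfolding \<pi>_surj[symmetric] by blast
    then have "\<exists>g. g \<in> carrier G \<and> ?D #>\<^bsub>H\<^esub> \<pi> g = C" using w(2) by blast
    then show ?thesis unfolding \<sigma>_def by (rule someI_ex)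
  qed
  let ?F = "\<lambda>(i, C). \<Delta> #>\<^bsub>G\<^esub> (z [^]\<^bsub>G\<^esub> (i::nat) \<otimes>\<^bsub>G\<^esub> \<sigma> C)"
  have "bij_betw ?F ({..<m} \<times> (rcosets\<^bsub>H\<^esub> ?D)) (rcosets\<^bsub>G\<^esub> \<Delta>)"
  proof (rule bij_betw_imageI)
    show "inj_on ?F ({..<m} \<times> (rcosets\<^bsub>H\<^esub> ?D))"
    proof (rule inj_onI)
      fix p p' assume p: "p \<in> {..<m} \<times> (rcosets\<^bsub>H\<^esub> ?D)" "p' \<in> {..<m} \<times> (rcosets\<^bsub>H\<^esub> ?D)" "?F p = ?F p'"
      obtain i C i' C' where pp: "p = (i, C)" "p' = (i', C')" by (metis surj_pair)
      have C: "C \<in> rcosets\<^bsub>H\<^esub> ?D" "C' \<in> rcosets\<^bsub>H\<^esub> ?D" and i: "i < m" "i' < m"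
        and eq: "\<Delta> #>\<^bsub>G\<^esub> (z [^]\<^bsub>G\<^esub> i \<otimes>\<^bsub>G\<^esub> \<sigma> C) = \<Delta> #>\<^bsub>G\<^esub> (z [^]\<^bsub>G\<^esub> i' \<otimes>\<^bsub>G\<^esub> \<sigma> C')"
        using p pp by auto
      have "?D #>\<^bsub>H\<^esub> \<pi> (\<sigma> C) = ?D #>\<^bsub>H\<^esub> \<pi> (\<sigma> C')"
        using arg_cong[OF eq, of "(`) \<pi>"] \<sigma> C by (simp add: image \<pi>_z)
      then have CC: "C = C'" using \<sigma> C by simp
      have "z [^]\<^bsub>G\<^esub> i \<otimes>\<^bsub>G\<^esub> \<sigma> C \<in> \<Delta> #>\<^bsub>G\<^esub> (z [^]\<^bsub>G\<^esub> i' \<otimes>\<^bsub>G\<^esub> \<sigma> C)"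
        using gamma.P.rcos_self[OF _ \<Delta>(1), of "z [^]\<^bsub>G\<^esub> i \<otimes>\<^bsub>G\<^esub> \<sigma> C"] \<sigma>[OF C(1)] eq CC by simp
      then obtain \<delta> where \<delta>: "\<delta> \<in> \<Delta>" "z [^]\<^bsub>G\<^esub> i \<otimes>\<^bsub>G\<^esub> \<sigma> C = \<delta> \<otimes>\<^bsub>G\<^esub> (z [^]\<^bsub>G\<^esub> i' \<otimes>\<^bsub>G\<^esub> \<sigma> C)"
        by (auto simp: r_coset_def)
      then have \<delta>G: "\<delta> \<in> carrier G" using \<Delta>_sub by blast
      then have "z [^]\<^bsub>G\<^esub> i \<otimes>\<^bsub>G\<^esub> \<sigma> C = (\<delta> \<otimes>\<^bsub>G\<^esub> z [^]\<^bsub>G\<^esub> i') \<otimes>\<^bsub>G\<^esub> \<sigma> C"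
        using \<delta>(2) \<sigma>[OF C(1)] by (simp add: gamma.P.m_assoc)
      then have zi: "z [^]\<^bsub>G\<^esub> i = \<delta> \<otimes>\<^bsub>G\<^esub> z [^]\<^bsub>G\<^esub> i'"
        using \<sigma>[OF C(1)] \<delta>G by simp
      have "\<pi> \<delta> = \<pi> (\<delta> \<otimes>\<^bsub>G\<^esub> z [^]\<^bsub>G\<^esub> i')" using \<delta>G by (simp add: \<pi>_z)
      also have "\<dots> = \<one>\<^bsub>H\<^esub>" unfolding zi[symmetric] by (rule \<pi>_z)
      finally have "\<pi> \<delta> = \<one>\<^bsub>H\<^esub>" .
      then have "\<delta> = \<one>\<^bsub>G\<^esub>" using kernel_\<pi>[OF \<delta>G] \<delta>(1) \<Delta>(2) by blast
      then show "p = p'" using zi z_pow_inj[of i i'] i CC pp by simp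
    qed
    show "?F ` ({..<m} \<times> (rcosets\<^bsub>H\<^esub> ?D)) = rcosets\<^bsub>G\<^esub> \<Delta>"
    proof (intro equalityI subsetI)
      fix c assume "c \<in> ?F ` ({..<m} \<times> (rcosets\<^bsub>H\<^esub> ?D))"
      then obtain i C where "C \<in> rcosets\<^bsub>H\<^esub> ?D" "c = \<Delta> #>\<^bsub>G\<^esub> (z [^]\<^bsub>G\<^esub> (i::nat) \<otimes>\<^bsub>G\<^esub> \<sigma> C)" by auto
      then show "c \<in> rcosets\<^bsub>G\<^esub> \<Delta>" using \<sigma> \<Delta>_sub by (auto intro!: gamma.P.rcosetsI)
    next
      fix c assume "c \<in> rcosets\<^bsub>G\<^esub> \<Delta>"
      then obtain g where g: "g \<in> carrier G" "c = \<Delta> #>\<^bsub>G\<^esub> g" by (auto simp: RCOSETS_def)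
      define C where "C = ?D #>\<^bsub>H\<^esub> \<pi> g"
      have C: "C \<in> rcosets\<^bsub>H\<^esub> ?D"
        unfolding C_def using g(1) subgroup.subset[OF D] by (intro hecke.P.rcosetsI) auto
      have "\<pi> g \<in> ?D #>\<^bsub>H\<^esub> \<pi> (\<sigma> C)"
        using \<sigma>[OF C] hecke.P.rcos_self[OF _ D, of "\<pi> g"] g(1) by (simp add: C_def)
      then obtain \<delta> where \<delta>: "\<delta> \<in> \<Delta>" "\<pi> g = \<pi> \<delta> \<otimes>\<^bsub>H\<^esub> \<pi> (\<sigma> C)" by (auto simp: r_coset_def)
      then have \<delta>G: "\<delta> \<in> carrier G" using \<Delta>_sub by blast
      then have "\<pi> g = \<pi> (\<delta> \<otimes>\<^bsub>G\<^esub> \<sigma> C)" using \<delta> \<sigma>[OF C] by simp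
      then obtain i where i: "i < m" "g = z [^]\<^bsub>G\<^esub> i \<otimes>\<^bsub>G\<^esub> (\<delta> \<otimes>\<^bsub>G\<^esub> \<sigma> C)"
        using \<pi>_eq_iff[OF g(1), of "\<delta> \<otimes>\<^bsub>G\<^esub> \<sigma> C"] \<delta>G \<sigma>[OF C] by auto
      have "g = (z [^]\<^bsub>G\<^esub> i \<otimes>\<^bsub>G\<^esub> \<delta>) \<otimes>\<^bsub>G\<^esub> \<sigma> C"
        using \<delta>G \<sigma>[OF C] by (simp add: i(2) gamma.P.m_assoc)
      then have "g = \<delta> \<otimes>\<^bsub>G\<^esub> (z [^]\<^bsub>G\<^esub> i \<otimes>\<^bsub>G\<^esub> \<sigma> C)"
        using \<delta>G \<sigma>[OF C] by (simp add: z_pow_central gamma.P.m_assoc)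
      then have "g \<in> \<Delta> #>\<^bsub>G\<^esub> (z [^]\<^bsub>G\<^esub> i \<otimes>\<^bsub>G\<^esub> \<sigma> C)"
        using \<delta>(1) by (auto simp: r_coset_def)
      then have "c = \<Delta> #>\<^bsub>G\<^esub> (z [^]\<^bsub>G\<^esub> i \<otimes>\<^bsub>G\<^esub> \<sigma> C)"
        using gamma.P.repr_independence[OF _ _ \<Delta>(1)] \<sigma>[OF C] by (simp add: g(2))
      then show "c \<in> ?F ` ({..<m} \<times> (rcosets\<^bsub>H\<^esub> ?D))"
        using i(1) C by (intro image_eqI[of _ _ "(i, C)"]) auto
    qed
  qed
  from bij_betw_same_card[OF this] show ?thesis by (simp add: card_cartesian_product)
qed

text \<open>The lifts of a subgroup \<open>D\<close> of \<open>Hecke q\<close>: the complements of \<open>Z\<close> in the preimage of \<open>D\<close>.\<close>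

definition lifts :: "gen word set set \<Rightarrow> gen word set set set" where
  "lifts D = {\<Delta>. subgroup \<Delta> G \<and> \<Delta> \<inter> Z = {\<one>\<^bsub>G\<^esub>} \<and> \<pi> ` \<Delta> = D}"

text \<open>A lift of \<open>D\<close> is the image of a section over \<open>D\<close>, and a section is determined by the values on a
  free basis of \<open>D\<close>, which are constrained only by the orders of the basis elements.\<close>

lemma bij_betw_lifts:
  assumes D: "subgroup D H" and \<phi>: "\<phi> \<in> iso (cyc J d) (subgrp H D)"
    and e: "\<And>j. j \<in> J \<Longrightarrow> \<phi> (cyc.gen J d j) = e j"
  defines "A \<equiv> \<lambda>j. {g \<in> carrier G. \<pi> g = e j \<and> g [^]\<^bsub>G\<^esub> d j = \<one>\<^bsub>G\<^esub>}"
  shows "bij_betw (\<lambda>s. s ` carrier (cyc J d))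
    {s \<in> hom (cyc J d) G \<inter> extensional (carrier (cyc J d)). \<forall>j\<in>J. s (cyc.gen J d j) \<in> A j} (lifts D)"
proof (rule bij_betw_imageI)
  let ?C = "cyc J d"
  let ?S = "{s \<in> hom ?C G \<inter> extensional (carrier ?C). \<forall>j\<in>J. s (cyc.gen J d j) \<in> A j}"
  have \<phi>H: "\<phi> \<in> hom ?C H" and \<phi>_bij: "bij_betw \<phi> (carrier ?C) D"
    using \<phi> subgroup.subset[OF D] by (auto simp: iso_def hom_def)
  interpret \<phi>: group_hom ?C H \<phi> by (intro group_homI \<phi>H cyc.group_P hecke.group_P)
  have over: "\<pi> (s w) = \<phi> w" if s: "s \<in> ?S" and w: "w \<in> carrier ?C" for s w
  proof -
    have "(\<pi> \<circ> s) w = \<phi> w"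
    proof (rule cyc.hom_eqI[OF hecke.group_P _ \<phi>H _ w])
      show "\<pi> \<circ> s \<in> hom ?C H" using s by (intro Group.hom_compose[OF _ \<pi>(1)]) auto
      show "(\<pi> \<circ> s) (cyc.gen J d j) = \<phi> (cyc.gen J d j)" if "j \<in> J" for j
        using s that e by (auto simp: A_def)
    qed
    then show ?thesis by simp
  qed
  have lift: "s ` carrier ?C \<in> lifts D" if s: "s \<in> ?S" for s
  proof -
    interpret s: group_hom ?C G s using s by (intro group_homI cyc.group_P gamma.group_P) auto
    have "g = \<one>\<^bsub>G\<^esub>" if g: "g \<in> s ` carrier ?C" "g \<in> Z" for g
    proof -
      obtain w where w: "w \<in> carrier ?C" "g = s w" using g(1) by blast
      have "\<pi> g = \<one>\<^bsub>H\<^esub>" using g(2) by (auto simp: Z_def \<pi>_z)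
      then have "\<phi> w = \<phi> \<one>\<^bsub>?C\<^esub>" using over[OF s w(1)] w(2) by simp
      then have "w = \<one>\<^bsub>?C\<^esub>" using \<phi>_bij w(1) by (auto simp: bij_betw_def inj_on_def)
      then show ?thesis using w(2) by simp
    qed
    moreover have "\<one>\<^bsub>G\<^esub> \<in> s ` carrier ?C" using s.hom_one cyc.P.one_closed by (metis imageI)
    moreover have "\<one>\<^bsub>G\<^esub> \<in> Z" using subgroup.one_closed[OF subgroup_Z] .
    ultimately have "s ` carrier ?C \<inter> Z = {\<one>\<^bsub>G\<^esub>}" by blast
    moreover have "\<pi> ` s ` carrier ?C = D"
      using over[OF s] \<phi>_bij by (simp add: image_image bij_betw_def)
    ultimately show ?thesis
      using s.img_is_subgroup by (simp add: lifts_def)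
  qed
  show "inj_on (\<lambda>s. s ` carrier ?C) ?S"
  proof (rule inj_onI)
    fix s s' assume s: "s \<in> ?S" "s' \<in> ?S" "s ` carrier ?C = s' ` carrier ?C"
    have "inj_on \<pi> (s ` carrier ?C)" using lift[OF s(1)] \<pi>_inj_on by (auto simp: lifts_def)
    then have "s w = s' w" if "w \<in> carrier ?C" for w
      using that over[OF s(1) that] over[OF s(2) that] s(3) by (metis imageI inj_onD)
    then show "s = s'" using s(1,2) by (intro extensionalityI[of _ "carrier ?C"]) auto
  qed
  show "(\<lambda>s. s ` carrier ?C) ` ?S = lifts D"
  proof (intro equalityI subsetI)
    fix \<Delta> assume "\<Delta> \<in> lifts D"
    then have \<Delta>: "subgroup \<Delta> G" "\<Delta> \<inter> Z = {\<one>\<^bsub>G\<^esub>}" "\<pi> ` \<Delta> = D" by (auto simp: lifts_def)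
    have \<Delta>_sub: "\<Delta> \<subseteq> carrier G" by (rule subgroup.subset[OF \<Delta>(1)])
    have inj: "inj_on \<pi> \<Delta>" by (rule \<pi>_inj_on[OF \<Delta>(1,2)])
    define s where "s = (\<lambda>w\<in>carrier ?C. inv_into \<Delta> \<pi> (\<phi> w))"
    have s: "s w \<in> \<Delta>" "\<pi> (s w) = \<phi> w" if "w \<in> carrier ?C" for w
    proof -
      have "\<phi> w \<in> \<pi> ` \<Delta>" using \<phi>_bij that \<Delta>(3) by (auto simp: bij_betw_def)
      then show "s w \<in> \<Delta>" "\<pi> (s w) = \<phi> w"
        using that by (simp_all add: s_def inv_into_into f_inv_into_f)
    qed
    have s_unique: "s w = g" if "w \<in> carrier ?C" "g \<in> \<Delta>" "\<pi> g = \<phi> w" for w g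
      using inj s[OF that(1)] that by (metis inj_onD)
    have hom: "s \<in> hom ?C G"
    proof (rule homI)
      fix v w assume vw: "v \<in> carrier ?C" "w \<in> carrier ?C"
      show "s (v \<otimes>\<^bsub>?C\<^esub> w) = s v \<otimes>\<^bsub>G\<^esub> s w"
        using vw s \<Delta>_sub subgroup.m_closed[OF \<Delta>(1)] by (intro s_unique) (auto simp: subset_iff)
    qed (use s \<Delta>_sub in auto)
    interpret s: group_hom ?C G s by (intro group_homI cyc.group_P gamma.group_P hom)
    have "s (cyc.gen J d j) \<in> A j" if "j \<in> J" for j
      using that s e s.hom_nat_pow[of "cyc.gen J d j" "d j"] cyc_gen_pow[OF that, of d]
      by (simp add: A_def)
    then have "s \<in> ?S" using hom by (simp add: s_def)
    moreover have "s ` carrier ?C = \<Delta>"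
    proof
      show "\<Delta> \<subseteq> s ` carrier ?C"
      proof
        fix g assume g: "g \<in> \<Delta>"
        then obtain w where "w \<in> carrier ?C" "\<pi> g = \<phi> w"
          using \<phi>_bij \<Delta>(3) by (auto simp: bij_betw_def) (metis imageE imageI)
        then show "g \<in> s ` carrier ?C" using s_unique[OF _ g] by blast
      qed
    qed (use s in auto)
    ultimately show "\<Delta> \<in> (\<lambda>s. s ` carrier ?C) ` ?S" by blast
  qed (use lift in blast)
qed

lemma num_homs_lift:
  assumes "\<Delta> \<in> lifts D"
  shows "num_homs (subgrp G \<Delta>) K = num_homs (subgrp H D) K"
proof (rule num_homs_iso)
  have \<Delta>: "subgroup \<Delta> G" "\<Delta> \<inter> Z = {\<one>\<^bsub>G\<^esub>}" "\<pi> ` \<Delta> = D" using assms by (auto simp: lifts_def)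
  show "group (subgrp G \<Delta>)" by (rule subgroup.subgroup_is_group[OF \<Delta>(1) gamma.group_P])
  have "\<pi> \<in> iso (subgrp G \<Delta>) (subgrp H D)"
    using \<Delta> \<pi>_inj_on[OF \<Delta>(1,2)] subgroup.subset[OF \<Delta>(1)]
    by (intro isoI) (auto simp: hom_def bij_betw_def subset_iff)
  then show "subgrp G \<Delta> \<cong> subgrp H D" by (rule is_isoI)
qed

text \<open>If \<open>g ^ r = z\<close>, then \<open>(z ^ i \<otimes> g) ^ r = z ^ (r * i + 1)\<close>. For a prime \<open>r\<close> this is trivial for exactly
  one \<open>i\<close> modulo \<open>m\<close> if \<open>r\<close> does not divide \<open>m\<close>, and for no \<open>i\<close> otherwise.\<close>

lemma card_root_lifts:
  assumes g: "g \<in> carrier G" "g [^]\<^bsub>G\<^esub> r = z" and r: "prime r"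
  shows "card {h \<in> carrier G. \<pi> h = \<pi> g \<and> h [^]\<^bsub>G\<^esub> r = \<one>\<^bsub>G\<^esub>} = (if r dvd m then 0 else 1)"
proof -
  let ?I = "{i. i < m \<and> m dvd r * i + 1}"
  have pow: "(z [^]\<^bsub>G\<^esub> i \<otimes>\<^bsub>G\<^esub> g) [^]\<^bsub>G\<^esub> r = z [^]\<^bsub>G\<^esub> (r * i + 1)" for i :: nat
  proof -
    have "(z [^]\<^bsub>G\<^esub> i \<otimes>\<^bsub>G\<^esub> g) [^]\<^bsub>G\<^esub> r = (z [^]\<^bsub>G\<^esub> i) [^]\<^bsub>G\<^esub> r \<otimes>\<^bsub>G\<^esub> g [^]\<^bsub>G\<^esub> r"
      using g(1) z_pow_central[OF g(1)] by (intro gamma.P.pow_mult_distrib) auto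
    then show ?thesis by (simp add: g(2) gamma.P.nat_pow_pow mult.commute)
  qed
  have "bij_betw (\<lambda>i. z [^]\<^bsub>G\<^esub> i \<otimes>\<^bsub>G\<^esub> g) ?I {h \<in> carrier G. \<pi> h = \<pi> g \<and> h [^]\<^bsub>G\<^esub> r = \<one>\<^bsub>G\<^esub>}"
  proof (rule bij_betw_imageI)
    show "inj_on (\<lambda>i. z [^]\<^bsub>G\<^esub> i \<otimes>\<^bsub>G\<^esub> g) ?I"
      using g(1) z_pow_inj by (auto simp: inj_on_def)
    show "(\<lambda>i. z [^]\<^bsub>G\<^esub> i \<otimes>\<^bsub>G\<^esub> g) ` ?I = {h \<in> carrier G. \<pi> h = \<pi> g \<and> h [^]\<^bsub>G\<^esub> r = \<one>\<^bsub>G\<^esub>}"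
    proof (intro equalityI subsetI)
      fix h assume "h \<in> (\<lambda>i. z [^]\<^bsub>G\<^esub> i \<otimes>\<^bsub>G\<^esub> g) ` ?I"
      then obtain i where i: "m dvd r * i + 1" "h = z [^]\<^bsub>G\<^esub> i \<otimes>\<^bsub>G\<^esub> g" by blast
      have "z [^]\<^bsub>G\<^esub> (r * i + 1) = \<one>\<^bsub>G\<^esub>" using i(1) z_pow_eq_one_iff by blast
      then show "h \<in> {h \<in> carrier G. \<pi> h = \<pi> g \<and> h [^]\<^bsub>G\<^esub> r = \<one>\<^bsub>G\<^esub>}"
        unfolding i(2) mem_Collect_eq pow using g(1) by (simp add: \<pi>_z)
    next
      fix h assume h: "h \<in> {h \<in> carrier G. \<pi> h = \<pi> g \<and> h [^]\<^bsub>G\<^esub> r = \<one>\<^bsub>G\<^esub>}"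
      then obtain i where i: "i < m" "h = z [^]\<^bsub>G\<^esub> i \<otimes>\<^bsub>G\<^esub> g" using \<pi>_eq_iff g(1) by auto
      then have "z [^]\<^bsub>G\<^esub> (r * i + 1) = \<one>\<^bsub>G\<^esub>" using h pow[of i] by simp
      then have "m dvd r * i + 1" using z_pow_eq_one_iff by blast
      then show "h \<in> (\<lambda>i. z [^]\<^bsub>G\<^esub> i \<otimes>\<^bsub>G\<^esub> g) ` ?I" using i by blast
    qed
  qed
  then have "card {h \<in> carrier G. \<pi> h = \<pi> g \<and> h [^]\<^bsub>G\<^esub> r = \<one>\<^bsub>G\<^esub>} = card ?I"
    by (rule bij_betw_same_card[symmetric])
  also have "\<dots> = (if r dvd m then 0 else 1)"
  proof (cases "r dvd m")
    case True
    then have "\<not> m dvd r * i + 1" for i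
      using r by (metis dvd_add_right_iff dvd_trans dvd_triv_left not_prime_unit)
    then show ?thesis using True by simp
  next
    case False
    then have cop: "coprime r m" using r prime_imp_coprime by blast
    obtain e where e: "[r * e = 1] (mod m)" using cong_solve_coprime_nat[OF cop] by (metis One_nat_def)
    have "[r * e * (m - 1) + 1 = 1 * (m - 1) + 1] (mod m)"
      by (intro cong_add cong_mult e cong_refl)
    then have dvd: "m dvd r * (e * (m - 1)) + 1"
      using m by (simp add: cong_def dvd_eq_mod_eq_0 mult.assoc)
    \<comment> \<open>As \<open>e\<close> is inverse to \<open>r\<close>, this solves \<open>r * i = -1\<close> modulo \<open>m\<close>; \<open>m - 1\<close> stands for \<open>-1\<close>.\<close>
    let ?i = "(e * (m - 1)) mod m"
    have "[r * ?i + 1 = r * (e * (m - 1)) + 1] (mod m)"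
      by (intro cong_add cong_mult) (auto simp: cong_def)
    then have i: "?i \<in> ?I" using dvd m by (simp add: cong_dvd_iff)
    have "i = j" if "i \<in> ?I" "j \<in> ?I" for i j
    proof -
      have "[r * i + 1 = r * j + 1] (mod m)"
        using that by (simp add: cong_def dvd_eq_mod_eq_0)
      then have "[r * i = r * j] (mod m)" by (simp only: cong_add_rcancel_nat)
      then have "[i = j] (mod m)" using cop by (simp add: cong_mult_lcancel_nat)
      then show ?thesis using that by (simp add: cong_def)
    qed
    then have "?I = {?i}" using i by blast
    then have "card ?I = card {?i}" by (rule arg_cong)
    then show ?thesis using False by simp
  qed
  finally show ?thesis .
qed

lemma card_all_lifts:
  assumes "h \<in> carrier H"
  shows "card {g \<in> carrier G. \<pi> g = h} = m"
proof -
  obtain g where g: "g \<in> carrier G" "\<pi> g = h" using assms unfolding \<pi>_surj[symmetric] by blast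
  have "{g \<in> carrier G. \<pi> g = h} = (\<lambda>i. z [^]\<^bsub>G\<^esub> i \<otimes>\<^bsub>G\<^esub> g) ` {..<m}"
  proof (intro equalityI subsetI)
    fix k assume "k \<in> {g \<in> carrier G. \<pi> g = h}"
    then show "k \<in> (\<lambda>i. z [^]\<^bsub>G\<^esub> i \<otimes>\<^bsub>G\<^esub> g) ` {..<m}"
      using \<pi>_eq_iff[OF _ g(1), of k] g(2) by auto
  next
    fix k assume "k \<in> (\<lambda>i. z [^]\<^bsub>G\<^esub> i \<otimes>\<^bsub>G\<^esub> g) ` {..<m}"
    then obtain i :: nat where "k = z [^]\<^bsub>G\<^esub> i \<otimes>\<^bsub>G\<^esub> g" by blast
    then show "k \<in> {g \<in> carrier G. \<pi> g = h}"
      using g assms by (simp add: \<pi>_z)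
  qed
  moreover have "inj_on (\<lambda>i::nat. z [^]\<^bsub>G\<^esub> i \<otimes>\<^bsub>G\<^esub> g) {..<m}"
    using g(1) z_pow_inj by (auto simp: inj_on_def)
  ultimately show ?thesis by (simp add: card_image)
qed

end

section \<open>Parity of the number of roots in a finite group\<close>

lemma even_card_involution:
  assumes "finite S" "\<And>x. x \<in> S \<Longrightarrow> f x \<in> S" "\<And>x. x \<in> S \<Longrightarrow> f (f x) = x" "\<And>x. x \<in> S \<Longrightarrow> f x \<noteq> x"
  shows "even (card S)"
  using assms
proof (induction "card S" arbitrary: S rule: less_induct)
  case less
  show ?case
  proof (cases "S = {}")
    case False
    then obtain x where x: "x \<in> S" by blast
    let ?T = "S - {x, f x}"
    have sub: "{x, f x} \<subseteq> S" using x less.prems by auto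
    have card2: "card {x, f x} = 2" using less.prems(4)[OF x] by auto
    then have card: "card S = card ?T + 2"
      using sub less.prems(1) by (metis card_Diff_subset card_mono finite_subset le_add_diff_inverse2)
    have "even (card ?T)"
      by (rule less.hyps) (use card less.prems x in \<open>auto, metis+\<close>)
    then show ?thesis using card by simp
  qed simp
qed

lemma (in group) even_card_square_roots_iff:
  assumes "finite (carrier G)"
  shows "even (card {h \<in> carrier G. h [^] (2::nat) = \<one>}) \<longleftrightarrow> even (order G)"
proof -
  let ?I = "{h \<in> carrier G. h [^] (2::nat) = \<one>}"
  have sq: "h [^] (2::nat) = \<one> \<longleftrightarrow> inv h = h" if "h \<in> carrier G" for h
    using that by (metis inv_equality l_inv nat_pow_Suc nat_pow_0 l_one numeral_2_eq_2)
  have "even (card (carrier G - ?I))"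
    by (rule even_card_involution[where f = "m_inv G"]) (use assms sq in auto)
  moreover have "order G = card (carrier G - ?I) + card ?I"
    using assms card_Diff_subset[of ?I "carrier G"] card_mono[of "carrier G" ?I] by (simp add: order_def)
  ultimately show ?thesis by simp
qed

lemma (in group) odd_card_odd_roots:
  assumes "finite (carrier G)" "odd q"
  shows "odd (card {h \<in> carrier G. h [^] (q::nat) = \<one>})"
proof -
  let ?I = "{h \<in> carrier G. h [^] q = \<one>}"
  have "inv h \<noteq> h" if "h \<in> ?I - {\<one>}" for h
  proof
    assume inv: "inv h = h"
    have h: "h \<in> carrier G" "h [^] q = \<one>" using that by auto
    have "h [^] (2::nat) = \<one>" using h(1) inv r_inv[OF h(1)] by (simp add: numeral_2_eq_2)
    then have "h = h [^] q"
      using pow_mod_exponent[OF h(1), of 2 q] \<open>odd q\<close> h(1) by (simp add: odd_iff_mod_2_eq_one)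
    then show False using h that by simp
  qed
  then have "even (card (?I - {\<one>}))"
    by (intro even_card_involution[where f = "m_inv G"]) (use assms in \<open>auto simp: nat_pow_inv\<close>)
  moreover have "card ?I = Suc (card (?I - {\<one>}))"
    by (rule card.remove) (use assms(1) in auto)
  ultimately show ?thesis by (simp only: even_Suc not_not)
qed

section \<open>The sum over the subgroups modulo two\<close>

context central_extension
begin

lemma card_basis_lifts:
  assumes "e \<in> carrier H" "d \<in> {0, 2, q}"
    and "d = 2 \<Longrightarrow> \<exists>g\<in>carrier H. e = inv\<^bsub>H\<^esub> g \<otimes>\<^bsub>H\<^esub> (hx q \<otimes>\<^bsub>H\<^esub> g)"
    and "d = q \<Longrightarrow> \<exists>g\<in>carrier H. e = inv\<^bsub>H\<^esub> g \<otimes>\<^bsub>H\<^esub> (hy q \<otimes>\<^bsub>H\<^esub> g)"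
  shows "card {g \<in> carrier G. \<pi> g = e \<and> g [^]\<^bsub>G\<^esub> d = \<one>\<^bsub>G\<^esub>} =
    (if d = 0 then m else if d dvd m then 0 else 1)"
proof -
  have conj: "card {g \<in> carrier G. \<pi> g = e \<and> g [^]\<^bsub>G\<^esub> r = \<one>\<^bsub>G\<^esub>} = (if r dvd m then 0 else 1)"
    if r: "prime r" and c: "c \<in> carrier G" "c [^]\<^bsub>G\<^esub> r = z"
      and e: "\<exists>g\<in>carrier H. e = inv\<^bsub>H\<^esub> g \<otimes>\<^bsub>H\<^esub> (\<pi> c \<otimes>\<^bsub>H\<^esub> g)" for r c
  proof -
    obtain w where w: "w \<in> carrier G" "e = inv\<^bsub>H\<^esub> (\<pi> w) \<otimes>\<^bsub>H\<^esub> (\<pi> c \<otimes>\<^bsub>H\<^esub> \<pi> w)"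
      using e unfolding \<pi>_surj[symmetric] by blast
    let ?g = "inv\<^bsub>G\<^esub> w \<otimes>\<^bsub>G\<^esub> (c \<otimes>\<^bsub>G\<^esub> w)"
    have "?g [^]\<^bsub>G\<^esub> r = inv\<^bsub>G\<^esub> w \<otimes>\<^bsub>G\<^esub> (z \<otimes>\<^bsub>G\<^esub> w)"
      using w(1) c by (simp add: gamma.P.conj_pow)
    also have "\<dots> = z" using w(1) by (simp add: z_central gamma.P.m_assoc[symmetric])
    finally have "?g [^]\<^bsub>G\<^esub> r = z" .
    moreover have "\<pi> ?g = e" using w c by simp
    ultimately show ?thesis using card_root_lifts[of ?g r] w(1) c(1) r by simp
  qed
  consider "d = 0" | "d = 2" | "d = q" using assms(2) by blast
  then show ?thesis
  proof cases
    case 1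
    then show ?thesis using card_all_lifts[OF assms(1)] by simp
  next
    case 2
    then show ?thesis using conj[of 2 X] assms(3) by (simp add: X_pow \<pi>)
  next
    case 3
    then show ?thesis using conj[of q Y] assms(4) q by (auto simp: Y_pow \<pi>)
  qed
qed

text \<open>Both the number of lifts of \<open>D\<close> and the number of homomorphisms from \<open>D\<close> to \<open>K\<close> are products over
  a basis of \<open>D\<close>, and the parity of their product is read off from the factors.\<close>

lemma subgroup_parity:
  assumes D: "D \<in> subgroups_of_index H k" "k \<ge> 1" and K: "group K" "finite (carrier K)"
  obtains J :: "(gen word set set + gen word set set) set" and d
  where "finite J" "J \<noteq> {}" "\<And>j. j \<in> J \<Longrightarrow> d j \<in> {0, 2, q}" "cyc J d \<cong> subgrp H D" "finite (lifts D)"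
    "odd (card (lifts D) * num_homs (subgrp H D) K) \<longleftrightarrow>
      (\<forall>j\<in>J. if d j = q then \<not> q dvd m else odd m \<and> odd (order K))"
proof -
  have sub: "subgroup D H" using D by (simp add: subgroups_of_index_def)
  have "q \<noteq> 2" using q by auto
  interpret act: transitive_action q "rcosets\<^bsub>H\<^esub> D" "\<lambda>w p. p #>\<^bsub>H\<^esub> inv\<^bsub>H\<^esub> w" D
    by (rule coset_action(1)[OF q(1) D])
  obtain J :: "(gen word set set + gen word set set) set" and d e \<phi>
    where J: "finite J" "J \<noteq> {}"
      and d: "\<And>j. j \<in> J \<Longrightarrow> d j \<in> {0, 2, q}"
      and e: "\<And>j. j \<in> J \<Longrightarrow> e j \<in> D"
      and e2: "\<And>j. j \<in> J \<Longrightarrow> d j = 2 \<Longrightarrow> \<exists>g\<in>carrier H. e j = inv\<^bsub>H\<^esub> g \<otimes>\<^bsub>H\<^esub> (hx q \<otimes>\<^bsub>H\<^esub> g)"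
      and eq: "\<And>j. j \<in> J \<Longrightarrow> d j = q \<Longrightarrow> \<exists>g\<in>carrier H. e j = inv\<^bsub>H\<^esub> g \<otimes>\<^bsub>H\<^esub> (hy q \<otimes>\<^bsub>H\<^esub> g)"
      and \<phi>: "\<phi> \<in> iso (cyc J d) (subgrp H D)" "\<And>j. j \<in> J \<Longrightarrow> \<phi> (cyc.gen J d j) = e j"
    using act.stab_basis[OF \<open>q \<noteq> 2\<close>] unfolding coset_action(2)[OF q(1) D] by blast
  define A where "A = (\<lambda>j. {g \<in> carrier G. \<pi> g = e j \<and> g [^]\<^bsub>G\<^esub> d j = \<one>\<^bsub>G\<^esub>})"
  let ?S = "{s \<in> hom (cyc J d) G \<inter> extensional (carrier (cyc J d)). \<forall>j\<in>J. s (cyc.gen J d j) \<in> A j}"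
  have e_closed: "e j \<in> carrier H" if "j \<in> J" for j using e[OF that] subgroup.subset[OF sub] by blast
  have card_A: "card (A j) = (if d j = 0 then m else if d j dvd m then 0 else 1)" if "j \<in> J" for j
    unfolding A_def using that by (intro card_basis_lifts e_closed d e2 eq)
  have fin_A: "finite (A j)" if "j \<in> J" for j
  proof (rule finite_subset)
    show "A j \<subseteq> {g \<in> carrier G. \<pi> g = e j}" by (auto simp: A_def)
    show "finite {g \<in> carrier G. \<pi> g = e j}"
      by (rule card_ge_0_finite) (use card_all_lifts[OF e_closed[OF that]] m in simp)
  qed
  have A_roots: "A j \<subseteq> {g \<in> carrier G. g [^]\<^bsub>G\<^esub> d j = \<one>\<^bsub>G\<^esub>}" for j by (auto simp: A_def)
  have lifts: "bij_betw (\<lambda>s. s ` carrier (cyc J d)) ?S (lifts D)"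
    unfolding A_def by (rule bij_betw_lifts[OF sub \<phi>])
  have "bij_betw (\<lambda>s. restrict (\<lambda>j. s (cyc.gen J d j)) J) ?S (PiE J A)"
    by (rule bij_betw_cyc_homs[OF gamma.group_P A_roots])
  then have "finite ?S" using fin_A J(1) by (simp add: bij_betw_finite finite_PiE)
  then have fin: "finite (lifts D)" using lifts by (simp add: bij_betw_finite)
  have "card (lifts D) = (\<Prod>j\<in>J. card (A j))"
    using bij_betw_same_card[OF lifts] card_cyc_homs[OF gamma.group_P J(1) A_roots] by simp
  moreover have iso: "cyc J d \<cong> subgrp H D" using \<phi>(1) by (rule is_isoI)
  have "num_homs (subgrp H D) K = (\<Prod>j\<in>J. card {h \<in> carrier K. h [^]\<^bsub>K\<^esub> d j = \<one>\<^bsub>K\<^esub>})"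
    using num_homs_iso[OF cyc.group_P iso, of K] num_homs_cyc[OF K(1) J(1), of d] by simp
  ultimately have prod: "card (lifts D) * num_homs (subgrp H D) K
      = (\<Prod>j\<in>J. card (A j) * card {h \<in> carrier K. h [^]\<^bsub>K\<^esub> d j = \<one>\<^bsub>K\<^esub>})"
    by (simp add: prod.distrib)
  have factor: "odd (card (A j) * card {h \<in> carrier K. h [^]\<^bsub>K\<^esub> d j = \<one>\<^bsub>K\<^esub>}) \<longleftrightarrow>
      (if d j = q then \<not> q dvd m else odd m \<and> odd (order K))" if j: "j \<in> J" for j
  proof -
    have "q > 0" using prime_gt_0_nat[OF q(1)] .
    have roots0: "{h \<in> carrier K. h [^]\<^bsub>K\<^esub> (0::nat) = \<one>\<^bsub>K\<^esub>} = carrier K" by simp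
    consider "d j = 0" | "d j = 2" | "d j = q" using d[OF j] by auto
    then show ?thesis
    proof cases
      case 1
      then show ?thesis using card_A[OF j] \<open>q > 0\<close> by (simp add: order_def)
    next
      case 2
      then show ?thesis
        using card_A[OF j] \<open>q \<noteq> 2\<close> group.even_card_square_roots_iff[OF K] by simp
    next
      case 3
      then show ?thesis
        using card_A[OF j] \<open>q > 0\<close> group.odd_card_odd_roots[OF K q(2)] by simp
    qed
  qed
  have "odd (card (lifts D) * num_homs (subgrp H D) K) \<longleftrightarrow>
      (\<forall>j\<in>J. if d j = q then \<not> q dvd m else odd m \<and> odd (order K))"
    unfolding prod even_prod_iff[OF J(1)] using factor by blast
  then show ?thesis using that[OF J d iso fin] by blast
qed

lemma odd_lifts_homs:
  assumes D: "D \<in> subgroups_of_index H k" "k \<ge> 1" and K: "group K" "finite (carrier K)"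
  defines "f \<equiv> card (lifts D) * num_homs (subgrp H D) K"
  shows "\<not> q dvd m \<Longrightarrow> odd m \<and> odd (order K) \<Longrightarrow> odd f"
    and "\<not> q dvd m \<Longrightarrow> \<not> (odd m \<and> odd (order K)) \<Longrightarrow>
      odd f \<longleftrightarrow> (\<exists>u. subgrp H D \<cong> free_power (integer_mod_group q) u)"
    and "q dvd m \<Longrightarrow> odd m \<and> odd (order K) \<Longrightarrow> odd f \<longleftrightarrow> (\<exists>l v. subgrp H D \<cong> kurosh_product q l 0 v)"
    and "q dvd m \<Longrightarrow> \<not> (odd m \<and> odd (order K)) \<Longrightarrow> even f"
    and "finite (lifts D)"
proof -
  obtain J :: "(gen word set set + gen word set set) set" and d
    where J: "finite J" "J \<noteq> {}" and d: "\<And>j. j \<in> J \<Longrightarrow> d j \<in> {0, 2, q}"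
      and iso: "cyc J d \<cong> subgrp H D" and fin: "finite (lifts D)"
      and odd: "odd f \<longleftrightarrow> (\<forall>j\<in>J. if d j = q then \<not> q dvd m else odd m \<and> odd (order K))"
    unfolding f_def by (rule subgroup_parity[OF D K]) blast
  have N: "(\<exists>u. subgrp H D \<cong> free_power (integer_mod_group q) u) \<longleftrightarrow> (\<forall>j\<in>J. d j = q)"
    by (rule iso_free_power_iff[OF J(1) _ q iso]) (rule d)
  have M: "(\<exists>l v. subgrp H D \<cong> kurosh_product q l 0 v) \<longleftrightarrow> (\<forall>j\<in>J. d j \<noteq> q)"
    by (rule iso_kurosh_no_q_iff[OF J(1) _ q iso]) (rule d)
  show "\<not> q dvd m \<Longrightarrow> odd m \<and> odd (order K) \<Longrightarrow> odd f" unfolding odd by simp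
  show "odd f \<longleftrightarrow> (\<exists>u. subgrp H D \<cong> free_power (integer_mod_group q) u)"
    if "\<not> q dvd m" "\<not> (odd m \<and> odd (order K))"
    unfolding odd N using that by auto
  show "odd f \<longleftrightarrow> (\<exists>l v. subgrp H D \<cong> kurosh_product q l 0 v)"
    if "q dvd m" "odd m \<and> odd (order K)"
    unfolding odd M using that by auto
  show "even f" if "q dvd m" "\<not> (odd m \<and> odd (order K))"
  proof -
    obtain j where "j \<in> J" using J(2) by blast
    then have "\<not> (\<forall>j\<in>J. if d j = q then \<not> q dvd m else odd m \<and> odd (order K))"
      using that by (metis (full_types))
    then show ?thesis using odd by blast
  qed
  show "finite (lifts D)" by (rule fin)
qed

lemma complement_index:
  assumes "n \<ge> 1" and \<Delta>: "\<Delta> \<in> subgroups_of_index G n" "\<Delta> \<inter> Z = {\<one>\<^bsub>G\<^esub>}"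
  shows "m dvd n" "\<pi> ` \<Delta> \<in> subgroups_of_index H (n div m)" "\<Delta> \<in> lifts (\<pi> ` \<Delta>)"
proof -
  have sub: "subgroup \<Delta> G" and "card (rcosets\<^bsub>G\<^esub> \<Delta>) = n"
    using \<Delta>(1) by (auto simp: subgroups_of_index_def)
  then have n: "n = m * card (rcosets\<^bsub>H\<^esub> (\<pi> ` \<Delta>))"
    using card_rcosets_complement[OF sub \<Delta>(2)] by simp
  then show "m dvd n" by simp
  show "\<pi> ` \<Delta> \<in> subgroups_of_index H (n div m)"
    using n m \<pi>.subgroup_img_is_subgroup[OF sub] by (simp add: subgroups_of_index_def)
  show "\<Delta> \<in> lifts (\<pi> ` \<Delta>)" using sub \<Delta>(2) by (simp add: lifts_def)
qed

lemma s_Gamma_not_dvd: "n \<ge> 1 \<Longrightarrow> \<not> m dvd n \<Longrightarrow> s_Gamma m q K n = 0"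
  unfolding s_Gamma_def generate_z using complement_index(1) by (intro sum.neutral) blast

lemma s_Gamma_eq:
  assumes "n \<ge> 1" "m dvd n" and K: "group K" "finite (carrier K)"
  shows "s_Gamma m q K n =
    (\<Sum>D\<in>subgroups_of_index H (n div m). card (lifts D) * num_homs (subgrp H D) K)"
proof -
  let ?I = "subgroups_of_index H (n div m)"
  have k: "n div m \<ge> 1" using assms(1,2) m by (auto elim!: dvdE)
  have "{\<Delta>. \<Delta> \<in> subgroups_of_index G n \<and> \<Delta> \<inter> Z = {\<one>\<^bsub>G\<^esub>}} = (\<Union>D\<in>?I. lifts D)"
  proof (intro equalityI subsetI)
    fix \<Delta> assume "\<Delta> \<in> {\<Delta>. \<Delta> \<in> subgroups_of_index G n \<and> \<Delta> \<inter> Z = {\<one>\<^bsub>G\<^esub>}}"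
    then show "\<Delta> \<in> (\<Union>D\<in>?I. lifts D)" using complement_index(2,3)[OF assms(1)] by blast
  next
    fix \<Delta> assume "\<Delta> \<in> (\<Union>D\<in>?I. lifts D)"
    then have "subgroup \<Delta> G" "\<Delta> \<inter> Z = {\<one>\<^bsub>G\<^esub>}" "\<pi> ` \<Delta> \<in> ?I" by (auto simp: lifts_def)
    then show "\<Delta> \<in> {\<Delta>. \<Delta> \<in> subgroups_of_index G n \<and> \<Delta> \<inter> Z = {\<one>\<^bsub>G\<^esub>}}"
      using card_rcosets_complement[of \<Delta>] assms(2) by (simp add: subgroups_of_index_def)
  qed
  then have "s_Gamma m q K n = (\<Sum>\<Delta>\<in>(\<Union>D\<in>?I. lifts D). num_homs (subgrp G \<Delta>) K)"
    by (simp add: s_Gamma_def generate_z)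
  also have "\<dots> = (\<Sum>D\<in>?I. \<Sum>\<Delta>\<in>lifts D. num_homs (subgrp G \<Delta>) K)"
  proof (rule sum.UNION_disjoint)
    show "finite ?I" by (rule finite_subgroups_of_index[OF q(1) k])
    show "\<forall>D\<in>?I. finite (lifts D)" using odd_lifts_homs(5)[OF _ k K] by blast
  qed (auto simp: lifts_def)
  also have "\<dots> = (\<Sum>D\<in>?I. card (lifts D) * num_homs (subgrp H D) K)"
  proof (rule sum.cong[OF HOL.refl])
    fix D
    have "(\<Sum>\<Delta>\<in>lifts D. num_homs (subgrp G \<Delta>) K) = (\<Sum>\<Delta>\<in>lifts D. num_homs (subgrp H D) K)"
      by (intro sum.cong HOL.refl num_homs_lift)
    then show "(\<Sum>\<Delta>\<in>lifts D. num_homs (subgrp G \<Delta>) K) = card (lifts D) * num_homs (subgrp H D) K"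
      by simp
  qed
  finally show ?thesis .
qed

end

theorem proposition1:
  fixes m n q :: nat and H :: "('h, 'k) monoid_scheme"
  assumes "m \<ge> 1" and "n \<ge> 1"
    and "prime q" and "odd q"
    and "group H" and "finite (carrier H)"
  shows "[s_Gamma m q H n =
    (if 2 dvd m \<and> m dvd n \<and> \<not> q dvd m then N_q q (n div m)
     else if \<not> 2 dvd m \<and> \<not> q dvd m \<and> m dvd n \<and> \<not> 2 dvd order H then s_q q (n div m)
     else if \<not> 2 dvd m \<and> \<not> q dvd m \<and> m dvd n \<and> 2 dvd order H then N_q q (n div m)
     else if q dvd m \<and> m dvd n \<and> \<not> 2 dvd m \<and> \<not> 2 dvd order H then M_q q (n div m)
     else 0)] (mod 2)"
proof (cases "m dvd n")
  case False
  interpret central_extension m q by unfold_locales (use assms in auto)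
  show ?thesis using False by (simp add: s_Gamma_not_dvd[OF assms(2)])
next
  case True
  interpret central_extension m q by unfold_locales (use assms in auto)
  define k where "k = n div m"
  define I where "I = subgroups_of_index (Hecke q) k"
  define f where "f = (\<lambda>D. card (lifts D) * num_homs (subgrp (Hecke q) D) H)"
  have k: "k \<ge> 1" using True assms(1,2) by (auto simp: k_def elim!: dvdE)
  have fin: "finite I" unfolding I_def by (rule finite_subgroups_of_index[OF assms(3) k])
  have sum: "s_Gamma m q H n = sum f I"
    using s_Gamma_eq[OF assms(2) True assms(5,6)] by (simp add: I_def k_def f_def)
  have parity: "[s_Gamma m q H n = card {D \<in> I. odd (f D)}] (mod 2)"
    using even_sum_iff[OF fin, of f] by (simp add: sum cong_def mod2_eq_if)
  note odd_f = odd_lifts_homs[OF _ k assms(5,6), folded I_def f_def]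
  define p where "p \<longleftrightarrow> odd m \<and> odd (order H)"
  consider "\<not> q dvd m" p | "\<not> q dvd m" "\<not> p" | "q dvd m" p | "q dvd m" "\<not> p" by blast
  then show ?thesis
  proof cases
    case 1
    then have "{D \<in> I. odd (f D)} = I" using odd_f(1) by (auto simp: p_def f_def)
    then show ?thesis using parity 1 True by (simp add: s_q_def I_def p_def k_def)
  next
    case 2
    then have "{D \<in> I. odd (f D)} = {D \<in> I. \<exists>u. subgrp (Hecke q) D \<cong> free_power (integer_mod_group q) u}"
      using odd_f(2) by (auto simp: p_def f_def)
    then have "[s_Gamma m q H n = N_q q k] (mod 2)" using parity by (simp add: N_q_def I_def)
    then show ?thesis using 2 True by (auto simp: p_def k_def)
  next
    case 3
    then have "{D \<in> I. odd (f D)} = {D \<in> I. \<exists>l v. subgrp (Hecke q) D \<cong> kurosh_product q l 0 v}"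
      using odd_f(3) by (auto simp: p_def f_def)
    then have "[s_Gamma m q H n = M_q q k] (mod 2)" using parity by (simp add: M_q_def I_def)
    then show ?thesis using 3 True by (auto simp: p_def k_def)
  next
    case 4
    then have "{D \<in> I. odd (f D)} = {}" using odd_f(4) by (auto simp: p_def f_def)
    then have "card {D \<in> I. odd (f D)} = 0" by (simp only: card.empty)
    then have "[s_Gamma m q H n = 0] (mod 2)" using parity by (simp only:)
    then show ?thesis using 4 True by (auto simp: p_def)
  qed
qed

end
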